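(* Every optimal design $\theta$ is continuous on $[0,1]$ (i.e. has a continuous representative), and either $\theta\equiv0$ or there are $0\le t_0<t_1<1$ such that: (1) if $t_0>0$ then $\theta=1$ on $(0,t_0)$; (2) $\theta$ is nonzero and strictly decreasing on $(t_0,t_1)$; (3) $\theta=0$ on $[t_1,1]$. Moreover, $\theta\in C^\infty(t_0,t_1)$.
   Context: Let $0<a<b$ and $c_l>0$ be constants. Let $W^{1,2}_l(0,1)=\{K\in W^{1,2}(0,1):K(0)=0\}$. For $B\in L^\infty((0,1);[a,b])$ let $K[B]\in W^{1,2}_l(0,1)$ be the unique global minimiser over $W^{1,2}_l(0,1)$ of $$K\mapsto\frac12\int_0^1B(t)(K'(t))^2\,dt+\int_0^1(1-t)\sin K(t)\,dt$$ (existence and uniqueness of this minimiser are known). It solves the state equation $(BK[B]')'=(1-t)\cos K[B]$ in the dual space of $W^{1,2}_l(0,1)$ (which encodes $K[B](0)=0$ and the natural condition $K[B]'(1)=0$) and takes values in $(-\pi/2,0]$. For $\theta\in L^\infty((0,1);[0,1])$ set $B_\theta=(1-\theta)a+\theta b$ and $$\widehat{\mathcal{J}}[\theta]=-\int_0^1(1-t)\sin K[B_\theta](t)\,dt+c_l\int_0^1\theta(t)\,dt.$$ A function $\theta\in L^\infty((0,1);[0,1])$ is called an optimal design if it is a minimiser of $\widehat{\mathcal{J}}$ on $L^\infty((0,1);[0,1])$. *)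

theory Defs
  imports "HOL-Analysis.Analysis"
begin

text \<open>All function spaces live on the open interval \<open>(0,1)\<close> with Lebesgue measure.  Elements of
  \<open>L\<^sup>2\<close> and \<open>L\<^sup>\<infinity>\<close> are represented by Lebesgue measurable functions \<open>real \<Rightarrow> real\<close>; what such
  a function does outside \<open>(0,1)\<close> or on a null set is irrelevant.\<close>

abbreviation leb01 :: "real measure" where
  "leb01 \<equiv> lebesgue_on {0<..<1}"

text \<open>To be used for open \<open>S\<close> only: \<open>f\<close> is infinitely often differentiable at the points of \<open>S\<close>.\<close>

definition smooth_on :: "real set \<Rightarrow> (real \<Rightarrow> real) \<Rightarrow> bool" where
  "smooth_on S f \<longleftrightarrow> (\<forall>n. \<forall>x\<in>S. (deriv ^^ n) f differentiable (at x))"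

definition L2 :: "(real \<Rightarrow> real) set" where
  "L2 = {f \<in> borel_measurable leb01. integrable leb01 (\<lambda>t. (f t)\<^sup>2)}"

text \<open>A closed subset of \<open>(0,1)\<close> is compact, so these are the elements of \<open>C\<^sub>c\<^sup>\<infinity>(0,1)\<close>,
  extended by zero.\<close>

definition test_functions :: "(real \<Rightarrow> real) set" where
  "test_functions = {\<phi>. smooth_on UNIV \<phi> \<and> closure {t. \<phi> t \<noteq> 0} \<subseteq> {0<..<1}}"

definition is_weak_deriv :: "(real \<Rightarrow> real) \<Rightarrow> (real \<Rightarrow> real) \<Rightarrow> bool" where
  "is_weak_deriv K g \<longleftrightarrow>
     (\<forall>\<phi>\<in>test_functions.
        integral\<^sup>L leb01 (\<lambda>t. K t * deriv \<phi> t) = - integral\<^sup>L leb01 (\<lambda>t. g t * \<phi> t))"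

text \<open>The space \<open>{K \<in> W\<^sup>1\<^sup>,\<^sup>2(0,1). K(0) = 0}\<close>.  The trace at \<open>0\<close> refers to the continuous
  representative on \<open>[0,1]\<close>, so each class is represented by that function.  The value \<open>0\<close> outside
  \<open>[0,1]\<close> is a normalisation which makes the representing function unique.\<close>

definition W12l :: "(real \<Rightarrow> real) set" where
  "W12l = {K. continuous_on {0..1} K \<and> (\<forall>t. t \<notin> {0..1} \<longrightarrow> K t = 0)
              \<and> K \<in> L2 \<and> (\<exists>g\<in>L2. is_weak_deriv K g) \<and> K 0 = 0}"

text \<open>The choice is immaterial: weak derivatives are unique almost everywhere on \<open>(0,1)\<close>.\<close>

definition weak_deriv :: "(real \<Rightarrow> real) \<Rightarrow> real \<Rightarrow> real" where
  "weak_deriv K = (SOME g. g \<in> L2 \<and> is_weak_deriv K g)"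

definition energy :: "(real \<Rightarrow> real) \<Rightarrow> (real \<Rightarrow> real) \<Rightarrow> real" where
  "energy B K = 1/2 * integral\<^sup>L leb01 (\<lambda>t. B t * (weak_deriv K t)\<^sup>2)
                + integral\<^sup>L leb01 (\<lambda>t. (1 - t) * sin (K t))"

text \<open>For measurable \<open>B\<close> with values in \<open>[a,b]\<close>, \<open>0 < a\<close>, the global minimiser exists and is unique.\<close>

definition state :: "(real \<Rightarrow> real) \<Rightarrow> real \<Rightarrow> real" where
  "state B = (THE K. is_arg_min (energy B) (\<lambda>K. K \<in> W12l) K)"

definition designs :: "(real \<Rightarrow> real) set" where
  "designs = {\<theta> \<in> borel_measurable leb01. AE t in leb01. \<theta> t \<in> {0..1}}"

definition stiffness :: "real \<Rightarrow> real \<Rightarrow> (real \<Rightarrow> real) \<Rightarrow> real \<Rightarrow> real" where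
  "stiffness a b \<theta> t = (1 - \<theta> t) * a + \<theta> t * b"

definition objective :: "real \<Rightarrow> real \<Rightarrow> real \<Rightarrow> (real \<Rightarrow> real) \<Rightarrow> real" where
  "objective a b c\<^sub>l \<theta> =
     - integral\<^sup>L leb01 (\<lambda>t. (1 - t) * sin (state (stiffness a b \<theta>) t))
     + c\<^sub>l * integral\<^sup>L leb01 \<theta>"

definition optimal_design :: "real \<Rightarrow> real \<Rightarrow> real \<Rightarrow> (real \<Rightarrow> real) \<Rightarrow> bool" where
  "optimal_design a b c\<^sub>l \<theta> \<longleftrightarrow> is_arg_min (objective a b c\<^sub>l) (\<lambda>\<theta>. \<theta> \<in> designs) \<theta>"

end

theory Submission
  imports Defs
begin

text \<open>Write \<open>U = BK'\<close> and let \<open>P\<close>, with flux \<open>V = BP'\<close>, solve the adjoint equation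
  \<open>V' = (1 - t)(cos K - P sin K)\<close>, \<open>P 0 = 0\<close>, \<open>V 1 = 0\<close>.  The derivative of the objective in the
  direction \<open>\<eta> - \<theta>\<close> is \<open>\<integral>(\<eta> - \<theta>)(c - (b - a) U V / B\<^sup>2)\<close>.  Since \<open>U V / B\<^sup>2\<close> decreases in \<open>B\<close>, the
  sign of the switching function determines the stiffness pointwise: \<open>B\<close> is the value of
  \<open>sqrt ((b - a) U V / c)\<close> clamped to \<open>[a,b]\<close>.  It remains to see that \<open>U V\<close> is strictly decreasing
  where it is positive.  As \<open>U < 0\<close> is nondecreasing, this amounts to \<open>V' > 0\<close> where \<open>V \<le> 0\<close>: if
  \<open>cos K - P sin K \<le> 0\<close> at such a point, then \<open>P - cot K\<close> is nonpositive there and decreases from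
  there on, so \<open>V\<close> decreases too and cannot reach \<open>V 1 = 0\<close>.  Smoothness follows by bootstrapping
  the system for \<open>K\<close>, \<open>U\<close>, \<open>P\<close>, \<open>V\<close>, which is polynomial in these functions, \<open>sin K\<close>, \<open>cos K\<close> and
  \<open>1 / B\<close>.

  The state equation is solved by shooting.  A solution minimises the energy by calibration: for a
  competitor \<open>L\<close> with derivative \<open>g\<close> one has \<open>B g\<^sup>2 / 2 \<ge> U G'(L) g - U\<^sup>2 / (2 B)\<close> for every 1-Lipschitz
  \<open>G\<close>, and with \<open>G\<close> as in \<open>fold_angle\<close> integration by parts leaves only a tangent inequality for the
  sine.\<close>

section \<open>Iterated differentiability and a smooth step function\<close>

text \<open>The stiffness \<open>B\<close> is only measurable, so \<open>K\<close> need not be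
  classically differentiable, whereas its flux is, having a continuous source. Hence every equation
  is stated for a pair (angle, flux) in integrated form, and classical derivatives return only once
  optimality has produced a continuous representative of \<open>B\<close>. Since
  \<open>state\<close> is a definite description over a space defined by test functions, minimality
  has to come with uniqueness, against competitors with arbitrary range. This is why a Sobolev
  function must first be recognised as an integral of its weak derivative, and why angles outside
  [-pi/2, 0] are folded. One sign carries the analysis: on [-pi/2, 0] the sine is convex and the
  cosine is nondecreasing. Convexity gives the tangent inequality of the calibration. Monotonicity
  bounds the difference of two states by the difference of their stiffnesses, and the corresponding
  sign of the sine makes the adjoint problem solvable. The objective can then be expanded along a
  segment of designs with an explicit quadratic remainder, without an implicit function
  theorem.\<close>

definition ntimes_diff_on :: "nat \<Rightarrow> real set \<Rightarrow> (real \<Rightarrow> real) \<Rightarrow> bool" where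
  "ntimes_diff_on n S f \<longleftrightarrow> (\<forall>i<n. \<forall>x\<in>S. (deriv ^^ i) f differentiable (at x))"

lemma smooth_on_iff: "smooth_on S f \<longleftrightarrow> (\<forall>n. ntimes_diff_on n S f)"
  unfolding smooth_on_def ntimes_diff_on_def by auto

lemma ntimes_diff_on_0 [simp]: "ntimes_diff_on 0 S f"
  by (simp add: ntimes_diff_on_def)

lemma ntimes_diff_on_Suc:
  "ntimes_diff_on (Suc n) S f \<longleftrightarrow>
     (\<forall>x\<in>S. f differentiable (at x)) \<and> ntimes_diff_on n S (deriv f)"
proof -
  have "(\<forall>i<Suc n. Q i) \<longleftrightarrow> Q 0 \<and> (\<forall>i<n. Q (Suc i))" for Q
    using less_Suc_eq_0_disj by auto
  then show ?thesis
    unfolding ntimes_diff_on_def by (simp add: funpow_swap1)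
qed

text \<open>Near a point of the open set \<open>S\<close> both functions agree, so their derivatives
  agree on \<open>S\<close> again and the argument repeats. What happens outside \<open>S\<close>
  has no influence.\<close>

lemma ntimes_diff_on_cong:
  assumes "open S" "\<And>x. x \<in> S \<Longrightarrow> f x = g x" "ntimes_diff_on n S f"
  shows "ntimes_diff_on n S g"
  using assms(2,3)
proof (induction n arbitrary: f g)
  case (Suc n)
  have "(g has_real_derivative deriv f x) (at x)" if "x \<in> S" for x
  proof -
    have "(f has_real_derivative deriv f x) (at x)"
      using Suc.prems that by (simp add: DERIV_deriv_iff_real_differentiable ntimes_diff_on_Suc)
    then show ?thesis
      using has_field_derivative_transform_within_open[OF _ \<open>open S\<close> that] Suc.prems by blast
  qed
  then have "\<forall>x\<in>S. g differentiable (at x)" "\<And>x. x \<in> S \<Longrightarrow> deriv f x = deriv g x"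
    by (auto simp: real_differentiable_def) (metis DERIV_imp_deriv)
  moreover have "ntimes_diff_on n S (deriv f)"
    using Suc.prems by (simp add: ntimes_diff_on_Suc)
  ultimately show ?case
    using Suc.IH[of "deriv f" "deriv g"] by (simp add: ntimes_diff_on_Suc)
qed simp

text \<open>Any expression \<open>f'\<close> that is a derivative on \<open>S\<close> may replace
  \<open>deriv f\<close>. The closure rules and the final bootstrap are inductions on
  \<open>n\<close> through this rule: a formula for the derivative is enough to climb one
  level.\<close>

lemma ntimes_diff_on_SucI:
  assumes "open S" "\<And>x. x \<in> S \<Longrightarrow> (f has_real_derivative f' x) (at x)" "ntimes_diff_on n S f'"
  shows "ntimes_diff_on (Suc n) S f"
proof -
  have "ntimes_diff_on n S (deriv f)"
    by (rule ntimes_diff_on_cong[OF assms(1) _ assms(3)]) (metis DERIV_imp_deriv assms(2))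
  then show ?thesis
    using assms(2) by (auto simp: ntimes_diff_on_Suc real_differentiable_def)
qed

lemma ntimes_diff_on_SucD:
  assumes "ntimes_diff_on (Suc n) S f"
  shows "ntimes_diff_on n S f" "ntimes_diff_on n S (deriv f)"
    "x \<in> S \<Longrightarrow> (f has_real_derivative deriv f x) (at x)"
proof -
  show "ntimes_diff_on n S f" using assms by (simp add: ntimes_diff_on_def)
qed (use assms in \<open>simp_all add: DERIV_deriv_iff_real_differentiable ntimes_diff_on_Suc\<close>)

lemma ntimes_diff_on_const: "ntimes_diff_on n S (\<lambda>x. c)"
proof (induction n arbitrary: c)
  case (Suc n)
  then show ?case by (simp add: ntimes_diff_on_Suc)
qed simp

lemma ntimes_diff_on_ident: "open S \<Longrightarrow> ntimes_diff_on n S (\<lambda>x. x)"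
  by (cases n) (auto intro!: ntimes_diff_on_SucI derivative_eq_intros ntimes_diff_on_const)

lemma ntimes_diff_on_add:
  assumes "open S" "ntimes_diff_on n S f" "ntimes_diff_on n S g"
  shows "ntimes_diff_on n S (\<lambda>x. f x + g x)"
  using assms(2,3)
proof (induction n arbitrary: f g)
  case (Suc n)
  note D = ntimes_diff_on_SucD[OF Suc.prems(1)] ntimes_diff_on_SucD[OF Suc.prems(2)]
  show ?case
    by (rule ntimes_diff_on_SucI[OF \<open>open S\<close>, where f' = "\<lambda>x. deriv f x + deriv g x"])
       (auto intro!: Suc.IH derivative_intros D)
qed simp

lemma ntimes_diff_on_mult:
  assumes "open S" "ntimes_diff_on n S f" "ntimes_diff_on n S g"
  shows "ntimes_diff_on n S (\<lambda>x. f x * g x)"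
  using assms(2,3)
proof (induction n arbitrary: f g)
  case (Suc n)
  note D = ntimes_diff_on_SucD[OF Suc.prems(1)] ntimes_diff_on_SucD[OF Suc.prems(2)]
  show ?case
    by (rule ntimes_diff_on_SucI[OF \<open>open S\<close>, where f' = "\<lambda>x. deriv f x * g x + f x * deriv g x"])
       (auto intro!: Suc.IH derivative_eq_intros D ntimes_diff_on_add[OF \<open>open S\<close>])
qed simp

lemma ntimes_diff_on_minus:
  assumes "open S" "ntimes_diff_on n S f"
  shows "ntimes_diff_on n S (\<lambda>x. - f x)"
  using ntimes_diff_on_mult[OF assms(1) ntimes_diff_on_const assms(2), of "-1"] by simp

lemma ntimes_diff_on_diff:
  assumes "open S" "ntimes_diff_on n S f" "ntimes_diff_on n S g"
  shows "ntimes_diff_on n S (\<lambda>x. f x - g x)"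
  using ntimes_diff_on_add[OF assms(1,2) ntimes_diff_on_minus[OF assms(1,3)]] by simp

text \<open>Here \<open>f\<close> stays fixed in the induction, because the derivative of 1/f is
  again built from 1/f and \<open>deriv f\<close>.\<close>

lemma ntimes_diff_on_inverse:
  assumes "open S" "ntimes_diff_on n S f" "\<And>x. x \<in> S \<Longrightarrow> f x \<noteq> 0"
  shows "ntimes_diff_on n S (\<lambda>x. inverse (f x))"
  using assms(2)
proof (induction n)
  case (Suc n)
  note D = ntimes_diff_on_SucD[OF Suc.prems]
  show ?case
    by (rule ntimes_diff_on_SucI[OF \<open>open S\<close>,
          where f' = "\<lambda>x. - (inverse (f x) * deriv f x * inverse (f x))"])
       (auto intro!: Suc.IH derivative_eq_intros D ntimes_diff_on_mult[OF \<open>open S\<close>]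
          ntimes_diff_on_minus[OF \<open>open S\<close>] simp: assms(3))
qed simp

lemma ntimes_diff_on_affine:
  assumes "ntimes_diff_on n UNIV f"
  shows "ntimes_diff_on n UNIV (\<lambda>x. f (c * x + d))"
  using assms
proof (induction n arbitrary: f)
  case (Suc n)
  note D = ntimes_diff_on_SucD[OF Suc.prems]
  have "((\<lambda>x. f (c * x + d)) has_real_derivative c * deriv f (c * x + d)) (at x)" for x
    by (rule DERIV_cong[OF DERIV_chain2[where g = "\<lambda>x. c * x + d", OF D(3)]])
       (auto intro!: derivative_eq_intros)
  then show ?case
    by (intro ntimes_diff_on_SucI[where f' = "\<lambda>x. c * deriv f (c * x + d)"]
         ntimes_diff_on_mult ntimes_diff_on_const Suc.IH D) auto
qed simp

text \<open>The exponent \<open>k\<close> makes the family closed under differentiation: the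
  derivative of member \<open>k\<close> is a linear combination of members \<open>k + 1\<close> and
  \<open>k + 2\<close>. Smoothness of all members then follows by one induction.\<close>

definition flat_exp :: "nat \<Rightarrow> real \<Rightarrow> real" where
  "flat_exp k x = (if 0 < x then exp (- (1 / x)) / x ^ k else 0)"

lemma flat_exp_tendsto_0: "(flat_exp k \<longlongrightarrow> 0) (at 0)"
proof -
  have "((\<lambda>x::real. inverse x ^ k / exp (inverse x)) \<longlongrightarrow> 0) (at_right 0)"
    by (rule filterlim_compose[OF tendsto_power_div_exp_0 filterlim_inverse_at_top_right])
  moreover have "\<forall>\<^sub>F x in at_right 0. inverse x ^ k / exp (inverse x) = flat_exp k x"
    by (intro eventually_at_right_less[THEN eventually_mono])
       (simp add: flat_exp_def exp_minus field_simps power_inverse)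
  ultimately have "(flat_exp k \<longlongrightarrow> 0) (at_right 0)"
    using Lim_transform_eventually by blast
  moreover have "(flat_exp k \<longlongrightarrow> 0) (at_left 0)"
    by (rule Lim_transform_eventually[OF tendsto_const])
       (auto simp: eventually_at_left_field flat_exp_def intro!: exI[of _ "-1"])
  ultimately show ?thesis
    by (simp add: filterlim_split_at)
qed

lemma flat_exp_has_derivative:
  "(flat_exp k has_real_derivative flat_exp (k + 2) x - real k * flat_exp (k + 1) x) (at x)"
proof (cases x "0::real" rule: linorder_cases)
  case less
  have "((\<lambda>x. 0) has_real_derivative 0) (at x)" by simp
  then have "(flat_exp k has_real_derivative 0) (at x)"
    by (rule has_field_derivative_transform_within_open[where S = "{..<0}"])
       (use less in \<open>auto simp: flat_exp_def\<close>)
  then show ?thesis using less by (simp add: flat_exp_def)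
next
  case equal
  \<comment> \<open>The difference quotient of \<open>flat_exp k\<close> at 0 is itself
    \<open>flat_exp (Suc k)\<close>, so its limit is already known.\<close>
  have "((\<lambda>h. (flat_exp k (0 + h) - flat_exp k 0) / h) \<longlongrightarrow> 0) (at 0)"
    by (rule Lim_transform_eventually[OF flat_exp_tendsto_0[of "Suc k"]])
       (auto simp: flat_exp_def intro!: always_eventually)
  then show ?thesis
    using equal by (simp add: DERIV_def flat_exp_def)
next
  case greater
  have "((\<lambda>x. exp (- (1 / x)) / x ^ k) has_real_derivative
           flat_exp (k + 2) x - real k * flat_exp (k + 1) x) (at x)"
  proof -
    have "real k * x ^ (k - 1) = real k * x ^ k / x"
      using greater by (cases k) auto
    then show ?thesis
    using greater
    by (auto intro!: derivative_eq_intros simp: flat_exp_def power2_eq_square field_simps)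
  qed
  then show ?thesis
    by (rule has_field_derivative_transform_within_open[where S = "{0<..}"])
       (use greater in \<open>auto simp: flat_exp_def\<close>)
qed

lemma ntimes_diff_on_flat_exp: "ntimes_diff_on n UNIV (flat_exp k)"
proof (induction n arbitrary: k)
  case (Suc n)
  show ?case
    by (rule ntimes_diff_on_SucI[OF open_UNIV flat_exp_has_derivative])
       (intro ntimes_diff_on_diff ntimes_diff_on_mult ntimes_diff_on_const Suc open_UNIV)
qed simp

lemma smooth_step_exists:
  obtains H :: "real \<Rightarrow> real"
  where "smooth_on UNIV H" "mono H" "\<And>x. x \<le> 0 \<Longrightarrow> H x = 0" "\<And>x. 1 \<le> x \<Longrightarrow> H x = 1"
proof
  let ?e = "flat_exp 0"
  \<comment> \<open>The quotient e(x) / (e(x) + e(1 - x)); one of x and 1 - x is always positive, so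
    the denominator never vanishes.\<close>
  define H where "H = (\<lambda>x. ?e x * inverse (?e x + ?e ((-1) * x + 1)))"
  have nn: "0 \<le> ?e x" for x by (simp add: flat_exp_def)
  have pos: "0 < ?e x + ?e (1 - x)" for x
    by (cases "0 < x") (auto simp: flat_exp_def intro: add_pos_nonneg)
  have mono: "?e x \<le> ?e y" if "x \<le> y" for x y
    using that by (auto simp: flat_exp_def frac_le)
  show "smooth_on UNIV H"
    unfolding smooth_on_iff H_def
  proof (intro allI ntimes_diff_on_mult ntimes_diff_on_inverse ntimes_diff_on_add
      ntimes_diff_on_flat_exp ntimes_diff_on_affine open_UNIV)
    fix x show "?e x + ?e ((- 1) * x + 1) \<noteq> 0" using pos[of x] by simp
  qed
  show "mono H"
  proof (rule monoI)
    fix x y :: real assume "x \<le> y"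
    then have "?e x * ?e (1 - y) \<le> ?e y * ?e (1 - x)"
      by (intro mult_mono mono nn) auto
    then show "H x \<le> H y"
      using pos[of x] pos[of y] by (simp add: H_def field_simps)
  qed
  show "H x = 0" if "x \<le> 0" for x using that by (simp add: H_def flat_exp_def)
  show "H x = 1" if "1 \<le> x" for x using that by (simp add: H_def flat_exp_def)
qed

section \<open>Absolutely continuous functions on the unit interval\<close>

text \<open>The end points form a null set. This links the Bochner integral of the problem statement
  with the gauge integral on closed intervals, for which the fundamental theorem and the combination
  of intervals are available.\<close>

lemma integrable_leb01_iff: "integrable leb01 f \<longleftrightarrow> f absolutely_integrable_on {0..1}" for f :: "real \<Rightarrow> real"
proof -
  have "integrable leb01 f \<longleftrightarrow> f absolutely_integrable_on {0<..<1}"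
    unfolding set_integrable_def by (rule integrable_restrict_space) simp
  also have "\<dots> \<longleftrightarrow> f absolutely_integrable_on {0..1}"
    unfolding absolutely_integrable_on_def integrable_on_open_interval_real ..
  finally show ?thesis .
qed

lemma integral_leb01:
  fixes f :: "real \<Rightarrow> real"
  assumes "integrable leb01 f"
  shows "integral\<^sup>L leb01 f = integral {0..1} f"
  unfolding integral_open_interval_real by (rule lebesgue_integral_eq_integral[OF assms]) simp

lemma integrable_leb01_sub:
  fixes f :: "real \<Rightarrow> real"
  assumes "integrable leb01 f" "0 \<le> s" "t \<le> 1"
  shows "f integrable_on {s..t}" "(\<lambda>x. \<bar>f x\<bar>) integrable_on {s..t}"
    "f absolutely_integrable_on {s..t}"
proof -
  show *: "f absolutely_integrable_on {s..t}"
  proof (rule absolutely_integrable_on_subinterval)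
    show "f absolutely_integrable_on {0..1}"
      using assms(1) by (rule integrable_leb01_iff[THEN iffD1])
  qed (use assms(2,3) in auto)
  show "f integrable_on {s..t}" "(\<lambda>x. \<bar>f x\<bar>) integrable_on {s..t}"
    using * unfolding absolutely_integrable_on_def real_norm_def by blast+
qed

lemma integral_diff_leb01:
  fixes f :: "real \<Rightarrow> real"
  assumes "integrable leb01 f" "0 \<le> s" "s \<le> t" "t \<le> 1"
  shows "integral {0..t} f - integral {0..s} f = integral {s..t} f"
  using Henstock_Kurzweil_Integration.integral_combine[where a = 0 and c = s and b = t and f = f] integrable_leb01_sub(1)[OF assms(1), of 0 t] assms by simp

lemma measurable_leb01_continuous:
  assumes "continuous_on {0..1} f"
  shows "f \<in> borel_measurable leb01"
  by (rule continuous_imp_measurable_on_sets_lebesgue)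
     (auto intro: continuous_on_subset[OF assms])

lemma integrable_leb01_mult:
  fixes f g :: "real \<Rightarrow> real"
  assumes "f \<in> borel_measurable leb01" "\<And>t. t \<in> {0<..<1} \<Longrightarrow> \<bar>f t\<bar> \<le> C" "integrable leb01 g"
  shows "integrable leb01 (\<lambda>t. f t * g t)"
proof (rule Bochner_Integration.integrable_bound)
  show "integrable leb01 (\<lambda>t. C * \<bar>g t\<bar>)" using assms by simp
  show "AE t in leb01. norm (f t * g t) \<le> norm (C * \<bar>g t\<bar>)"
  proof (rule AE_I2)
    fix t assume "t \<in> space leb01"
    then have "\<bar>f t\<bar> \<le> C" using assms(2) by simp
    then show "norm (f t * g t) \<le> norm (C * \<bar>g t\<bar>)"
      by (simp add: abs_mult mult_right_mono)
  qed
qed (use assms in measurable)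

lemma integrable_leb01_const [simp]: "integrable leb01 (\<lambda>t. c :: real)"
  unfolding integrable_leb01_iff by (intro absolutely_integrable_continuous_real continuous_intros)

lemma integrable_leb01_bounded:
  fixes f :: "real \<Rightarrow> real"
  assumes "f \<in> borel_measurable leb01" "\<And>t. t \<in> {0<..<1} \<Longrightarrow> \<bar>f t\<bar> \<le> C"
  shows "integrable leb01 f"
  using integrable_leb01_mult[OF assms integrable_leb01_const[of 1]] by simp

lemma integrable_leb01_continuous:
  "continuous_on {0..1} f \<Longrightarrow> integrable leb01 (f :: real \<Rightarrow> real)"
  unfolding integrable_leb01_iff by (rule absolutely_integrable_continuous_real)

lemma continuous_bounded_leb01:
  assumes "continuous_on {0..1} (f :: real \<Rightarrow> real)"
  obtains C where "0 \<le> C" "\<And>t. t \<in> {0..1} \<Longrightarrow> \<bar>f t\<bar> \<le> C"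
proof -
  have "bounded (f ` {0..1})"
    by (intro compact_imp_bounded compact_continuous_image assms) auto
  then obtain C where "0 < C" "\<forall>t\<in>{0..1}. \<bar>f t\<bar> \<le> C"
    by (auto simp: bounded_pos)
  then show ?thesis using that[of C] by auto
qed

lemma integrable_leb01_continuous_mult:
  fixes f g :: "real \<Rightarrow> real"
  assumes "continuous_on {0..1} f" "integrable leb01 g"
  shows "integrable leb01 (\<lambda>t. f t * g t)"
proof -
  obtain C where "\<And>t. t \<in> {0..1} \<Longrightarrow> \<bar>f t\<bar> \<le> C"
    using continuous_bounded_leb01[OF assms(1)] by metis
  then show ?thesis
    using assms by (intro integrable_leb01_mult[where C = C] measurable_leb01_continuous) auto
qed

text \<open>\<open>primitive F f\<close>: on \<open>[0,1]\<close> the function \<open>F\<close> is absolutely continuous with derivative \<open>f\<close>.\<close>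

definition primitive :: "(real \<Rightarrow> real) \<Rightarrow> (real \<Rightarrow> real) \<Rightarrow> bool" where
  "primitive F f \<longleftrightarrow>
     integrable leb01 f \<and> (\<forall>t\<in>{0..1}. F t - F 0 = integral {0..t} f)"

lemma primitive_integrable: "primitive F f \<Longrightarrow> integrable leb01 f"
  by (simp add: primitive_def)

lemma primitive_eq: "primitive F f \<Longrightarrow> t \<in> {0..1} \<Longrightarrow> F t = F 0 + integral {0..t} f"
  unfolding primitive_def by (metis add.commute diff_add_cancel)

lemma primitive_diff:
  assumes "primitive F f" "0 \<le> s" "s \<le> t" "t \<le> 1"
  shows "F t - F s = integral {s..t} f"
proof -
  have "F t - F 0 = integral {0..t} f" "F s - F 0 = integral {0..s} f"
    using assms unfolding primitive_def by auto
  then show ?thesis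
    using integral_diff_leb01[OF primitive_integrable[OF assms(1)] assms(2-4)] by simp
qed

lemma primitive_integral: "primitive F f \<Longrightarrow> integral\<^sup>L leb01 f = F 1 - F 0"
  using primitive_diff[of F f 0 1] by (simp add: integral_leb01 primitive_integrable)

lemma primitive_continuous:
  assumes "primitive F f"
  shows "continuous_on {0..1} F"
proof -
  have "continuous_on {0..1} (\<lambda>t. F 0 + integral {0..t} f)"
    using integrable_leb01_sub(1)[OF primitive_integrable[OF assms], of 0 1]
    by (intro continuous_intros indefinite_integral_continuous_1) auto
  then show ?thesis
    by (rule continuous_on_eq) (rule primitive_eq[OF assms, symmetric])
qed

lemma primitive_indefinite_integral:
  "integrable leb01 f \<Longrightarrow> primitive (\<lambda>t. c + integral {0..t} f) f"
  by (simp add: primitive_def)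

lemma primitive_add:
  assumes "primitive F f" "primitive G g"
  shows "primitive (\<lambda>t. F t + G t) (\<lambda>t. f t + g t)"
proof -
  have "integral {0..t} (\<lambda>t. f t + g t) = integral {0..t} f + integral {0..t} g"
    if "t \<in> {0..1}" for t
    using that assms by (intro Henstock_Kurzweil_Integration.integral_add integrable_leb01_sub)
      (auto simp: primitive_integrable)
  then show ?thesis using assms unfolding primitive_def
    by (auto simp: add_diff_add)
qed

lemma primitive_cmult:
  assumes "primitive F f"
  shows "primitive (\<lambda>t. c * F t) (\<lambda>t. c * f t)"
  using assms by (auto simp: primitive_def simp flip: right_diff_distrib)

lemma primitive_sub:
  assumes "primitive F f" "primitive G g"
  shows "primitive (\<lambda>t. F t - G t) (\<lambda>t. f t - g t)"
  using primitive_add[OF assms(1) primitive_cmult[OF assms(2), of "-1"]] by simp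

lemma primitive_cong:
  assumes "primitive F f" "\<And>t. t \<in> {0..1} \<Longrightarrow> F t = G t"
  shows "primitive G f"
  unfolding primitive_def
proof (intro conjI ballI primitive_integrable[OF assms(1)])
  fix t :: real assume "t \<in> {0..1}"
  then show "G t - G 0 = integral {0..t} f"
    using primitive_diff[OF assms(1), of 0 t] assms(2)[of t] assms(2)[of 0] by auto
qed

section \<open>Null sets and the fundamental theorem of calculus\<close>

lemma AE_leb01_negligible:
  "(AE t in leb01. P t) \<longleftrightarrow> negligible {t \<in> {0<..<1}. \<not> P t}"
proof -
  have "(AE t in leb01. P t) \<longleftrightarrow> (AE t in lebesgue. t \<in> {0<..<1} \<longrightarrow> P t)"
    by (subst AE_restrict_space_iff) auto
  also have "\<dots> \<longleftrightarrow> {t. \<not> (t \<in> {0<..<1} \<longrightarrow> P t)} \<in> null_sets lebesgue"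
    unfolding eventually_ae_filter
    by (auto simp: negligible_iff_null_sets[symmetric] intro: negligible_subset
        intro!: bexI[of _ "{t. 0 < t \<and> t < 1 \<and> \<not> P t}"])
  finally show ?thesis by (simp add: negligible_iff_null_sets)
qed

lemma integral_cong_AE_leb01:
  assumes "AE t in leb01. f t = g t" "0 \<le> s" "t \<le> 1"
  shows "integral {s..t} f = integral {s..t} g"
proof (rule integral_spike)
  show "negligible ({t \<in> {0<..<1}. f t \<noteq> g t} \<union> {0, 1})"
    using assms(1) by (simp add: AE_leb01_negligible)
qed (use assms(2,3) in auto)

lemma primitive_cong_AE:
  assumes "primitive F f" "AE t in leb01. f t = g t" "g \<in> borel_measurable leb01"
  shows "primitive F g"
proof -
  have "integrable leb01 g"
    using integrable_cong_AE[of f leb01 g] assms primitive_integrable[OF assms(1)] by simp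
  moreover have "integral {0..t} f = integral {0..t} g" if "t \<in> {0..1}" for t
    using integral_cong_AE_leb01[OF assms(2)] that by simp
  ultimately show ?thesis using assms(1) unfolding primitive_def by auto
qed

lemma primitive_of_derivative:
  assumes "\<And>t. t \<in> {0..1} \<Longrightarrow> (F has_real_derivative f t) (at t within {0..1})"
    and "continuous_on {0..1} f"
  shows "primitive F f"
  unfolding primitive_def
proof (intro conjI ballI integrable_leb01_continuous assms(2))
  fix t :: real assume t: "t \<in> {0..1}"
  have "(f has_integral (F t - F 0)) {0..t}"
    by (rule fundamental_theorem_of_calculus)
       (use t assms(1) in \<open>auto simp: has_real_derivative_iff_has_vector_derivative[symmetric]
          intro: DERIV_subset[of F _ _ "{0..1}"]\<close>)
  then show "F t - F 0 = integral {0..t} f" by (simp add: integral_unique)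
qed

lemma primitive_has_derivative:
  assumes "primitive F f" "continuous_on {0..1} f" "t \<in> {0..1}"
  shows "(F has_real_derivative f t) (at t within {0..1})"
proof -
  have "((\<lambda>t. F 0 + integral {0..t} f) has_real_derivative f t) (at t within {0..1})"
    using integral_has_real_derivative[OF assms(2,3)] by (auto intro!: derivative_eq_intros)
  then show ?thesis
    by (rule has_field_derivative_transform_within[of _ _ _ _ 1])
       (use assms(3) in \<open>auto intro: primitive_eq[OF assms(1), symmetric]\<close>)
qed

text \<open>Adding the increments over an equidistant partition telescopes on both sides and bounds
  |d t - d 0| by e (M t - M 0) for every e. With \<open>M\<close> the integral of |f| this proves a
  chain rule without differentiating anything almost everywhere.\<close>

lemma constant_if_small_increments:
  fixes d M :: "real \<Rightarrow> real"
  assumes "\<And>e. 0 < e \<Longrightarrow> \<exists>\<delta>>0. \<forall>s\<in>{0..1}. \<forall>t\<in>{0..1}. s \<le> t \<and> t - s < \<delta> \<longrightarrow> \<bar>d t - d s\<bar> \<le> e * (M t - M s)"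
    and "t \<in> {0..1}"
  shows "d t = d 0"
proof -
  have "\<bar>d t - d 0\<bar> \<le> e * (M t - M 0)" if "0 < e" for e
  proof -
    obtain \<delta> where \<delta>: "\<delta> > 0"
      "\<And>s t. s \<in> {0..1} \<Longrightarrow> t \<in> {0..1} \<Longrightarrow> s \<le> t \<Longrightarrow> t - s < \<delta> \<Longrightarrow> \<bar>d t - d s\<bar> \<le> e * (M t - M s)"
      using assms(1)[OF \<open>0 < e\<close>] by blast
    obtain n :: nat where n: "n > 0" "inverse (real n) < \<delta>"
      using ex_inverse_of_nat_less[OF \<delta>(1)] by auto
    define p where "p i = real i / n * t" for i
    have "\<bar>d (p i) - d 0\<bar> \<le> e * (M (p i) - M 0)" if "i \<le> n" for i
      using that
    proof (induction i)
      case (Suc i)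
      have "p i \<in> {0..1}" "p (Suc i) \<in> {0..1}"
        unfolding p_def atLeastAtMost_iff using Suc.prems assms(2) n
        by (intro conjI mult_le_one mult_nonneg_nonneg; simp)+
      moreover have step: "p (Suc i) - p i = t / n" by (simp add: p_def add_divide_distrib algebra_simps)
      moreover have "t / n < \<delta>"
        using assms(2) n by (auto intro!: le_less_trans[OF _ n(2)] simp: field_simps)
      moreover have "0 \<le> t / n" using assms(2) by simp
      ultimately have "\<bar>d (p (Suc i)) - d (p i)\<bar> \<le> e * (M (p (Suc i)) - M (p i))"
        by (intro \<delta>(2)) linarith+
      with Suc show ?case by (simp add: algebra_simps)
    qed (simp add: p_def)
    from this[of n] show ?thesis using n by (simp add: p_def)
  qed
  then have "\<bar>d t - d 0\<bar> \<le> 0 + e" if "0 < e" for e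
  proof -
    \<comment> \<open>\<open>M t - M 0\<close> may vanish; the added 1 keeps the quotient
      meaningful.\<close>
    have "\<bar>d t - d 0\<bar> \<le> e / (\<bar>M t - M 0\<bar> + 1) * (M t - M 0)"
      by (rule \<open>\<And>e. 0 < e \<Longrightarrow> \<bar>d t - d 0\<bar> \<le> e * (M t - M 0)\<close>) (use that in simp)
    also have "\<dots> \<le> e / (\<bar>M t - M 0\<bar> + 1) * (\<bar>M t - M 0\<bar> + 1)"
      using that by (intro mult_left_mono) auto
    also have "\<dots> = e" by simp
    finally show ?thesis by simp
  qed
  then have "\<bar>d t - d 0\<bar> \<le> 0" by (rule field_le_epsilon)
  then show ?thesis by simp
qed

text \<open>On a short interval the mean value theorem writes the increment of G(F) as G'(x) times
  the integral of \<open>f\<close>, with x between the end values of \<open>F\<close>. Uniform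
  continuity of \<open>F\<close> and of \<open>G'\<close> on the range of \<open>F\<close> makes
  G'(x) close to G'(F u) for every u in the interval, so the defect \<open>d\<close> moves by at
  most e times the integral of |f|.\<close>

lemma primitive_comp:
  assumes F: "primitive F f"
    and G: "\<And>x. (G has_real_derivative G' x) (at x)" and G': "continuous_on UNIV G'"
  shows "primitive (\<lambda>t. G (F t)) (\<lambda>t. G' (F t) * f t)"
proof -
  have cF: "continuous_on {0..1} F" by (rule primitive_continuous[OF F])
  have cG'F: "continuous_on {0..1} (\<lambda>t. G' (F t))"
    by (rule continuous_on_compose2[OF G' cF]) auto
  have int: "integrable leb01 (\<lambda>t. G' (F t) * f t)"
    by (intro integrable_leb01_continuous_mult cG'F primitive_integrable[OF F])
  have intf: "integrable leb01 f" "integrable leb01 (\<lambda>t. \<bar>f t\<bar>)"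
    using primitive_integrable[OF F] by auto
  obtain C where C: "0 \<le> C" "\<And>t. t \<in> {0..1} \<Longrightarrow> \<bar>F t\<bar> \<le> C"
    using continuous_bounded_leb01[OF cF] by metis
  define d where "d t = G (F t) - integral {0..t} (\<lambda>t. G' (F t) * f t)" for t
  define M where "M t = integral {0..t} (\<lambda>t. \<bar>f t\<bar>)" for t
  have const: "d t = d 0" if t: "t \<in> {0..1}" for t
  proof (rule constant_if_small_increments[OF _ t, of d M])
    fix e :: real assume e: "0 < e"
    have "uniformly_continuous_on {-C..C} G'"
      by (intro compact_uniformly_continuous continuous_on_subset[OF G']) auto
    then obtain r where r: "r > 0"
      "\<And>x y. x \<in> {-C..C} \<Longrightarrow> y \<in> {-C..C} \<Longrightarrow> \<bar>x - y\<bar> < r \<Longrightarrow> \<bar>G' x - G' y\<bar> < e"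
      using e unfolding uniformly_continuous_on_def dist_real_def by metis
    have "uniformly_continuous_on {0..1} F"
      by (intro compact_uniformly_continuous cF) auto
    moreover have "r / 2 > 0" using r by simp
    ultimately obtain \<delta> where \<delta>: "\<delta> > 0"
      "\<And>s t. s \<in> {0..1} \<Longrightarrow> t \<in> {0..1} \<Longrightarrow> \<bar>s - t\<bar> < \<delta> \<Longrightarrow> \<bar>F s - F t\<bar> < r / 2"
      unfolding uniformly_continuous_on_def dist_real_def by metis
    have "\<bar>d t - d s\<bar> \<le> e * (M t - M s)" if "s \<in> {0..1}" "t \<in> {0..1}" "s \<le> t" "t - s < \<delta>" for s t
    proof -
      note I = integrable_leb01_sub[OF intf(1), of s t] integrable_leb01_sub[OF int, of s t]
      obtain x where x: "x \<in> closed_segment (F s) (F t)" "G (F t) - G (F s) = G' x * (F t - F s)"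
      proof (cases "F s" "F t" rule: linorder_cases)
        case less
        from MVT2[OF this, of G G'] G obtain z where "F s < z" "z < F t"
          "G (F t) - G (F s) = (F t - F s) * G' z" by blast
        then show ?thesis by (intro that[of z]) (auto simp: closed_segment_eq_real_ivl)
      next
        case equal then show ?thesis by (intro that[of "F s"]) auto
      next
        case greater
        from MVT2[OF this, of G G'] G obtain z where "F t < z" "z < F s"
          "G (F s) - G (F t) = (F s - F t) * G' z" by blast
        then show ?thesis by (intro that[of z]) (auto simp: closed_segment_eq_real_ivl algebra_simps)
      qed
      have bnd: "\<bar>G' x - G' (F u)\<bar> \<le> e" if u: "u \<in> {s..t}" for u
      proof -
        have "u \<in> {0..1}" "\<bar>s - u\<bar> < \<delta>" "\<bar>t - u\<bar> < \<delta>"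
          using u \<open>s \<in> {0..1}\<close> \<open>t \<in> {0..1}\<close> \<open>t - s < \<delta>\<close> by auto
        then have "\<bar>F s - F u\<bar> < r/2" "\<bar>F t - F u\<bar> < r/2"
          using \<delta>(2)[OF \<open>s \<in> {0..1}\<close>, of u] \<delta>(2)[OF \<open>t \<in> {0..1}\<close>, of u] by blast+
        moreover have "F s \<le> x \<and> x \<le> F t \<or> F t \<le> x \<and> x \<le> F s"
          using x(1) by (auto simp: closed_segment_eq_real_ivl split: if_splits)
        ultimately have "\<bar>x - F u\<bar> < r" by linarith
        moreover have "F s \<in> {-C..C}" "F t \<in> {-C..C}" "F u \<in> {-C..C}"
          using u \<open>s \<in> {0..1}\<close> \<open>t \<in> {0..1}\<close> C(2)[of s] C(2)[of t] C(2)[of u] by (auto simp: abs_le_iff)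
        moreover from this have "x \<in> {-C..C}"
          using x(1) by (auto simp: closed_segment_eq_real_ivl split: if_splits)
        ultimately show ?thesis using r(2)[of x "F u"] by simp
      qed
      have "d t - d s = G' x * integral {s..t} f - integral {s..t} (\<lambda>t. G' (F t) * f t)"
        using primitive_diff[OF F, of s t] integral_diff_leb01[OF int, of s t] x(2) that
        by (simp add: d_def)
      also have "\<dots> = integral {s..t} (\<lambda>u. G' x * f u - G' (F u) * f u)"
        using I(1,4) that
        by (simp add: Henstock_Kurzweil_Integration.integral_diff integrable_on_mult_right)
      also have "\<bar>\<dots>\<bar> \<le> integral {s..t} (\<lambda>u. e * \<bar>f u\<bar>)"
      proof -
        have "norm (G' x * f u - G' (F u) * f u) \<le> e * \<bar>f u\<bar>" if "u \<in> {s..t}" for u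
          using bnd[OF that] by (simp add: left_diff_distrib[symmetric] abs_mult mult_right_mono)
        then have "norm (integral {s..t} (\<lambda>u. G' x * f u - G' (F u) * f u)) \<le> integral {s..t} (\<lambda>u. e * \<bar>f u\<bar>)"
          using I that by (intro integral_norm_bound_integral integrable_on_mult_right
              Henstock_Kurzweil_Integration.integrable_diff) simp_all
        then show ?thesis by simp
      qed
      also have "\<dots> = e * (M t - M s)"
        using integral_diff_leb01[OF intf(2), of s t] that by (simp add: M_def)
      finally show ?thesis .
    qed
    then show "\<exists>\<delta>>0. \<forall>s\<in>{0..1}. \<forall>t\<in>{0..1}. s \<le> t \<and> t - s < \<delta> \<longrightarrow> \<bar>d t - d s\<bar> \<le> e * (M t - M s)"
      using \<delta>(1) by blast
  qed
  then have "G (F t) - G (F 0) = integral {0..t} (\<lambda>t. G' (F t) * f t)" if "t \<in> {0..1}" for t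
    using const[OF that] by (simp add: d_def)
  then show ?thesis using int by (simp add: primitive_def)
qed

text \<open>Polarisation: a product is a quarter of the difference of two squares, and squares are
  covered by the chain rule.\<close>

lemma primitive_mult:
  assumes "primitive F f" "primitive G g"
  shows "primitive (\<lambda>t. F t * G t) (\<lambda>t. f t * G t + F t * g t)"
proof -
  have sq: "primitive (\<lambda>t. (H t)\<^sup>2) (\<lambda>t. 2 * H t * h t)" if "primitive H h" for H h
  proof (rule primitive_comp[OF that, of "\<lambda>x. x\<^sup>2" "\<lambda>x. 2 * x"])
    show "((\<lambda>x. x\<^sup>2) has_real_derivative 2 * x) (at x)" for x :: real
      by (auto intro!: derivative_eq_intros)
  qed (intro continuous_intros)
  have "primitive (\<lambda>t. 1/4 * ((F t + G t)\<^sup>2 - (F t - G t)\<^sup>2))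
     (\<lambda>t. 1/4 * (2 * (F t + G t) * (f t + g t) - 2 * (F t - G t) * (f t - g t)))"
    by (intro primitive_cmult primitive_sub primitive_add sq assms)
  moreover have "1/4 * ((F t + G t)\<^sup>2 - (F t - G t)\<^sup>2) = F t * G t" for t
    by (simp add: power2_eq_square algebra_simps)
  moreover have "1/4 * (2 * (F t + G t) * (f t + g t) - 2 * (F t - G t) * (f t - g t))
    = f t * G t + F t * g t" for t
    by (simp add: algebra_simps)
  ultimately show ?thesis by (simp only:)
qed

text \<open>All integrals of f - g over subintervals vanish, while by Lebesgue differentiation its
  averages over shrinking intervals tend to its value almost everywhere. The differentiation theorem
  is used on the whole line, hence the extension \<open>h\<close> by zero.\<close>

lemma primitive_deriv_unique:
  assumes "primitive F f" "primitive F g"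
  shows "AE t in leb01. f t = g t"
proof -
  have 0: "integral {s..t} (\<lambda>t. f t - g t) = 0" if "0 \<le> s" "s \<le> t" "t \<le> 1" for s t
    using primitive_diff[OF primitive_sub[OF assms] that] by simp
  define h where "h t = (if t \<in> {0..1} then f t - g t else 0)" for t
  have "integrable leb01 (\<lambda>t. f t - g t)"
    using assms by (auto simp: primitive_def)
  then have "(\<lambda>t. f t - g t) integrable_on {0..1}"
    by (rule integrable_leb01_sub(1)) auto
  then have "h integrable_on UNIV"
    unfolding h_def by (rule integrable_restrict_UNIV[THEN iffD2])
  then have "h integrable_on cbox a b" for a b
    by (rule integrable_on_subcbox) auto
  then obtain N where N: "negligible N"
    "\<And>x e. \<lbrakk>x \<notin> N; 0 < e\<rbrakk> \<Longrightarrow> \<exists>d>0. \<forall>r. 0 < r \<and> r < d \<longrightarrow>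
       norm (integral (cbox x (x + r *\<^sub>R One)) h /\<^sub>R r ^ DIM(real) - h x) < e"
    using integrable_ccontinuous_explicit[of h] by metis
  have "f t = g t" if t: "t \<in> {0<..<1}" "t \<notin> N" for t
  proof (rule ccontr)
    assume ne: "f t \<noteq> g t"
    then obtain d where d: "d > 0" "\<And>r. 0 < r \<Longrightarrow> r < d \<Longrightarrow>
       norm (integral (cbox t (t + r *\<^sub>R One)) h /\<^sub>R r ^ DIM(real) - h t) < \<bar>f t - g t\<bar>"
      using N(2)[OF t(2), of "\<bar>f t - g t\<bar>"] by auto
    define r where "r = min (d/2) (1 - t)"
    have r: "0 < r" "r < d" "t + r \<le> 1" using d t by (auto simp: r_def min_def)
    have "integral {t..t + r} h = integral {t..t + r} (\<lambda>t. f t - g t)"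
      by (rule Henstock_Kurzweil_Integration.integral_cong) (use r t in \<open>auto simp: h_def\<close>)
    also have "\<dots> = 0" using r t by (intro 0) auto
    finally have "\<bar>h t\<bar> < \<bar>f t - g t\<bar>" using d(2)[OF r(1,2)] by simp
    then show False using t by (simp add: h_def)
  qed
  then have "{t \<in> {0<..<1}. f t \<noteq> g t} \<subseteq> N" by auto
  then show ?thesis
    unfolding AE_leb01_negligible using N(1) negligible_subset by blast
qed

section \<open>The Sobolev space\<close>

lemma test_function_zero:
  assumes "\<phi> \<in> test_functions" "t \<notin> {0<..<1}"
  shows "\<phi> t = 0"
  using assms closure_subset[of "{t. \<phi> t \<noteq> 0}"] unfolding test_functions_def by blast

lemma smooth_on_UNIV_DERIV:
  assumes "smooth_on UNIV f"
  shows "(f has_real_derivative deriv f x) (at x)" "continuous_on A (deriv f)"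
proof -
  have "ntimes_diff_on (Suc (Suc 0)) UNIV f" using assms by (simp only: smooth_on_iff)
  note D = ntimes_diff_on_SucD[OF this] ntimes_diff_on_SucD[OF ntimes_diff_on_SucD(2)[OF this]]
  show "(f has_real_derivative deriv f x) (at x)" by (rule D(3)) simp
  have "continuous_on UNIV (deriv f)"
    by (intro DERIV_continuous_on[of _ _ "deriv (deriv f)"]) (rule D(6)[OF UNIV_I])
  then show "continuous_on A (deriv f)" by (rule continuous_on_subset) simp
qed

lemma primitive_smooth:
  assumes "smooth_on UNIV f"
  shows "primitive f (deriv f)"
  by (rule primitive_of_derivative)
     (rule has_field_derivative_at_within[OF smooth_on_UNIV_DERIV(1)[OF assms]]
       smooth_on_UNIV_DERIV(2)[OF assms])+

lemma is_weak_deriv_primitive: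
  assumes "primitive K g"
  shows "is_weak_deriv K g"
  unfolding is_weak_deriv_def
proof
  fix \<phi> assume \<phi>: "\<phi> \<in> test_functions"
  then have sm: "smooth_on UNIV \<phi>" by (simp add: test_functions_def)
  have p: "primitive \<phi> (deriv \<phi>)" by (rule primitive_smooth[OF sm])
  have int: "integrable leb01 (\<lambda>t. K t * deriv \<phi> t)" "integrable leb01 (\<lambda>t. g t * \<phi> t)"
    using integrable_leb01_continuous_mult[OF primitive_continuous[OF assms] primitive_integrable[OF p]]
      integrable_leb01_continuous_mult[OF primitive_continuous[OF p] primitive_integrable[OF assms]]
    by (simp_all add: mult.commute)
  have "integral\<^sup>L leb01 (\<lambda>t. g t * \<phi> t + K t * deriv \<phi> t) = K 1 * \<phi> 1 - K 0 * \<phi> 0"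
    by (rule primitive_integral[OF primitive_mult[OF assms p]])
  also have "\<dots> = 0"
    using test_function_zero[OF \<phi>, of 0] test_function_zero[OF \<phi>, of 1] by simp
  finally show "integral\<^sup>L leb01 (\<lambda>t. K t * deriv \<phi> t) = - integral\<^sup>L leb01 (\<lambda>t. g t * \<phi> t)"
    using int by simp
qed

lemma L2_integrable:
  assumes "g \<in> L2"
  shows "integrable leb01 g"
proof (rule Bochner_Integration.integrable_bound)
  show "integrable leb01 (\<lambda>t. 1 + (g t)\<^sup>2)" "g \<in> borel_measurable leb01"
    using assms by (auto simp: L2_def)
  have "\<bar>x\<bar> \<le> 1 + x\<^sup>2" for x :: real
    using zero_le_power2[of "\<bar>x\<bar> - 1"] by (simp add: power2_diff)
  then show "AE t in leb01. norm (g t) \<le> norm (1 + (g t)\<^sup>2)"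
    by (intro AE_I2) (simp add: abs_of_nonneg)
qed

text \<open>The test function is the difference of two smooth steps, one rising just after x and one
  just after y. Its derivative is an approximate unit mass at x minus one at y, while the function
  itself tends to the indicator of (x, y]. In the limit the weak identity reads K x - K y = -
  integral of \<open>g\<close> over [x, y]; continuity of \<open>K\<close> carries this to the end
  points.\<close>

lemma primitive_weak_deriv:
  assumes K: "continuous_on {0..1} K" and g: "integrable leb01 g" and w: "is_weak_deriv K g"
  shows "primitive K g"
proof -
  obtain H :: "real \<Rightarrow> real" where H: "smooth_on UNIV H" "mono H"
    "\<And>x. x \<le> 0 \<Longrightarrow> H x = 0" "\<And>x. 1 \<le> x \<Longrightarrow> H x = 1"
    using smooth_step_exists by blast
  have H01: "0 \<le> H x" "H x \<le> 1" for x
    using monoD[OF H(2), of "min 0 x" x] monoD[OF H(2), of x "max 1 x"] H(3)[of "min 0 x"]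
      H(4)[of "max 1 x"] by simp_all
  \<comment> \<open>A step rising from 0 to 1 on [x, x + 1/n], written as an affine substitution so
    that smoothness is inherited from \<open>H\<close>.\<close>
  define S where "S x n t = H (real n * t + (- (real n * x)))" for x n t
  have S_smooth: "smooth_on UNIV (S x n)" for x n
    unfolding S_def smooth_on_iff
    by (intro allI ntimes_diff_on_affine H(1)[unfolded smooth_on_iff, rule_format])
  have S_prim: "primitive (S x n) (deriv (S x n))" for x n
    by (rule primitive_smooth[OF S_smooth])
  have S_deriv_nonneg: "0 \<le> deriv (S x n) t" for x n t
  proof (rule mono_on_imp_deriv_nonneg[of UNIV "S x n"])
    show "mono_on UNIV (S x n)"
      unfolding S_def by (intro mono_onI monoD[OF H(2)]) (simp add: mult_left_mono)
  qed (use smooth_on_UNIV_DERIV[OF S_smooth] in auto)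
  have S_deriv_zero: "deriv (S x n) t = 0" if "t < x \<or> x + 1 / n < t" "0 < n" for x n t
  proof -
    have "\<exists>T c. open T \<and> t \<in> T \<and> (\<forall>u\<in>T. c = S x n u)"
      using that(1)
    proof
      assume "t < x" then show ?thesis
        by (intro exI[of _ "{..<x}"] exI[of _ 0]) (auto simp: S_def H(3) mult_left_mono)
    next
      assume t: "x + 1 / n < t"
      have "S x n u = 1" if "x + 1 / n < u" for u
      proof -
        have "1 = real n * (1 / n)" using \<open>0 < n\<close> by simp
        also have "\<dots> \<le> real n * (u - x)" using that by (intro mult_left_mono) auto
        finally show ?thesis unfolding S_def by (intro H(4)) (simp add: algebra_simps)
      qed
      with t show ?thesis by (intro exI[of _ "{x + 1 / n<..}"] exI[of _ 1]) auto
    qed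
    then obtain T c where T: "open T" "t \<in> T" "\<And>u. u \<in> T \<Longrightarrow> c = S x n u" by blast
    have "((\<lambda>_. c) has_real_derivative 0) (at t)" by simp
    then have "(S x n has_real_derivative 0) (at t)"
      by (rule has_field_derivative_transform_within_open[OF _ T])
    then show ?thesis by (rule DERIV_imp_deriv)
  qed
  have S_lim: "(\<lambda>n. S x n t) \<longlonglongrightarrow> (if x < t then 1 else 0)" for x t
  proof (cases "x < t")
    case True
    obtain N :: nat where N: "1 / (t - x) < real N" using reals_Archimedean2 by blast
    have "S x n t = 1" if "n \<ge> N" for n
    proof -
      have "1 / (t - x) \<le> real n" using N that by linarith
      then have "1 \<le> real n * t + (- (real n * x))" using True by (simp add: field_simps)
      then show ?thesis unfolding S_def by (rule H(4))
    qed
    then have "\<forall>\<^sub>F n in sequentially. S x n t = 1" by (auto simp: eventually_sequentially)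
    then show ?thesis using True by (simp add: tendsto_eventually)
  next
    case False
    then have "S x n t = 0" for n unfolding S_def by (intro H(3)) (simp add: mult_left_mono)
    then show ?thesis using False by simp
  qed
  have int_S: "integrable leb01 (\<lambda>t. K t * deriv (S x n) t)" for x n
    by (intro integrable_leb01_continuous_mult K primitive_integrable[OF S_prim])
  have lim_K: "(\<lambda>n. integral\<^sup>L leb01 (\<lambda>t. K t * deriv (S x n) t)) \<longlonglongrightarrow> K x" if x: "0 < x" "x < 1" for x
  proof (rule LIMSEQ_I)
    fix r :: real assume r: "0 < r"
    obtain d where d: "d > 0" "\<And>t. t \<in> {0..1} \<Longrightarrow> \<bar>t - x\<bar> < d \<Longrightarrow> \<bar>K t - K x\<bar> < r / 2"
      using K x r unfolding continuous_on_iff dist_real_def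
      by (metis atLeastAtMost_iff half_gt_zero_iff less_imp_le)
    \<comment> \<open>The ramp has to fit into the continuity neighbourhood of width d, and to
      finish before 1 so that its derivative has total mass one.\<close>
    obtain N :: nat where N: "1 / min d (1 - x) < real N" using reals_Archimedean2 by blast
    have "\<bar>integral\<^sup>L leb01 (\<lambda>t. K t * deriv (S x n) t) - K x\<bar> < r" if n: "n \<ge> N" for n
    proof -
      have m: "0 < min d (1 - x)" using d x by simp
      have "0 < real N" using N m by (smt (verit) divide_pos_pos)
      then have n0: "0 < n" using n by simp
      have "1 / min d (1 - x) < real n" using N n by linarith
      moreover have "1 / n < m" if "0 < m" "1 / m < real n" for m
        using that n0 by (simp add: field_simps)
      ultimately have "1 / n < min d (1 - x)" using m by blast
      then have nd: "1 / n < d" "1 / n < 1 - x" by simp_all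
      have "S x n 1 = 1" "S x n 0 = 0"
        using nd n0 x unfolding S_def by (auto intro!: H(3,4) simp: field_simps)
      then have one: "integral\<^sup>L leb01 (deriv (S x n)) = 1"
        using primitive_integral[OF S_prim, of x n] by simp
      have "integral\<^sup>L leb01 (\<lambda>t. K t * deriv (S x n) t) - K x
          = integral\<^sup>L leb01 (\<lambda>t. K t * deriv (S x n) t - K x * deriv (S x n) t)"
        using int_S[of x n] primitive_integrable[OF S_prim, of x n] one by simp
      also have "\<bar>\<dots>\<bar> \<le> integral\<^sup>L leb01 (\<lambda>t. r / 2 * deriv (S x n) t)"
      proof -
        have "norm (integral\<^sup>L leb01 (\<lambda>t. K t * deriv (S x n) t - K x * deriv (S x n) t))
            \<le> integral\<^sup>L leb01 (\<lambda>t. r / 2 * deriv (S x n) t)"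
        proof (rule Bochner_Integration.integral_norm_bound_integral)
          fix t assume "t \<in> space leb01"
          then have t: "t \<in> {0..1}" by auto
          show "norm (K t * deriv (S x n) t - K x * deriv (S x n) t) \<le> r / 2 * deriv (S x n) t"
          proof (cases "t < x \<or> x + 1 / n < t")
            case True then show ?thesis using S_deriv_zero[OF True n0] by simp
          next
            case False
            then have "\<bar>t - x\<bar> < d" using nd by auto
            then have "\<bar>K t - K x\<bar> * deriv (S x n) t \<le> r / 2 * deriv (S x n) t"
              using d(2)[OF t] by (intro mult_right_mono S_deriv_nonneg) auto
            then show ?thesis
              by (simp add: left_diff_distrib[symmetric] abs_mult S_deriv_nonneg)
          qed
        qed (use int_S[of x n] primitive_integrable[OF S_prim, of x n] in auto)
        then show ?thesis by simp
      qed
      also have "\<dots> < r" using one r by simp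
      finally show ?thesis .
    qed
    then show "\<exists>N. \<forall>n\<ge>N. norm (integral\<^sup>L leb01 (\<lambda>t. K t * deriv (S x n) t) - K x) < r"
      by auto
  qed
  have incr: "K y - K x = integral {x..y} g" if xy: "0 < x" "x < y" "y < 1" for x y
  proof -
    define \<phi> where "\<phi> n t = S x n t - S y n t" for n t
    have \<phi>_deriv: "deriv (\<phi> n) t = deriv (S x n) t - deriv (S y n) t" for n t
      unfolding \<phi>_def
      by (intro DERIV_imp_deriv derivative_intros smooth_on_UNIV_DERIV(1) S_smooth)
    \<comment> \<open>This choice gives y + 1/n < 1, so the support of the test function is a closed
      interval inside (0,1).\<close>
    obtain N :: nat where N: "1 / (1 - y) < real N" using reals_Archimedean2 by blast
    have eq: "integral\<^sup>L leb01 (\<lambda>t. K t * deriv (S x n) t) - integral\<^sup>L leb01 (\<lambda>t. K t * deriv (S y n) t)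
        = - integral\<^sup>L leb01 (\<lambda>t. g t * \<phi> n t)" if n: "n \<ge> N" for n
    proof -
      have "0 < 1 / (1 - y)" using xy by simp
      then have n0: "0 < real n" and "1 / (1 - y) < real n" using N n by linarith+
      then have ny: "y + 1 / n < 1" using xy by (simp add: field_simps)
      have zero: "\<phi> n t = 0" if "t \<notin> {x..y + 1 / n}" for t
      proof (cases "t < x")
        case True
        then have "real n * t \<le> real n * x" "real n * t \<le> real n * y"
          using xy by (auto intro!: mult_left_mono)
        then show ?thesis by (simp add: \<phi>_def S_def H(3))
      next
        case False
        then have "1 \<le> real n * (t - y)" "1 \<le> real n * (t - x)"
        proof -
          have "1 / n \<le> t - y" "1 / n \<le> t - x" using False that xy by auto
          then show "1 \<le> real n * (t - y)" "1 \<le> real n * (t - x)"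
            using n0 by (auto simp: field_simps)
        qed
        then show ?thesis by (simp add: \<phi>_def S_def H(4) right_diff_distrib)
      qed
      have "\<phi> n \<in> test_functions"
        unfolding test_functions_def
      proof (intro CollectI conjI)
        show "smooth_on UNIV (\<phi> n)"
          unfolding smooth_on_iff \<phi>_def
          by (intro allI ntimes_diff_on_diff open_UNIV S_smooth[unfolded smooth_on_iff, rule_format])
        have "closure {t. \<phi> n t \<noteq> 0} \<subseteq> {x..y + 1 / n}"
        proof (rule closure_minimal)
          show "{t. \<phi> n t \<noteq> 0} \<subseteq> {x..y + 1 / n}" using zero by blast
        qed simp
        then show "closure {t. \<phi> n t \<noteq> 0} \<subseteq> {0<..<1}" using xy ny by auto
      qed
      then have "integral\<^sup>L leb01 (\<lambda>t. K t * deriv (\<phi> n) t) = - integral\<^sup>L leb01 (\<lambda>t. g t * \<phi> n t)"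
        using w unfolding is_weak_deriv_def by blast
      then show ?thesis
        using int_S[of x n] int_S[of y n] by (simp add: \<phi>_deriv right_diff_distrib)
    qed
    have g_ind: "integrable leb01 (\<lambda>t. g t * indicator {x<..y} t)"
    proof -
      have "(indicator {x<..y} :: real \<Rightarrow> real) \<in> borel_measurable leb01"
        by (intro measurable_restrict_space1 borel_measurable_indicator) simp
      then have "integrable leb01 (\<lambda>t. indicator {x<..y} t * g t)"
        by (rule integrable_leb01_mult[OF _ _ g, of _ 1]) (simp add: indicator_def)
      then show ?thesis by (simp only: mult.commute)
    qed
    have "(\<lambda>n. integral\<^sup>L leb01 (\<lambda>t. g t * \<phi> n t)) \<longlonglongrightarrow>
        integral\<^sup>L leb01 (\<lambda>t. g t * indicator {x<..y} t)"
    proof (rule integral_dominated_convergence[where w = "\<lambda>t. \<bar>g t\<bar>"])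
      show "AE t in leb01. (\<lambda>n. g t * \<phi> n t) \<longlonglongrightarrow> g t * indicator {x<..y} t"
      proof (intro AE_I2 tendsto_mult_left)
        fix t
        have "(\<lambda>n. \<phi> n t) \<longlonglongrightarrow> (if x < t then 1 else 0) - (if y < t then 1 else 0)"
          unfolding \<phi>_def by (intro tendsto_diff S_lim)
        also have "(if x < t then 1 else 0) - (if y < t then 1 else 0) = indicat_real {x<..y} t"
          using xy by auto
        finally show "(\<lambda>n. \<phi> n t) \<longlonglongrightarrow> indicator {x<..y} t" .
      qed
      show "AE t in leb01. norm (g t * \<phi> n t) \<le> \<bar>g t\<bar>" for n
      proof (intro AE_I2)
        fix t
        have "\<bar>\<phi> n t\<bar> \<le> 1"
          using H01[of "real n * t + - (real n * x)"] H01[of "real n * t + - (real n * y)"]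
          unfolding \<phi>_def S_def by linarith
        then show "norm (g t * \<phi> n t) \<le> \<bar>g t\<bar>"
          by (simp add: abs_mult mult_left_le)
      qed
      have [measurable]: "g \<in> borel_measurable leb01" using g by simp
      have "S x n \<in> borel_measurable leb01" for x n
        by (intro measurable_leb01_continuous primitive_continuous[OF S_prim])
      then show "(\<lambda>t. g t * \<phi> n t) \<in> borel_measurable leb01" for n
        unfolding \<phi>_def by simp
      show "(\<lambda>t. g t * indicator {x<..y} t) \<in> borel_measurable leb01"
        by (rule borel_measurable_integrable[OF g_ind])
    qed (use g in auto)
    also have "integral\<^sup>L leb01 (\<lambda>t. g t * indicator {x<..y} t) = integral {x..y} g"
    proof -
      have "integral\<^sup>L leb01 (\<lambda>t. g t * indicator {x<..y} t)
          = integral {0..1} (\<lambda>t. g t * indicator {x<..y} t)"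
        by (rule integral_leb01[OF g_ind])
      also have "\<dots> = integral {0..1} (\<lambda>t. if t \<in> {x..y} then g t else 0)"
        by (rule integral_spike[of "{x}"]) auto
      also have "\<dots> = integral {x..y} g"
        using xy by (subst integral_restrict_Int) (simp add: max_def min_def)
      finally show ?thesis .
    qed
    finally have "(\<lambda>n. - integral\<^sup>L leb01 (\<lambda>t. g t * \<phi> n t)) \<longlonglongrightarrow> - integral {x..y} g"
      by (rule tendsto_minus)
    moreover have "(\<lambda>n. - integral\<^sup>L leb01 (\<lambda>t. g t * \<phi> n t)) \<longlonglongrightarrow> K x - K y"
    proof (rule Lim_transform_eventually)
      show "(\<lambda>n. integral\<^sup>L leb01 (\<lambda>t. K t * deriv (S x n) t) -
          integral\<^sup>L leb01 (\<lambda>t. K t * deriv (S y n) t)) \<longlonglongrightarrow> K x - K y"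
        using xy by (intro tendsto_diff lim_K) auto
      show "\<forall>\<^sub>F n in sequentially. integral\<^sup>L leb01 (\<lambda>t. K t * deriv (S x n) t) -
          integral\<^sup>L leb01 (\<lambda>t. K t * deriv (S y n) t) = - integral\<^sup>L leb01 (\<lambda>t. g t * \<phi> n t)"
        using eq by (auto simp: eventually_sequentially)
    qed
    ultimately have "- integral {x..y} g = K x - K y" by (rule LIMSEQ_unique)
    then show ?thesis by simp
  qed
  \<comment> \<open>The increments of \<open>F\<close> vanish on the open interval, where alone the
    test functions could be placed; constancy then passes to the closure.\<close>
  define F where "F t = K t - integral {0..t} g" for t
  have F_cont: "continuous_on (closure {0<..<1}) F"
    unfolding F_def using K integrable_leb01_sub(1)[OF g, of 0 1]
    by (auto intro!: continuous_intros indefinite_integral_continuous_1)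
  have F_mid: "F t = F (1/2)" if "t \<in> {0<..<1}" for t
  proof (cases t "1/2 :: real" rule: linorder_cases)
    case less then show ?thesis
      using that incr[of t "1/2"] integral_diff_leb01[OF g, of t "1/2"] by (simp add: F_def)
  next
    case greater then show ?thesis
      using that incr[of "1/2" t] integral_diff_leb01[OF g, of "1/2" t] by (simp add: F_def)
  qed (simp only:)
  have "F t = F (1/2)" if "t \<in> {0..1}" for t
    using continuous_constant_on_closure[OF F_cont F_mid, of t] that by simp
  then have F_const: "F t = F 0" if "t \<in> {0..1}" for t
    using that by (metis atLeastAtMost_iff order_refl zero_le_one)
  show ?thesis
    unfolding primitive_def
  proof (intro conjI ballI g)
    fix t :: real assume "t \<in> {0..1}"
    from F_const[OF this] show "K t - K 0 = integral {0..t} g" by (simp add: F_def)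
  qed
qed

lemma W12l_iff:
  "K \<in> W12l \<longleftrightarrow> (\<exists>g\<in>L2. primitive K g) \<and> K 0 = 0 \<and> (\<forall>t. t \<notin> {0..1} \<longrightarrow> K t = 0)"
proof -
  have "K \<in> L2" if "primitive K g" for g
  proof -
    have c: "continuous_on {0..1} K" by (rule primitive_continuous[OF that])
    then show ?thesis
      unfolding L2_def
      by (auto intro!: measurable_leb01_continuous integrable_leb01_continuous continuous_intros)
  qed
  then show ?thesis
    unfolding W12l_def
    using primitive_weak_deriv L2_integrable is_weak_deriv_primitive primitive_continuous by blast
qed

lemma primitive_weak_deriv_W12l:
  assumes "K \<in> W12l"
  shows "weak_deriv K \<in> L2" "primitive K (weak_deriv K)"
proof -
  have "\<exists>g. g \<in> L2 \<and> is_weak_deriv K g" and c: "continuous_on {0..1} K"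
    using assms by (auto simp: W12l_def)
  then have "weak_deriv K \<in> L2 \<and> is_weak_deriv K (weak_deriv K)"
    unfolding weak_deriv_def by (intro someI_ex[of "\<lambda>g. g \<in> L2 \<and> is_weak_deriv K g"])
  then show "weak_deriv K \<in> L2" "primitive K (weak_deriv K)"
    using primitive_weak_deriv[OF c] L2_integrable by auto
qed

text \<open>\<open>weak_deriv\<close> is an arbitrary choice from a class determined only up to null
  sets; the energy may therefore be computed with whatever derivative is at hand.\<close>

lemma energy_eq:
  assumes "K \<in> W12l" "primitive K g" "B \<in> borel_measurable leb01"
  shows "energy B K = 1/2 * integral\<^sup>L leb01 (\<lambda>t. B t * (g t)\<^sup>2)
                      + integral\<^sup>L leb01 (\<lambda>t. (1 - t) * sin (K t))"
proof -
  note w = primitive_weak_deriv_W12l[OF assms(1)]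
  have [measurable]: "weak_deriv K \<in> borel_measurable leb01" "g \<in> borel_measurable leb01"
    using w assms(2) by (auto simp: L2_def primitive_def)
  note assms(3)[measurable]
  have "integral\<^sup>L leb01 (\<lambda>t. B t * (weak_deriv K t)\<^sup>2) = integral\<^sup>L leb01 (\<lambda>t. B t * (g t)\<^sup>2)"
  proof (rule integral_cong_AE)
    show "AE t in leb01. B t * (weak_deriv K t)\<^sup>2 = B t * (g t)\<^sup>2"
      using primitive_deriv_unique[OF w(2) assms(2)] by auto
  qed measurable
  then show ?thesis by (simp add: energy_def)
qed

section \<open>State and adjoint equations\<close>

lemma primitive_mono:
  assumes "primitive F f" "0 \<le> s" "s \<le> t" "t \<le> 1" "\<And>u. u \<in> {s..t} \<Longrightarrow> 0 \<le> f u"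
  shows "F s \<le> F t"
proof -
  have "0 \<le> integral {s..t} f"
    by (rule Henstock_Kurzweil_Integration.integral_nonneg)
       (use assms integrable_leb01_sub(1)[OF primitive_integrable[OF assms(1)], of s t] in auto)
  then show ?thesis using primitive_diff[OF assms(1-4)] by simp
qed

lemma primitive_antimono:
  assumes "primitive F f" "0 \<le> s" "s \<le> t" "t \<le> 1" "\<And>u. u \<in> {s..t} \<Longrightarrow> f u \<le> 0"
  shows "F t \<le> F s"
  using primitive_mono[OF primitive_cmult[OF assms(1), of "-1"] assms(2-4)] assms(5) by simp

lemma primitive_exp: "primitive (\<lambda>t. exp (c * t)) (\<lambda>t. c * exp (c * t))"
  by (rule primitive_of_derivative) (auto intro!: derivative_eq_intros continuous_intros)

text \<open>The right-hand side I of the hypothesis satisfies I' = C \<phi> \<le> C I, so I exp(-C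
  t) is nonincreasing.\<close>

lemma gronwall:
  fixes \<phi> :: "real \<Rightarrow> real"
  assumes \<phi>: "continuous_on {0..1} \<phi>" and C: "0 \<le> C"
    and le: "\<And>t. t \<in> {0..1} \<Longrightarrow> \<phi> t \<le> A + C * integral {0..t} \<phi>" and t: "t \<in> {0..1}"
  shows "\<phi> t \<le> A * exp (C * t)"
proof -
  define I where "I t = A + C * integral {0..t} \<phi>" for t
  have "primitive (\<lambda>t. A + C * (0 + integral {0..t} \<phi>)) (\<lambda>t. 0 + C * \<phi> t)"
    by (intro primitive_add primitive_cmult primitive_indefinite_integral
          integrable_leb01_continuous \<phi>) (simp add: primitive_def)
  then have "primitive I (\<lambda>t. C * \<phi> t)" by (simp add: I_def[abs_def])
  from primitive_mult[OF this primitive_exp[of "- C"]]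
  have p: "primitive (\<lambda>t. I t * exp (- C * t))
      (\<lambda>t. C * \<phi> t * exp (- C * t) + I t * (- C * exp (- C * t)))" .
  have "I t * exp (- C * t) \<le> I 0 * exp (- C * 0)"
  proof (rule primitive_antimono[OF p])
    fix u assume "u \<in> {0..t}"
    then have "\<phi> u \<le> I u" using le[of u] t by (simp add: I_def)
    then have "C * exp (- C * u) * (\<phi> u - I u) \<le> 0"
      using C by (intro mult_nonneg_nonpos) auto
    then show "C * \<phi> u * exp (- C * u) + I u * (- C * exp (- C * u)) \<le> 0"
      by (simp add: algebra_simps)
  qed (use t in auto)
  then have "I t \<le> A * exp (C * t)" by (simp add: I_def exp_minus field_simps)
  then show ?thesis using le[OF t] by (simp add: I_def)
qed

text \<open>Picard iteration from 0, measured with the weight exp(2 C t): integrating this weight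
  and multiplying by C gains a factor 1/2, so successive differences decay geometrically on the
  whole of [0,1] whatever the size of \<open>C\<close>.\<close>

lemma volterra_fixpoint:
  fixes T :: "(real \<Rightarrow> real) \<Rightarrow> real \<Rightarrow> real"
  assumes cont: "\<And>x. continuous_on {0..1} x \<Longrightarrow> continuous_on {0..1} (T x)"
    and C: "0 < C"
    and le: "\<And>x y t. continuous_on {0..1} x \<Longrightarrow> continuous_on {0..1} y \<Longrightarrow> t \<in> {0..1} \<Longrightarrow>
        \<bar>T x t - T y t\<bar> \<le> C * integral {0..t} (\<lambda>s. \<bar>x s - y s\<bar>)"
  obtains x where "continuous_on {0..1} x" "\<And>t. t \<in> {0..1} \<Longrightarrow> T x t = x t"
proof -
  define X where "X n = (T ^^ n) (\<lambda>t. 0)" for n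
  have X0: "X 0 = (\<lambda>t. 0)" and XS: "X (Suc n) = T (X n)" for n by (simp_all add: X_def)
  have X_cont: "continuous_on {0..1} (X n)" for n
    by (induction n) (auto simp: X0 XS intro: cont)
  obtain D where D: "0 \<le> D" "\<And>t. t \<in> {0..1} \<Longrightarrow> \<bar>X 1 t\<bar> \<le> D"
    using continuous_bounded_leb01[OF X_cont[of 1]] by metis
  have step: "\<bar>X (Suc n) t - X n t\<bar> \<le> D * (1/2) ^ n * exp (2 * C * t)" if "t \<in> {0..1}" for n t
    using that
  proof (induction n arbitrary: t)
    case 0
    then have "1 \<le> exp (2 * C * t)" using C by simp
    then have "D * 1 \<le> D * exp (2 * C * t)" using D(1) by (intro mult_left_mono)
    then show ?case using D(2)[OF 0] by (simp add: X0)
  next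
    case (Suc n)
    have e: "primitive (\<lambda>t. D * (1/2) ^ n / (2 * C) * exp (2 * C * t))
        (\<lambda>t. D * (1/2) ^ n / (2 * C) * (2 * C * exp (2 * C * t)))"
      by (intro primitive_cmult primitive_exp)
    have "integral {0..t} (\<lambda>s. \<bar>X (Suc n) s - X n s\<bar>)
        \<le> integral {0..t} (\<lambda>t. D * (1/2) ^ n / (2 * C) * (2 * C * exp (2 * C * t)))"
    proof (rule integral_le)
      have "continuous_on {0..t} (X (Suc n))" "continuous_on {0..t} (X n)"
        using Suc.prems by (auto intro: continuous_on_subset[OF X_cont])
      then show "(\<lambda>s. \<bar>X (Suc n) s - X n s\<bar>) integrable_on {0..t}"
        by (intro integrable_continuous_real continuous_intros)
      show "(\<lambda>t. D * (1/2) ^ n / (2 * C) * (2 * C * exp (2 * C * t))) integrable_on {0..t}"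
        by (intro integrable_continuous_real continuous_intros)
    next
      fix s assume "s \<in> {0..t}"
      then have "\<bar>X (Suc n) s - X n s\<bar> \<le> D * (1/2) ^ n * exp (2 * C * s)"
        using Suc.prems by (intro Suc.IH) auto
      then show "\<bar>X (Suc n) s - X n s\<bar> \<le> D * (1/2) ^ n / (2 * C) * (2 * C * exp (2 * C * s))"
        using C by simp
    qed
    also have "\<dots> = D * (1/2) ^ n / (2 * C) * exp (2 * C * t) - D * (1/2) ^ n / (2 * C) * exp (2 * C * 0)"
      using Suc.prems by (subst primitive_diff[OF e, of 0 t, symmetric]) auto
    also have "\<dots> \<le> D * (1/2) ^ n / (2 * C) * exp (2 * C * t)"
      using D C by simp
    finally have "C * integral {0..t} (\<lambda>s. \<bar>X (Suc n) s - X n s\<bar>)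
        \<le> C * (D * (1/2) ^ n / (2 * C) * exp (2 * C * t))"
      using C by (intro mult_left_mono) auto
    also have "\<dots> = D * (1/2) ^ Suc n * exp (2 * C * t)" using C by (simp add: field_simps)
    finally show ?case
      using le[OF X_cont X_cont Suc.prems, of "Suc n" n] by (simp add: XS)
  qed
  define x where "x t = (\<Sum>i. X (Suc i) t - X i t)" for t
  have "uniform_limit {0..1} (\<lambda>n t. \<Sum>i<n. X (Suc i) t - X i t) x sequentially"
    unfolding x_def
  proof (rule Weierstrass_m_test)
    fix n t assume t: "t \<in> {0..1::real}"
    have "D * (1/2) ^ n * exp (2 * C * t) \<le> D * (1/2) ^ n * exp (2 * C)"
      using D C t by (intro mult_left_mono) auto
    then show "norm (X (Suc n) t - X n t) \<le> D * exp (2 * C) * (1/2) ^ n"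
      using step[OF t, of n] by (simp add: mult_ac)
  qed (intro summable_mult summable_geometric; simp)
  then have "uniform_limit {0..1} (\<lambda>n t. X n t - X 0 t) x sequentially"
    by (simp add: sum_lessThan_telescope[of "\<lambda>i. X i _"])
  then have ul: "uniform_limit {0..1} X x sequentially" by (simp add: X0)
  have x: "continuous_on {0..1} x"
    by (rule uniform_limit_theorem[OF _ ul]) (auto simp: X_cont)
  have "T x t = x t" if t: "t \<in> {0..1}" for t
  proof (rule LIMSEQ_unique)
    show "(\<lambda>n. X (Suc n) t) \<longlonglongrightarrow> x t"
      using tendsto_uniform_limitI[OF ul t] by (rule LIMSEQ_Suc)
    show "(\<lambda>n. X (Suc n) t) \<longlonglongrightarrow> T x t"
    proof (rule LIMSEQ_I)
      fix r :: real assume "0 < r"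
      then have "0 < r / (2 * C)" using C by simp
      then have "\<forall>\<^sub>F n in sequentially. \<forall>s\<in>{0..1}. dist (X n s) (x s) < r / (2 * C)"
        using ul unfolding uniform_limit_iff by blast
      then obtain N where N: "\<And>n s. n \<ge> N \<Longrightarrow> s \<in> {0..1} \<Longrightarrow> \<bar>X n s - x s\<bar> < r / (2 * C)"
        unfolding eventually_sequentially dist_real_def by blast
      have "\<bar>X (Suc n) t - T x t\<bar> < r" if "n \<ge> N" for n
      proof -
        have "continuous_on {0..t} (X n)" "continuous_on {0..t} x"
          using t by (auto intro: continuous_on_subset[OF X_cont] continuous_on_subset[OF x])
        then have "integral {0..t} (\<lambda>s. \<bar>X n s - x s\<bar>) \<le> integral {0..t} (\<lambda>s. r / (2 * C))"
          using t N[OF that] by (intro integral_le integrable_continuous_real continuous_intros)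
            (auto intro: less_imp_le)
        also have "\<dots> \<le> r / (2 * C)"
          using t mult_right_mono[of t 1 "r / (2 * C)"] \<open>0 < r / (2 * C)\<close> by simp
        finally have "C * integral {0..t} (\<lambda>s. \<bar>X n s - x s\<bar>) \<le> C * (r / (2 * C))"
          using C by (intro mult_left_mono) auto
        also have "\<dots> < r" using C \<open>0 < r\<close> by simp
        finally show ?thesis using le[OF X_cont x t, of n] by (simp add: XS)
      qed
      then show "\<exists>no. \<forall>n\<ge>no. norm (X (Suc n) t - T x t) < r" by auto
    qed
  qed
  with x that show ?thesis by blast
qed

text \<open>To be applied to differences: \<open>K\<close>, \<open>U\<close> are differences of two
  solutions or iterates, and \<open>x\<close> is the difference of the inputs in the source. It
  serves both the contraction estimate for existence and the dependence on the initial flux.\<close>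

lemma two_step_integral_bound:
  fixes b :: "real \<Rightarrow> real"
  assumes K: "primitive K (\<lambda>t. b t * U t)" and U: "primitive U h"
    and b: "\<And>t. \<bar>b t\<bar> \<le> M" and "K 0 = 0"
    and x: "continuous_on {0..1} x" and h: "\<And>t. t \<in> {0..1} \<Longrightarrow> \<bar>h t\<bar> \<le> \<bar>x t\<bar>"
    and t: "t \<in> {0..1}"
  shows "\<bar>U t\<bar> \<le> \<bar>U 0\<bar> + integral {0..t} (\<lambda>s. \<bar>x s\<bar>)"
    and "\<bar>K t\<bar> \<le> M * (\<bar>U 0\<bar> + integral {0..t} (\<lambda>s. \<bar>x s\<bar>))"
proof -
  have ix: "(\<lambda>s. \<bar>x s\<bar>) integrable_on {0..s}" if "s \<in> {0..1}" for s
    using that by (intro integrable_continuous_real continuous_intros continuous_on_subset[OF x]) auto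
  have bU: "\<bar>U s\<bar> \<le> \<bar>U 0\<bar> + integral {0..s} (\<lambda>s. \<bar>x s\<bar>)" if s: "s \<in> {0..1}" for s
  proof -
    have "norm (integral {0..s} h) \<le> integral {0..s} (\<lambda>s. \<bar>x s\<bar>)"
      using s h by (intro integral_norm_bound_integral ix
          integrable_leb01_sub(1)[OF primitive_integrable[OF U]]) auto
    then show ?thesis using primitive_diff[OF U, of 0 s] s by simp
  qed
  then show "\<bar>U t\<bar> \<le> \<bar>U 0\<bar> + integral {0..t} (\<lambda>s. \<bar>x s\<bar>)" using t by blast
  define J where "J = \<bar>U 0\<bar> + integral {0..t} (\<lambda>s. \<bar>x s\<bar>)"
  have "0 \<le> integral {0..t} (\<lambda>s. \<bar>x s\<bar>)"
    by (intro Henstock_Kurzweil_Integration.integral_nonneg ix t) auto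
  then have J: "0 \<le> J" by (simp add: J_def)
  have M: "0 \<le> M" using b[of 0] by linarith
  have "norm (integral {0..t} (\<lambda>t. b t * U t)) \<le> integral {0..t} (\<lambda>s. M * J)"
  proof (rule integral_norm_bound_integral)
    show "(\<lambda>t. b t * U t) integrable_on {0..t}"
      using t by (intro integrable_leb01_sub(1)[OF primitive_integrable[OF K]]) auto
    fix s assume s: "s \<in> {0..t}"
    then have "integral {0..s} (\<lambda>s. \<bar>x s\<bar>) \<le> integral {0..t} (\<lambda>s. \<bar>x s\<bar>)"
      using t by (intro integral_subset_le ix) auto
    then have "\<bar>U s\<bar> \<le> J" using bU[of s] s t by (simp add: J_def)
    then show "norm (b s * U s) \<le> M * J"
      using b[of s] M by (simp add: abs_mult mult_mono)
  qed auto
  also have "\<dots> \<le> M * J"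
    using t J M mult_right_mono[of t 1 "M * J"] by (simp add: mult_ac)
  finally show "\<bar>K t\<bar> \<le> M * (\<bar>U 0\<bar> + integral {0..t} (\<lambda>s. \<bar>x s\<bar>))"
    using primitive_diff[OF K, of 0 t] t \<open>K 0 = 0\<close> by (simp add: J_def)
qed

text \<open>Eliminating \<open>U\<close> leaves a scalar Volterra equation for \<open>K\<close>:
  integrate the source, multiply by the bounded measurable \<open>b\<close>, integrate
  again.\<close>

lemma ivp_exists:
  fixes b :: "real \<Rightarrow> real" and h :: "real \<Rightarrow> real \<Rightarrow> real"
  assumes b: "b \<in> borel_measurable leb01" "\<And>t. \<bar>b t\<bar> \<le> M"
    and h_cont: "\<And>x. continuous_on {0..1} x \<Longrightarrow> continuous_on {0..1} (\<lambda>t. h t (x t))"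
    and h_lip: "\<And>t x y. t \<in> {0..1} \<Longrightarrow> \<bar>h t x - h t y\<bar> \<le> \<bar>x - y\<bar>"
  obtains K U where "primitive K (\<lambda>t. b t * U t)" "primitive U (\<lambda>t. h t (K t))" "K 0 = 0" "U 0 = \<sigma>"
proof -
  define U where "U K t = \<sigma> + integral {0..t} (\<lambda>r. h r (K r))" for K t
  define T where "T K t = 0 + integral {0..t} (\<lambda>s. b s * U K s)" for K t
  have prim_U: "primitive (U K) (\<lambda>t. h t (K t))" if "continuous_on {0..1} K" for K
    unfolding U_def by (intro primitive_indefinite_integral integrable_leb01_continuous h_cont that)
  have U0: "U K 0 = \<sigma>" and T0: "T K 0 = 0" for K by (simp_all add: U_def T_def)
  have prim_T: "primitive (T K) (\<lambda>t. b t * U K t)" if "continuous_on {0..1} K" for K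
    unfolding T_def
    by (intro primitive_indefinite_integral integrable_leb01_mult[OF b]
        integrable_leb01_continuous primitive_continuous[OF prim_U] that)
  have "0 \<le> M" using b(2)[of 0] by linarith
  obtain K where K: "continuous_on {0..1} K" "\<And>t. t \<in> {0..1} \<Longrightarrow> T K t = K t"
  \<comment> \<open>The contraction lemma wants a positive constant, and \<open>M\<close> may be
    0.\<close>
  proof (rule volterra_fixpoint[of T "M + 1"])
    fix x y :: "real \<Rightarrow> real" and t :: real
    assume x: "continuous_on {0..1} x" and y: "continuous_on {0..1} y" and t: "t \<in> {0..1}"
    have "\<bar>T x t - T y t\<bar> \<le> M * (\<bar>U x 0 - U y 0\<bar> + integral {0..t} (\<lambda>s. \<bar>x s - y s\<bar>))"
    proof (rule two_step_integral_bound(2)[where h = "\<lambda>t. h t (x t) - h t (y t)" and b = b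
          and K = "\<lambda>t. T x t - T y t" and U = "\<lambda>t. U x t - U y t" and x = "\<lambda>t. x t - y t"])
      show "primitive (\<lambda>t. T x t - T y t) (\<lambda>t. b t * (U x t - U y t))"
        using primitive_sub[OF prim_T[OF x] prim_T[OF y]] by (simp add: right_diff_distrib)
    qed (use b x y t in \<open>auto intro!: primitive_sub prim_U continuous_intros h_lip simp: T0\<close>)
    moreover have "0 \<le> integral {0..t} (\<lambda>s. \<bar>x s - y s\<bar>)"
      using t by (intro Henstock_Kurzweil_Integration.integral_nonneg integrable_continuous_real
          continuous_intros continuous_on_subset[OF x] continuous_on_subset[OF y]) auto
    ultimately show "\<bar>T x t - T y t\<bar> \<le> (M + 1) * integral {0..t} (\<lambda>s. \<bar>x s - y s\<bar>)"
      by (simp add: U0 distrib_right)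
  qed (use \<open>0 \<le> M\<close> primitive_continuous[OF prim_T] in auto)
  show ?thesis
  proof (rule that)
    show "primitive K (\<lambda>t. b t * U K t)"
      using prim_T[OF K(1)] K(2) by (rule primitive_cong)
    show "K 0 = 0" using K(2)[of 0] by (simp add: T0)
  qed (use prim_U[OF K(1)] U0 in auto)
qed

text \<open>Gives the continuity in the initial flux on which shooting relies. Gronwall controls K -
  L by the initial difference, and the Lipschitz source passes this bound on to the flux at
  1.\<close>

lemma ivp_lipschitz:
  fixes b :: "real \<Rightarrow> real" and h :: "real \<Rightarrow> real \<Rightarrow> real"
  assumes b: "\<And>t. \<bar>b t\<bar> \<le> M"
    and h_lip: "\<And>t x y. t \<in> {0..1} \<Longrightarrow> \<bar>h t x - h t y\<bar> \<le> \<bar>x - y\<bar>"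
    and K: "primitive K (\<lambda>t. b t * U t)" "primitive U (\<lambda>t. h t (K t))" "K 0 = 0"
    and L: "primitive L (\<lambda>t. b t * V t)" "primitive V (\<lambda>t. h t (L t))" "L 0 = 0"
  shows "\<bar>U 1 - V 1\<bar> \<le> (1 + M * exp M) * \<bar>U 0 - V 0\<bar>"
proof -
  have M: "0 \<le> M" using b[of 0] by linarith
  have cont: "continuous_on {0..1} (\<lambda>t. K t - L t)"
    by (intro continuous_intros primitive_continuous[OF K(1)] primitive_continuous[OF L(1)])
  have p: "primitive (\<lambda>t. K t - L t) (\<lambda>t. b t * (U t - V t))"
    using primitive_sub[OF K(1) L(1)] by (simp add: right_diff_distrib)
  have KL0: "K 0 - L 0 = 0" using K(3) L(3) by simp
  note bound = two_step_integral_bound[OF p primitive_sub[OF K(2) L(2)] b KL0 cont h_lip]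
  have gr: "\<bar>K t - L t\<bar> \<le> M * \<bar>U 0 - V 0\<bar> * exp (M * t)" if "t \<in> {0..1}" for t
  proof (rule gronwall[OF _ M _ that])
    show "continuous_on {0..1} (\<lambda>t. \<bar>K t - L t\<bar>)" by (intro continuous_intros cont)
    show "\<bar>K s - L s\<bar> \<le> M * \<bar>U 0 - V 0\<bar> + M * integral {0..s} (\<lambda>t. \<bar>K t - L t\<bar>)"
      if "s \<in> {0..1}" for s
      using bound(2)[OF _ that] by (simp add: distrib_left)
  qed
  have "integral {0..1} (\<lambda>t. \<bar>K t - L t\<bar>) \<le> integral {0..1} (\<lambda>t::real. M * \<bar>U 0 - V 0\<bar> * exp M)"
  proof (rule integral_le)
    fix t :: real assume t: "t \<in> {0..1}"
    have "M * \<bar>U 0 - V 0\<bar> * exp (M * t) \<le> M * \<bar>U 0 - V 0\<bar> * exp M"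
      using M t by (intro mult_left_mono) (auto simp: mult_left_le)
    then show "\<bar>K t - L t\<bar> \<le> M * \<bar>U 0 - V 0\<bar> * exp M" using gr[OF t] by simp
  qed (auto intro!: integrable_continuous_real continuous_intros cont)
  then show ?thesis
    using bound(1)[of 1] by (simp add: algebra_simps)
qed

section \<open>The state equation by shooting\<close>

lemma abs_cos_diff_le: "\<bar>cos x - cos y\<bar> \<le> \<bar>x - y\<bar>" for x y :: real
proof -
  have "\<bar>cos x - cos y\<bar> = 2 * \<bar>sin ((x + y) / 2)\<bar> * \<bar>sin ((y - x) / 2)\<bar>"
    by (simp add: cos_diff_cos abs_mult)
  also have "\<dots> \<le> 2 * 1 * \<bar>(y - x) / 2\<bar>"
    by (intro mult_mono abs_sin_x_le_abs_x abs_sin_le_one) auto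
  finally show ?thesis by simp
qed

text \<open>\<open>U\<close> plays the role of the flux \<open>BK'\<close>.\<close>

definition solves_state :: "(real \<Rightarrow> real) \<Rightarrow> (real \<Rightarrow> real) \<Rightarrow> (real \<Rightarrow> real) \<Rightarrow> bool" where
  "solves_state B K U \<longleftrightarrow>
     primitive K (\<lambda>t. U t / B t) \<and> primitive U (\<lambda>t. (1 - t) * cos (K t)) \<and>
     K 0 = 0 \<and> U 1 = 0 \<and> (\<forall>t\<in>{0..1}. - pi / 2 \<le> K t \<and> K t \<le> 0)"

lemma solves_state_exists:
  assumes B: "B \<in> borel_measurable leb01" "\<And>t. a \<le> B t" and "0 < a"
  obtains K U where "solves_state B K U"
proof -
  \<comment> \<open>The cosine frozen outside [-pi/2, 0]: it has values in [0,1] for every argument,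
    and it is 0 below -pi/2. Both facts are used, the first for the sign change in the shooting, the
    second to keep the solution in range.\<close>
  define c :: "real \<Rightarrow> real" where "c x = cos (max (- pi / 2) (min x 0))" for x
  define h where "h t x = (1 - t) * c x" for t x
  have c01: "0 \<le> c x" "c x \<le> 1" for x
    unfolding c_def by (auto intro!: cos_ge_zero simp: max_def min_def)
  have c_lip: "\<bar>c x - c y\<bar> \<le> \<bar>x - y\<bar>" for x y
    unfolding c_def by (rule order_trans[OF abs_cos_diff_le]) (auto simp: max_def min_def)
  have h_cont: "continuous_on {0..1} (\<lambda>t. h t (x t))" if "continuous_on {0..1} x" for x
    unfolding h_def c_def by (intro continuous_intros that)
  have h_lip: "\<bar>h t x - h t y\<bar> \<le> \<bar>x - y\<bar>" if "t \<in> {0..1}" for t x y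
  proof -
    have "\<bar>h t x - h t y\<bar> = (1 - t) * \<bar>c x - c y\<bar>"
      using that by (simp add: h_def right_diff_distrib[symmetric] abs_mult)
    also have "\<dots> \<le> 1 * \<bar>x - y\<bar>" using that by (intro mult_mono c_lip) auto
    finally show ?thesis by simp
  qed
  have pos: "0 < B t" for t using B(2)[of t] \<open>0 < a\<close> by linarith
  have b: "(\<lambda>t. 1 / B t) \<in> borel_measurable leb01" "\<And>t. \<bar>1 / B t\<bar> \<le> 1 / a"
    using B pos \<open>0 < a\<close> by (auto simp: frac_le less_imp_le abs_of_pos)
  have "\<exists>K U. primitive K (\<lambda>t. 1 / B t * U t) \<and> primitive U (\<lambda>t. h t (K t)) \<and> K 0 = 0 \<and> U 0 = \<sigma>" for \<sigma>
    by (rule ivp_exists[OF b h_cont h_lip]) blast+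
  then obtain K U where KU: "\<And>\<sigma>. primitive (K \<sigma>) (\<lambda>t. 1 / B t * U \<sigma> t)"
    "\<And>\<sigma>. primitive (U \<sigma>) (\<lambda>t. h t (K \<sigma> t))" "\<And>\<sigma>. K \<sigma> 0 = 0" "\<And>\<sigma>. U \<sigma> 0 = \<sigma>"
    by metis
  have U1: "U \<sigma> 1 - \<sigma> = integral {0..1} (\<lambda>t. h t (K \<sigma> t))" for \<sigma>
    using primitive_diff[OF KU(2), of 0 1 \<sigma>] KU(4) by simp
  have int: "(\<lambda>t. h t (K \<sigma> t)) integrable_on {0..1}" for \<sigma>
    using integrable_leb01_sub(1)[OF primitive_integrable[OF KU(2)], of 0 1] by simp
  have h01: "0 \<le> h t x" "h t x \<le> 1" if "t \<in> {0..1}" for t x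
    using that c01[of x] by (auto simp: h_def mult_le_one)
  have I0: "0 \<le> integral {0..1} (\<lambda>t. h t (K \<sigma> t))" for \<sigma>
    by (intro Henstock_Kurzweil_Integration.integral_nonneg int h01)
  have "integral {0..1} (\<lambda>t. h t (K \<sigma> t)) \<le> integral {0..1::real} (\<lambda>t. 1)" for \<sigma>
    by (intro integral_le int h01) auto
  then have I1: "integral {0..1} (\<lambda>t. h t (K \<sigma> t)) \<le> 1" for \<sigma> by simp
  \<comment> \<open>The source lies in [0,1], so the flux grows by at most 1 over the interval; the
    initial values -1 and 0 therefore bracket a vanishing end flux.\<close>
  have ends: "U (-1) 1 \<le> 0" "0 \<le> U 0 1"
    using U1[of "-1"] U1[of 0] I0[of 0] I1[of "-1"] by linarith+
  have "continuous_on {-1..0} (\<lambda>\<sigma>. U \<sigma> 1)"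
  proof (rule lipschitz_on_continuous_on[of "1 + 1 / a * exp (1 / a)"], rule lipschitz_onI)
    fix \<sigma> \<tau> :: real
    show "dist (U \<sigma> 1) (U \<tau> 1) \<le> (1 + 1 / a * exp (1 / a)) * dist \<sigma> \<tau>"
      using ivp_lipschitz[OF b(2) h_lip KU(1-3) KU(1-3), of \<sigma> \<tau>] KU(4) by (simp add: dist_real_def)
  qed (use \<open>0 < a\<close> in simp)
  then obtain \<sigma> where \<sigma>: "U \<sigma> 1 = 0"
    using IVT'[of "\<lambda>\<sigma>. U \<sigma> 1" "-1" 0 0] ends by auto
  define k u where "k = K \<sigma>" and "u = U \<sigma>"
  have k: "primitive k (\<lambda>t. 1 / B t * u t)" "primitive u (\<lambda>t. h t (k t))" "k 0 = 0" "u 1 = 0"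
    using KU \<sigma> by (auto simp: k_def u_def)
  have u_le: "u t \<le> 0" if "t \<in> {0..1}" for t
    using primitive_mono[OF k(2), of t 1] h01 that k(4) by auto
  have k_anti: "k t \<le> k s" if "0 \<le> s" "s \<le> t" "t \<le> 1" for s t
    by (rule primitive_antimono[OF k(1) that])
       (use that u_le pos in \<open>auto intro!: mult_nonneg_nonpos simp: less_imp_le divide_nonpos_pos\<close>)
  have k_le: "k t \<le> 0" if "t \<in> {0..1}" for t
    using k_anti[of 0 t] that k(3) by auto
  \<comment> \<open>Once the nonincreasing \<open>k\<close> has reached -pi/2 the truncated source
    vanishes, so the flux keeps its end value 0 and \<open>k\<close> stays where it is.\<close>
  have k_ge: "- pi / 2 \<le> k t" if t: "t \<in> {0..1}" for t
  proof (rule ccontr)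
    assume n: "\<not> - pi / 2 \<le> k t"
    have "continuous_on {0..t} k"
      using t by (intro continuous_on_subset[OF primitive_continuous[OF k(1)]]) auto
    then obtain z where z: "0 \<le> z" "z \<le> t" "k z = - pi / 2"
      using IVT2'[of k t "- pi / 2" 0] n t k(3) by auto
    have hz: "h s (k s) = 0" if "s \<in> {z..1}" for s
    proof -
      have "max (- pi / 2) (min (k s) 0) = - pi / 2"
        using k_anti[of z s] that z pi_gt_zero by simp
      then show ?thesis by (simp add: h_def c_def)
    qed
    have "u s = 0" if "s \<in> {z..1}" for s
      using primitive_mono[OF k(2), of s 1] primitive_antimono[OF k(2), of s 1] hz that z k(4) by auto
    then have "k z \<le> k t"
      using z t by (intro primitive_mono[OF k(1)]) auto
    then show False using n z by simp
  qed
  have "solves_state B k u"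
    unfolding solves_state_def
  proof (intro conjI ballI k k_ge k_le)
    show "primitive k (\<lambda>t. u t / B t)" using k(1) by simp
    have "h t (k t) = (1 - t) * cos (k t)" if "t \<in> {0..1}" for t
      using k_ge[OF that] k_le[OF that] by (simp add: h_def c_def)
    then show "primitive u (\<lambda>t. (1 - t) * cos (k t))"
      by (intro primitive_cong_AE[OF k(2)] AE_I2 measurable_leb01_continuous continuous_intros
           primitive_continuous[OF k(1)]) auto
  qed
  then show ?thesis by (rule that)
qed

lemma two_abs_mult_le: "\<bar>2 * (x * y)\<bar> \<le> x\<^sup>2 + y\<^sup>2" for x y :: real
  using zero_le_power2[of "x + y"] zero_le_power2[of "x - y"]
  by (simp add: power2_sum power2_diff abs_le_iff)

text \<open>A zero of the flux before 1 persists up to 1, because \<open>U\<close> is nondecreasing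
  with \<open>U 1 = 0\<close>; the source is then zero as well, which forces the angle -pi/2. But
  angle -pi/2 with flux 0 is an equilibrium, so by backward uniqueness the solution would have
  started there, contradicting \<open>K 0 = 0\<close>.\<close>

lemma solves_state_flux_negative:
  assumes st: "solves_state B K U" and B: "\<And>t. a \<le> B t" and "0 < a" and t: "0 \<le> t" "t < 1"
  shows "U t < 0"
proof (rule ccontr)
  assume n: "\<not> U t < 0"
  have K: "primitive K (\<lambda>t. U t / B t)" and U: "primitive U (\<lambda>t. (1 - t) * cos (K t))"
    and K0: "K 0 = 0" and U1: "U 1 = 0" and rng: "\<And>t. t \<in> {0..1} \<Longrightarrow> - pi / 2 \<le> K t \<and> K t \<le> 0"
    using st by (auto simp: solves_state_def)
  have cK: "continuous_on {0..1} K" by (rule primitive_continuous[OF K])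
  have cos_nn: "0 \<le> cos (K s)" if "s \<in> {0..1}" for s
    using rng[OF that] by (intro cos_ge_zero) auto
  have U_mono: "U r \<le> U s" if "0 \<le> r" "r \<le> s" "s \<le> 1" for r s
    using that cos_nn by (intro primitive_mono[OF U]) auto
  have U_zero: "U s = 0" if "s \<in> {t..1}" for s
    using U_mono[of t s] U_mono[of s 1] that t n U1 by auto
  have "K t = - pi / 2"
  proof (rule ccontr)
    assume "K t \<noteq> - pi / 2"
    then have "0 < cos (K t)" using rng[of t] t by (intro cos_gt_zero_pi) auto
    then have "0 < (1 - t) * cos (K t)" using t by simp
    moreover have "integral {t..1} (\<lambda>s. (1 - s) * cos (K s)) = 0"
      using primitive_diff[OF U, of t 1] U_zero[of t] U1 t by simp
    moreover have "continuous_on {t..1} (\<lambda>s. (1 - s) * cos (K s))"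
      using t by (intro continuous_intros continuous_on_subset[OF cK]) auto
    moreover have "0 \<le> (1 - s) * cos (K s)" if "s \<in> {t..1}" for s
      using cos_nn[of s] that t by auto
    ultimately have "\<forall>s\<in>{t..1}. (1 - s) * cos (K s) = 0"
      using integral_eq_0_iff[of t 1 "\<lambda>s. (1 - s) * cos (K s)"] t by blast
    then have "(1 - t) * cos (K t) = 0" by (rule bspec) (use t in simp)
    then show False using \<open>0 < (1 - t) * cos (K t)\<close> by linarith
  qed
  \<comment> \<open>Backward uniqueness through the squared distance m^2 + U^2 to the equilibrium, m
    = K + pi/2: multiplied by exp(C t) it is nondecreasing. The term 1/a pays for the equation of
    \<open>K\<close>, the term 1 for that of \<open>U\<close>, where cos K = sin m \<le> m.\<close>
  define C where "C = 1 / a + 1"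
  have m: "primitive (\<lambda>t. K t + pi / 2) (\<lambda>t. U t / B t)"
    using primitive_add[OF K, of "\<lambda>_. pi / 2" "\<lambda>_. 0"] by (simp add: primitive_def)
  have sq: "primitive (\<lambda>t. (K t + pi / 2) * (K t + pi / 2) + U t * U t)
     (\<lambda>t. (U t / B t * (K t + pi / 2) + (K t + pi / 2) * (U t / B t)) +
          ((1 - t) * cos (K t) * U t + U t * ((1 - t) * cos (K t))))"
    by (intro primitive_add primitive_mult m U)
  have regroup: "(u / b * m + m * (u / b) + (p * u + u * p)) * e + (m * m + u * u) * (C * e)
      = (2 * (m * u) / b + 2 * (p * u) + (m\<^sup>2 + u\<^sup>2) * C) * e" for u b m p e :: real
    by (simp add: algebra_simps power2_eq_square)
  have "((K 0 + pi / 2) * (K 0 + pi / 2) + U 0 * U 0) * exp (C * 0)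
      \<le> ((K t + pi / 2) * (K t + pi / 2) + U t * U t) * exp (C * t)"
  proof (rule primitive_mono[OF primitive_mult[OF sq primitive_exp[of C]]])
    fix s assume s: "s \<in> {0..t}"
    let ?m = "K s + pi / 2" and ?u = "U s"
    have "?m \<ge> 0" using rng[of s] s t by auto
    have "cos (K s) = sin ?m" by (simp add: sin_add)
    then have cb: "cos (K s) \<le> ?m" using sin_x_le_x[OF \<open>?m \<ge> 0\<close>] by simp
    have pos: "0 < B s" using B[of s] \<open>0 < a\<close> by linarith
    have mu: "\<bar>2 * (?m * ?u)\<bar> \<le> ?m\<^sup>2 + ?u\<^sup>2" by (rule two_abs_mult_le)
    have "\<bar>2 * (?m * ?u) / B s\<bar> \<le> (?m\<^sup>2 + ?u\<^sup>2) / a"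
      unfolding abs_divide abs_of_pos[OF pos] using mu B[of s] \<open>0 < a\<close> by (intro frac_le) auto
    then have 1: "- ((?m\<^sup>2 + ?u\<^sup>2) / a) \<le> 2 * (?m * ?u) / B s" by linarith
    have "\<bar>(1 - s) * cos (K s) * ?u\<bar> \<le> 1 * ?m * \<bar>?u\<bar>"
      unfolding abs_mult using s t cb cos_nn[of s] \<open>?m \<ge> 0\<close> by (intro mult_right_mono mult_mono) auto
    then have "\<bar>2 * ((1 - s) * cos (K s) * ?u)\<bar> \<le> ?m\<^sup>2 + ?u\<^sup>2"
      using mu \<open>?m \<ge> 0\<close> by (simp add: abs_mult)
    then have 2: "- (?m\<^sup>2 + ?u\<^sup>2) \<le> 2 * ((1 - s) * cos (K s) * ?u)" by linarith
    have "0 \<le> 2 * (?m * ?u) / B s + 2 * ((1 - s) * cos (K s) * ?u) + (?m\<^sup>2 + ?u\<^sup>2) * C"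
      using 1 2 by (simp add: C_def distrib_left)
    then have "0 \<le> (2 * (?m * ?u) / B s + 2 * ((1 - s) * cos (K s) * ?u) + (?m\<^sup>2 + ?u\<^sup>2) * C) * exp (C * s)"
      by simp
    then show "0 \<le> ((U s / B s * ?m + ?m * (U s / B s)) +
          ((1 - s) * cos (K s) * U s + U s * ((1 - s) * cos (K s)))) * exp (C * s) +
          (?m * ?m + U s * U s) * (C * exp (C * s))"
      unfolding regroup .
  qed (use t in auto)
  then have "(pi / 2) * (pi / 2) + U 0 * U 0 \<le> 0"
    using K0 U_zero[of t] \<open>K t = - pi / 2\<close> t by simp
  moreover have "0 < (pi / 2) * (pi / 2)" by simp
  moreover have "0 \<le> U 0 * U 0" by simp
  ultimately show False by linarith
qed

section \<open>The adjoint equation\<close>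

definition solves_adjoint :: "(real \<Rightarrow> real) \<Rightarrow> (real \<Rightarrow> real) \<Rightarrow> (real \<Rightarrow> real) \<Rightarrow> (real \<Rightarrow> real) \<Rightarrow> bool" where
  "solves_adjoint B K P V \<longleftrightarrow>
     primitive P (\<lambda>t. V t / B t) \<and> primitive V (\<lambda>t. (1 - t) * (cos (K t) - sin (K t) * P t)) \<and>
     P 0 = 0 \<and> V 1 = 0"

text \<open>The problem is linear, so a multiple of the homogeneous solution with initial flux 1 is
  added to a particular solution to correct the end flux. This works because sin K \<le> 0 makes
  first \<open>P1 V1\<close> and then \<open>V1 V1\<close> nondecreasing, whence \<open>V1 1\<close>
  is nonzero.\<close>

lemma solves_adjoint_exists:
  assumes B: "B \<in> borel_measurable leb01" "\<And>t. a \<le> B t" and "0 < a"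
    and K: "continuous_on {0..1} K" "\<And>t. t \<in> {0..1} \<Longrightarrow> sin (K t) \<le> 0"
  obtains P V where "solves_adjoint B K P V"
proof -
  have pos: "0 < B t" for t using B(2)[of t] \<open>0 < a\<close> by linarith
  have b: "(\<lambda>t. 1 / B t) \<in> borel_measurable leb01" "\<And>t. \<bar>1 / B t\<bar> \<le> 1 / a"
    using B pos \<open>0 < a\<close> by (auto simp: frac_le less_imp_le abs_of_pos)
  have lip: "\<bar>(1 - t) * (c - sin (K t) * x) - (1 - t) * (c - sin (K t) * y)\<bar> \<le> \<bar>x - y\<bar>"
    if "t \<in> {0..1}" for t x y c
  proof -
    have "(1 - t) * (c - sin (K t) * x) - (1 - t) * (c - sin (K t) * y) = (1 - t) * sin (K t) * (y - x)"
      by (simp add: algebra_simps)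
    also have "\<bar>\<dots>\<bar> \<le> 1 * 1 * \<bar>y - x\<bar>"
      unfolding abs_mult using that by (intro mult_mono) auto
    finally show ?thesis by simp
  qed
  obtain P0 V0 where 0: "primitive P0 (\<lambda>t. 1 / B t * V0 t)"
    "primitive V0 (\<lambda>t. (1 - t) * (cos (K t) - sin (K t) * P0 t))" "P0 0 = 0" "V0 0 = 0"
    by (rule ivp_exists[OF b, of "\<lambda>t x. (1 - t) * (cos (K t) - sin (K t) * x)" 0])
       (erule lip | intro continuous_intros K(1) | assumption)+
  obtain P1 V1 where 1: "primitive P1 (\<lambda>t. 1 / B t * V1 t)"
    "primitive V1 (\<lambda>t. (1 - t) * (0 - sin (K t) * P1 t))" "P1 0 = 0" "V1 0 = 1"
    by (rule ivp_exists[OF b, of "\<lambda>t x. (1 - t) * (0 - sin (K t) * x)" 1])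
       (erule lip | intro continuous_intros K(1) | assumption)+
  have PV: "0 \<le> P1 t * V1 t" if "t \<in> {0..1}" for t
  proof -
    have "P1 0 * V1 0 \<le> P1 t * V1 t"
    proof (rule primitive_mono[OF primitive_mult[OF 1(1,2)]])
      fix s assume s: "s \<in> {0..t}"
      have "0 \<le> V1 s * V1 s / B s" using pos[of s] by simp
      moreover have "0 \<le> (1 - s) * (- sin (K s)) * (P1 s * P1 s)"
        using s that K(2)[of s] by (intro mult_nonneg_nonneg[OF _ zero_le_square]) (simp add: mult_nonneg_nonpos)
      ultimately show "0 \<le> 1 / B s * V1 s * V1 s + P1 s * ((1 - s) * (0 - sin (K s) * P1 s))"
        by (simp add: algebra_simps)
    qed (use that in auto)
    then show ?thesis by (simp add: 1)
  qed
  have "V1 0 * V1 0 \<le> V1 1 * V1 1"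
  proof (rule primitive_mono[OF primitive_mult[OF 1(2,2)]])
    fix s :: real assume s: "s \<in> {0..1}"
    have "0 \<le> (1 - s) * (- sin (K s)) * (P1 s * V1 s)"
      using s K(2)[of s] by (intro mult_nonneg_nonneg[OF _ PV[OF s]]) (simp add: mult_nonneg_nonpos)
    then show "0 \<le> (1 - s) * (0 - sin (K s) * P1 s) * V1 s + V1 s * ((1 - s) * (0 - sin (K s) * P1 s))"
      by (simp add: algebra_simps)
  qed auto
  then have V1: "V1 1 \<noteq> 0" using 1(4) by auto
  define \<alpha> where "\<alpha> = - V0 1 / V1 1"
  have "solves_adjoint B K (\<lambda>t. P0 t + \<alpha> * P1 t) (\<lambda>t. V0 t + \<alpha> * V1 t)"
    unfolding solves_adjoint_def
  proof (intro conjI)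
    show "primitive (\<lambda>t. P0 t + \<alpha> * P1 t) (\<lambda>t. (V0 t + \<alpha> * V1 t) / B t)"
      using primitive_add[OF 0(1) primitive_cmult[OF 1(1), of \<alpha>]] by (simp add: add_divide_distrib)
    show "primitive (\<lambda>t. V0 t + \<alpha> * V1 t) (\<lambda>t. (1 - t) * (cos (K t) - sin (K t) * (P0 t + \<alpha> * P1 t)))"
      using primitive_add[OF 0(2) primitive_cmult[OF 1(2), of \<alpha>]] by (simp add: algebra_simps)
    show "P0 0 + \<alpha> * P1 0 = 0" using 0 1 by simp
    show "V0 1 + \<alpha> * V1 1 = 0" using V1 by (simp add: \<alpha>_def)
  qed
  then show ?thesis by (rule that)
qed

section \<open>The state minimises the energy\<close>

lemma DERIV_glue:
  fixes f g :: "real \<Rightarrow> real"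
  assumes "\<And>x. (f has_real_derivative f' x) (at x)" "\<And>x. (g has_real_derivative g' x) (at x)"
    and "f c = g c" "f' c = g' c"
  shows "((\<lambda>x. if x \<le> c then f x else g x) has_real_derivative (if x \<le> c then f' x else g' x)) (at x)"
proof (cases x c rule: linorder_cases)
  case less
  show ?thesis
    by (rule has_field_derivative_transform_within_open[where S = "{..<c}" and f = f])
       (use assms less in auto)
next
  case equal
  let ?h = "\<lambda>x. if x \<le> c then f x else g x"
  have "(?h has_real_derivative f' c) (at c within {..c})"
    by (rule has_field_derivative_transform_within[where d = 1, OF has_field_derivative_at_within[OF assms(1)]])
       auto
  moreover have "(?h has_real_derivative f' c) (at c within {c..})"
    unfolding assms(4)
    by (rule has_field_derivative_transform_within[where d = 1, OF has_field_derivative_at_within[OF assms(2)]])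
       (use assms(3) in auto)
  ultimately have "(?h has_real_derivative f' c) (at c within {..c} \<union> {c..})"
    unfolding has_field_derivative_iff Lim_within_Un by blast
  moreover have "{..c} \<union> {c..} = UNIV" by auto
  ultimately show ?thesis using equal by simp
next
  case greater
  show ?thesis
    by (rule has_field_derivative_transform_within_open[where S = "{c<..}" and f = g])
       (use assms greater in auto)
qed

text \<open>A \<open>C\<^sup>1\<close> substitute for folding the values of a competitor into \<open>[-\<pi>/2,0]\<close>: it fixes the
  nonpositive numbers, is 1-Lipschitz, and lies below all tangents used in \<open>fold_angle_le\<close>.\<close>

definition fold_angle :: "real \<Rightarrow> real" where
  "fold_angle x = (if x \<le> 0 then x else if x \<le> pi then sin x else pi - x)"

definition fold_angle' :: "real \<Rightarrow> real" where
  "fold_angle' x = cos (max 0 (min x pi))"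

lemma fold_angle_DERIV: "(fold_angle has_real_derivative fold_angle' x) (at x)"
proof -
  have "((\<lambda>x. if x \<le> pi then sin x else pi - x) has_real_derivative
      (if x \<le> pi then cos x else -1)) (at x)" for x
    by (rule DERIV_glue) (auto intro!: derivative_eq_intros)
  then have "((\<lambda>x. if x \<le> 0 then x else if x \<le> pi then sin x else pi - x) has_real_derivative
      (if x \<le> 0 then 1 else if x \<le> pi then cos x else -1)) (at x)"
    by (rule DERIV_glue[where f = "\<lambda>x. x", rotated]) auto
  moreover have "fold_angle' x = (if x \<le> 0 then 1 else if x \<le> pi then cos x else -1)"
    using order_trans[OF _ pi_ge_zero, of x] by (auto simp: fold_angle'_def max_def min_def)
  ultimately show ?thesis by (simp add: fold_angle_def[abs_def])
qed

lemma fold_angle'_continuous: "continuous_on A fold_angle'"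
  unfolding fold_angle'_def[abs_def] by (intro continuous_intros)

lemma fold_angle'_square_le: "(fold_angle' x)\<^sup>2 \<le> 1"
  by (simp add: fold_angle'_def abs_square_le_1)

text \<open>The sine is convex on [-pi/2, 0]. Further left the tangent, having nonnegative slope, is
  below its value at -pi/2 and hence below -1.\<close>

lemma sin_above_tangent:
  fixes \<kappa> y :: real
  assumes "- pi / 2 \<le> \<kappa>" "\<kappa> \<le> 0" "y \<le> 0"
  shows "cos \<kappa> * (y - \<kappa>) \<le> sin y - sin \<kappa>"
proof -
  have near: "cos \<kappa> * (y - \<kappa>) \<le> sin y - sin \<kappa>" if y: "- pi / 2 \<le> y" "y \<le> 0" for y
  proof (cases y \<kappa> rule: linorder_cases)
    case less
    then obtain z where z: "y < z" "z < \<kappa>" "sin \<kappa> - sin y = (\<kappa> - y) * cos z"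
      using MVT2[of y \<kappa> sin cos] by auto
    have "cos z \<le> cos \<kappa>"
      using z y assms by (intro cos_monotone_minus_pi_0') auto
    then have "(\<kappa> - y) * cos z \<le> (\<kappa> - y) * cos \<kappa>" using less by (intro mult_left_mono) auto
    then show ?thesis using z(3) by (simp add: algebra_simps)
  next
    case greater
    then obtain z where z: "\<kappa> < z" "z < y" "sin y - sin \<kappa> = (y - \<kappa>) * cos z"
      using MVT2[of \<kappa> y sin cos] by auto
    have "cos \<kappa> \<le> cos z"
      using z y assms by (intro cos_monotone_minus_pi_0') auto
    then have "(y - \<kappa>) * cos \<kappa> \<le> (y - \<kappa>) * cos z" using greater by (intro mult_left_mono) auto
    then show ?thesis using z(3) by (simp add: algebra_simps)
  qed simp
  show ?thesis
  proof (cases "- pi / 2 \<le> y")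
    case False
    have "0 \<le> cos \<kappa>" using assms by (intro cos_ge_zero) auto
    then have "cos \<kappa> * (y - \<kappa>) \<le> cos \<kappa> * (- pi / 2 - \<kappa>)" using False by (intro mult_left_mono) auto
    also have "\<dots> \<le> sin (- pi / 2) - sin \<kappa>" by (rule near) auto
    also have "\<dots> \<le> sin y - sin \<kappa>" by simp
    finally show ?thesis .
  qed (use near assms in auto)
qed

text \<open>Beyond pi, the reflected angle pi - x has the same sine and is negative, so the tangent
  inequality applies to it. Between 0 and pi the bound cos \<kappa> \<le> 1 and the tangent
  inequality at 0 suffice.\<close>

lemma fold_angle_le:
  fixes \<kappa> x :: real
  assumes "- pi / 2 \<le> \<kappa>" "\<kappa> \<le> 0"
  shows "cos \<kappa> * (fold_angle x - \<kappa>) \<le> sin x - sin \<kappa>"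
proof -
  note tangent = sin_above_tangent[OF assms]
  consider "x \<le> 0" | "0 < x" "x \<le> pi" | "pi < x" by linarith
  then show ?thesis
  proof cases
    case 1 then show ?thesis using tangent[of x] by (simp add: fold_angle_def)
  next
    case 2
    have "cos \<kappa> * sin x \<le> 1 * sin x"
      using 2 sin_ge_zero[of x] by (intro mult_right_mono) auto
    then show ?thesis using 2 tangent[of 0] by (simp add: fold_angle_def right_diff_distrib)
  next
    case 3
    have "0 < x" using 3 pi_gt_zero by linarith
    then show ?thesis using 3 tangent[of "pi - x"] by (simp add: fold_angle_def)
  qed
qed

lemma AE_zero_continuous:
  fixes f :: "real \<Rightarrow> real"
  assumes "continuous_on {0..1} f" "\<And>t. t \<in> {0..1} \<Longrightarrow> 0 \<le> f t" "AE t in leb01. f t = 0"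
    and "t \<in> {0..1}"
  shows "f t = 0"
proof -
  have "integral {0..1} f = integral {0..1} (\<lambda>t. 0)"
    using integral_cong_AE_leb01[OF assms(3), of 0 1] by simp
  then have "\<forall>t\<in>{0..1}. f t = 0"
    using integral_eq_0_iff[OF assms(1) _ assms(2)] by simp
  then show ?thesis using assms(4) by blast
qed

lemma integrable_leb01_square:
  assumes "g \<in> L2" "B \<in> borel_measurable leb01" "\<And>t. \<bar>B t\<bar> \<le> b"
  shows "integrable leb01 (\<lambda>t. B t * (g t)\<^sup>2)"
  using assms by (intro integrable_leb01_mult) (auto simp: L2_def)

text \<open>\<open>z1\<close> and \<open>z2\<close> are derivatives of U G(L) and U K (G the
  folding), which vanish at both ends; adding them leaves the energy gap unchanged but turns its
  integrand \<open>D\<close> into a sum of three nonnegative terms: a completed square, the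
  Lipschitz defect of the folding, and the tangent inequality.\<close>

lemma solves_state_energy_gap:
  fixes B K U L g :: "real \<Rightarrow> real"
  assumes st: "solves_state B K U" and B: "B \<in> borel_measurable leb01" "\<And>t. a \<le> B t" "\<And>t. B t \<le> b"
    and a: "0 < a" and L: "primitive L g" "g \<in> L2" "L 0 = 0"
  defines "E \<equiv> \<lambda>L g. 1/2 * integral\<^sup>L leb01 (\<lambda>t. B t * (g t)\<^sup>2) + integral\<^sup>L leb01 (\<lambda>t. (1 - t) * sin (L t))"
  shows "E K (\<lambda>t. U t / B t) \<le> E L g"
    and "E L g \<le> E K (\<lambda>t. U t / B t) \<Longrightarrow> t \<in> {0..1} \<Longrightarrow> L t = K t"
proof -
  have K: "primitive K (\<lambda>t. U t / B t)" and U: "primitive U (\<lambda>t. (1 - t) * cos (K t))"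
    and K0: "K 0 = 0" and U1: "U 1 = 0" and rng: "\<And>t. t \<in> {0..1} \<Longrightarrow> - pi / 2 \<le> K t \<and> K t \<le> 0"
    using st by (auto simp: solves_state_def)
  have pos: "0 < B t" for t using B(2)[of t] a by linarith
  have absB: "\<bar>B t\<bar> \<le> b" for t using pos[of t] B(3)[of t] by simp
  define G where "G t = fold_angle' (L t)" for t
  have Z1: "primitive (\<lambda>t. U t * fold_angle (L t))
      (\<lambda>t. (1 - t) * cos (K t) * fold_angle (L t) + U t * (G t * g t))"
    unfolding G_def
    by (intro primitive_mult U primitive_comp L fold_angle_DERIV fold_angle'_continuous)
  have Z2: "primitive (\<lambda>t. U t * K t) (\<lambda>t. (1 - t) * cos (K t) * K t + U t * (U t / B t))"
    by (intro primitive_mult U K)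
  define z1 where "z1 t = (1 - t) * cos (K t) * fold_angle (L t) + U t * (G t * g t)" for t
  define z2 where "z2 t = (1 - t) * cos (K t) * K t + U t * (U t / B t)" for t
  note Z = Z1[folded z1_def] Z2[folded z2_def]
  have int_Z: "integrable leb01 z1" "integrable leb01 z2" "integral\<^sup>L leb01 z1 = 0" "integral\<^sup>L leb01 z2 = 0"
    using primitive_integrable[OF Z(1)] primitive_integrable[OF Z(2)]
      primitive_integral[OF Z(1)] primitive_integral[OF Z(2)] L(3) K0 U1
    by (simp_all add: fold_angle_def)
  have cont: "continuous_on {0..1} K" "continuous_on {0..1} L" "continuous_on {0..1} U"
    using primitive_continuous K L(1) U by auto
  have int_sin: "integrable leb01 (\<lambda>t. (1 - t) * sin (K t))" "integrable leb01 (\<lambda>t. (1 - t) * sin (L t))"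
    by (intro integrable_leb01_continuous continuous_intros cont)+
  have int_Bg: "integrable leb01 (\<lambda>t. B t * (g t)\<^sup>2)"
    by (rule integrable_leb01_square[OF L(2) B(1) absB])
  have "integrable leb01 (\<lambda>t. U t * (U t / B t))"
    by (intro integrable_leb01_continuous_mult cont primitive_integrable[OF K])
  then have int_BU: "integrable leb01 (\<lambda>t. B t * (U t / B t)\<^sup>2)"
    using pos by (simp add: power2_eq_square less_imp_neq[THEN not_sym])
  define D where "D t = (1/2 * (B t * (g t)\<^sup>2) + (1 - t) * sin (L t))
      - (1/2 * (B t * (U t / B t)\<^sup>2) + (1 - t) * sin (K t))
      - z1 t + z2 t" for t
  have int_D: "integrable leb01 D"
    unfolding D_def using int_sin int_Bg int_BU int_Z
    by (intro Bochner_Integration.integrable_add Bochner_Integration.integrable_diff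
        integrable_mult_right)
  have gap: "integral\<^sup>L leb01 D = E L g - E K (\<lambda>t. U t / B t)"
    unfolding D_def E_def using int_sin int_Bg int_BU int_Z by simp
  have D_eq: "D t = 1/2 * (B t * (g t - U t * G t / B t)\<^sup>2) + 1/2 * ((U t)\<^sup>2 / B t * (1 - (G t)\<^sup>2))
      + (1 - t) * (sin (L t) - sin (K t) - cos (K t) * (fold_angle (L t) - K t))" for t
    unfolding D_def z1_def z2_def using pos[of t] by (simp add: field_simps power2_eq_square)
  have parts: "0 \<le> 1/2 * (B t * (g t - U t * G t / B t)\<^sup>2)" "0 \<le> 1/2 * ((U t)\<^sup>2 / B t * (1 - (G t)\<^sup>2))"
    "0 \<le> (1 - t) * (sin (L t) - sin (K t) - cos (K t) * (fold_angle (L t) - K t))"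
    if "t \<in> {0..1}" for t
  proof -
    show "0 \<le> 1/2 * (B t * (g t - U t * G t / B t)\<^sup>2)" using pos[of t] by simp
    show "0 \<le> 1/2 * ((U t)\<^sup>2 / B t * (1 - (G t)\<^sup>2))"
      using pos[of t] fold_angle'_square_le[of "L t"] unfolding G_def
      by (intro mult_nonneg_nonneg divide_nonneg_pos) auto
    show "0 \<le> (1 - t) * (sin (L t) - sin (K t) - cos (K t) * (fold_angle (L t) - K t))"
      using that rng[OF that] fold_angle_le[of "K t" "L t"] by (intro mult_nonneg_nonneg) auto
  qed
  have D_nonneg: "AE t in leb01. 0 \<le> D t"
    using parts by (intro AE_I2) (auto simp: D_eq)
  then show "E K (\<lambda>t. U t / B t) \<le> E L g"
    using integral_nonneg_AE[OF D_nonneg] gap by linarith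
  show "L t = K t" if le: "E L g \<le> E K (\<lambda>t. U t / B t)" and t: "t \<in> {0..1}"
  proof -
    have "integral\<^sup>L leb01 D = 0"
      using integral_nonneg_AE[OF D_nonneg] gap le by linarith
    then have "AE t in leb01. D t = 0"
      using integral_nonneg_eq_0_iff_AE[OF int_D D_nonneg] by blast
    moreover have "AE t in leb01. t \<in> {0<..<1}" by (intro AE_I2) simp
    \<comment> \<open>Equality makes each term vanish. Since \<open>U\<close> is strictly negative,
      the Lipschitz defect forces the slope of the folding to be 1 or -1, and the square then
      determines \<open>g\<close>.\<close>
    ultimately have "AE t in leb01. (G t)\<^sup>2 = 1 \<and> g t = U t * G t / B t"
    proof eventually_elim
      fix t assume D0: "D t = 0" and t: "t \<in> {0<..<1::real}"
      then have t': "t \<in> {0..1}" by simp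
      have sum0: "1/2 * (B t * (g t - U t * G t / B t)\<^sup>2) = 0" "1/2 * ((U t)\<^sup>2 / B t * (1 - (G t)\<^sup>2)) = 0"
        using D0 parts[OF t'] unfolding D_eq by linarith+
      have "U t < 0"
        using solves_state_flux_negative[OF st B(2) a, of t] t by auto
      then show "(G t)\<^sup>2 = 1 \<and> g t = U t * G t / B t"
        using sum0 pos[of t] by simp
    qed
    then have G2: "AE t in leb01. 1 - (G t)\<^sup>2 = 0" and gU: "AE t in leb01. g t = U t * G t / B t"
      by auto
    have cG: "continuous_on {0..1} G"
      unfolding G_def by (rule continuous_on_compose2[OF fold_angle'_continuous[of UNIV] cont(2)]) auto
    have G2: "1 - (G s)\<^sup>2 = 0" if "s \<in> {0..1}" for s
    proof (rule AE_zero_continuous[OF _ _ G2 that])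
      show "continuous_on {0..1} (\<lambda>t. 1 - (G t)\<^sup>2)" by (intro continuous_intros cG)
    qed (simp add: G_def fold_angle'_square_le)
    \<comment> \<open>A positive value of \<open>L\<close> would by continuity produce a value in
      (0, 1], where the slope is a cosine of modulus below 1. So the slope -1, reached only from pi
      on, is excluded too.\<close>
    have L_le: "L s \<le> 0" if s: "s \<in> {0..1}" for s
    proof (rule ccontr)
      assume n: "\<not> L s \<le> 0"
      have "continuous_on {0..s} L" by (rule continuous_on_subset[OF cont(2)]) (use s in auto)
      then obtain z where z: "0 \<le> z" "z \<le> s" "L z = min (L s) 1"
        using IVT'[of L 0 "min (L s) 1" s] n s L(3) by (auto simp: min_le_iff_disj)
      have Lz: "0 < L z" "L z < pi" using z(3) n pi_gt3 by (auto simp: min_def)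
      then have "0 < sin (L z)" by (rule sin_gt_zero)
      moreover have "(cos (L z))\<^sup>2 = 1"
        using G2[of z] z s Lz by (simp add: G_def fold_angle'_def)
      ultimately show False using sin_cos_squared_add[of "L z"] by simp
    qed
    have G1: "G s = 1" if "s \<in> {0..1}" for s
      using L_le[OF that] pi_gt_zero by (simp add: G_def fold_angle'_def)
    from gU AE_space[of leb01] have "AE s in leb01. g s = U s / B s"
    proof eventually_elim
      case (elim s)
      then show ?case using G1[of s] by simp
    qed
    then have "integral {0..t} g = integral {0..t} (\<lambda>s. U s / B s)"
      using t by (intro integral_cong_AE_leb01) auto
    then show ?thesis
      using primitive_diff[OF L(1), of 0 t] primitive_diff[OF K, of 0 t] t L(3) K0 by simp
  qed
qed

lemma energy_cong_AE:
  assumes "B \<in> borel_measurable leb01" "C \<in> borel_measurable leb01" "AE t in leb01. B t = C t" "K \<in> W12l"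
  shows "energy B K = energy C K"
proof -
  have [measurable]: "weak_deriv K \<in> borel_measurable leb01"
    using primitive_weak_deriv_W12l[OF assms(4)] by (auto simp: L2_def)
  note assms(1,2)[measurable]
  have "integral\<^sup>L leb01 (\<lambda>t. B t * (weak_deriv K t)\<^sup>2) = integral\<^sup>L leb01 (\<lambda>t. C t * (weak_deriv K t)\<^sup>2)"
    using assms(3) by (intro integral_cong_AE) auto
  then show ?thesis by (simp add: energy_def)
qed

text \<open>Designs lie in [0,1] only almost everywhere; this permits passing to a representative
  that does so at every point.\<close>

lemma state_cong_AE:
  assumes "B \<in> borel_measurable leb01" "C \<in> borel_measurable leb01" "AE t in leb01. B t = C t"
  shows "state B = state C"
proof -
  have "is_arg_min (energy B) (\<lambda>K. K \<in> W12l) K = is_arg_min (energy C) (\<lambda>K. K \<in> W12l) K" for K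
    using energy_cong_AE[OF assms] unfolding is_arg_min_def by (metis (no_types))
  then show ?thesis by (simp add: state_def)
qed

text \<open>The definite description requires uniqueness among functions on the whole line.
  \<open>N\<close> cuts \<open>K\<close> off outside [0,1], in line with the normalisation in
  \<open>W12l\<close>, so that agreement on [0,1] becomes equality.\<close>

lemma state_eq:
  assumes st: "solves_state B K U" and B: "B \<in> borel_measurable leb01" "\<And>t. a \<le> B t" "\<And>t. B t \<le> b"
    and a: "0 < a" and t: "t \<in> {0..1}"
  shows "state B t = K t"
proof -
  define N where "N t = (if t \<in> {0..1} then K t else 0)" for t
  have K: "primitive K (\<lambda>t. U t / B t)" and U: "primitive U (\<lambda>t. (1 - t) * cos (K t))"
    and K0: "K 0 = 0" using st by (auto simp: solves_state_def)
  have N: "primitive N (\<lambda>t. U t / B t)" by (rule primitive_cong[OF K]) (simp add: N_def)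
  have pos: "0 < B t" for t using B(2)[of t] a by linarith
  have "integrable leb01 (\<lambda>t. (U t / B t) * (U t / B t))"
  proof -
    obtain C where C: "\<And>t. t \<in> {0..1} \<Longrightarrow> \<bar>U t\<bar> \<le> C"
      using continuous_bounded_leb01[OF primitive_continuous[OF U]] by metis
    have "\<bar>U t / B t\<bar> \<le> C / a" if "t \<in> {0<..<1}" for t
      using C[of t] that B(2)[of t] pos[of t] a by (simp add: abs_divide frac_le)
    then show ?thesis
      using primitive_integrable[OF K] by (intro integrable_leb01_mult[where C = "C / a"]) auto
  qed
  then have g2: "(\<lambda>t. U t / B t) \<in> L2"
    using primitive_integrable[OF K] by (simp add: L2_def power2_eq_square)
  have NW: "N \<in> W12l" unfolding W12l_iff using N g2 K0 by (auto simp: N_def)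
  have EN: "energy B N = 1/2 * integral\<^sup>L leb01 (\<lambda>t. B t * (U t / B t)\<^sup>2) + integral\<^sup>L leb01 (\<lambda>t. (1 - t) * sin (K t))"
  proof -
    have "integral\<^sup>L leb01 (\<lambda>t. (1 - t) * sin (N t)) = integral\<^sup>L leb01 (\<lambda>t. (1 - t) * sin (K t))"
      by (rule Bochner_Integration.integral_cong) (auto simp: N_def)
    then show ?thesis using energy_eq[OF NW N B(1)] by simp
  qed
  have gap: "energy B N \<le> energy B L \<and> (energy B L \<le> energy B N \<longrightarrow> L = N)" if L: "L \<in> W12l" for L
  proof -
    note w = primitive_weak_deriv_W12l[OF L]
    have L0: "L 0 = 0" "\<And>t. t \<notin> {0..1} \<Longrightarrow> L t = 0" using L by (auto simp: W12l_def)
    note gap = solves_state_energy_gap[OF st B a w(2,1) L0(1), folded EN energy_eq[OF L w(2) B(1)]]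
    have "L = N" if "energy B L \<le> energy B N"
    proof
      fix t show "L t = N t"
        using gap(2)[OF that, of t] L0(2)[of t] by (simp add: N_def)
    qed
    then show ?thesis using gap(1) by blast
  qed
  have "state B = N"
    unfolding state_def
  proof (rule the_equality)
    show "is_arg_min (energy B) (\<lambda>K. K \<in> W12l) N"
      using NW gap by (auto simp: is_arg_min_def not_less)
    fix L assume "is_arg_min (energy B) (\<lambda>K. K \<in> W12l) L"
    then show "L = N" using NW gap[of L] by (auto simp: is_arg_min_def not_less)
  qed
  then show ?thesis using t by (simp add: N_def)
qed

section \<open>First-order optimality condition\<close>

lemma abs_sin_diff_le: "\<bar>sin x - sin y\<bar> \<le> \<bar>x - y\<bar>" for x y :: real
proof -
  have "\<bar>sin x - sin y\<bar> = 2 * \<bar>sin ((x - y) / 2)\<bar> * \<bar>cos ((x + y) / 2)\<bar>"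
    by (simp add: sin_diff_sin abs_mult)
  also have "\<dots> \<le> 2 * \<bar>(x - y) / 2\<bar> * 1"
    by (intro mult_mono abs_sin_x_le_abs_x abs_cos_le_one) auto
  finally show ?thesis by simp
qed

lemma first_order_remainder_le:
  fixes f f' :: "real \<Rightarrow> real"
  assumes "\<And>x. (f has_real_derivative f' x) (at x)" "\<And>x y. \<bar>f' x - f' y\<bar> \<le> \<bar>x - y\<bar>"
  shows "\<bar>f y - f x - f' x * (y - x)\<bar> \<le> (y - x)\<^sup>2"
proof -
  have "\<exists>z. \<bar>z - x\<bar> \<le> \<bar>y - x\<bar> \<and> f y - f x = (y - x) * f' z"
  proof (cases x y rule: linorder_cases)
    case less
    then obtain z where "x < z" "z < y" "f y - f x = (y - x) * f' z"
      using MVT2[of x y f f'] assms(1) by auto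
    then show ?thesis by (intro exI[of _ z]) auto
  next
    case greater
    then obtain z where z: "y < z" "z < x" "f x - f y = (x - y) * f' z"
      using MVT2[of y x f f'] assms(1) by auto
    then have "f y - f x = (y - x) * f' z" by (simp add: algebra_simps)
    with z show ?thesis by (intro exI[of _ z]) auto
  qed auto
  then obtain z where z: "\<bar>z - x\<bar> \<le> \<bar>y - x\<bar>" "f y - f x = (y - x) * f' z" by blast
  have "\<bar>f y - f x - f' x * (y - x)\<bar> = \<bar>y - x\<bar> * \<bar>f' z - f' x\<bar>"
    unfolding z(2) abs_mult[symmetric] by (simp add: algebra_simps)
  also have "\<dots> \<le> \<bar>y - x\<bar> * \<bar>y - x\<bar>"
    using assms(2)[of z x] z(1) by (intro mult_left_mono) auto
  finally show ?thesis by (simp add: power2_eq_square)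
qed

lemma sin_remainder_le: "\<bar>sin y - sin x - cos x * (y - x)\<bar> \<le> (y - x)\<^sup>2" for x y :: real
  by (rule first_order_remainder_le) (auto intro!: derivative_eq_intros abs_cos_diff_le)

lemma cos_remainder_le: "\<bar>cos y - cos x + sin x * (y - x)\<bar> \<le> (y - x)\<^sup>2" for x y :: real
  using first_order_remainder_le[of cos "\<lambda>x. - sin x" y x] abs_sin_diff_le
  by (auto simp: DERIV_cos abs_minus_commute)

lemma mult_le_weighted_squares:
  fixes x y a :: real
  assumes "0 < a"
  shows "\<bar>x * y\<bar> \<le> a / 2 * x\<^sup>2 + y\<^sup>2 / (2 * a)"
proof -
  have "2 * (a * \<bar>x\<bar> * \<bar>y\<bar>) \<le> (a * x)\<^sup>2 + y\<^sup>2"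
    using two_abs_mult_le[of "a * x" y] assms by (simp add: abs_mult)
  then show ?thesis using assms by (simp add: abs_mult field_simps power2_eq_square)
qed

lemma measure_leb01 [simp]: "measure leb01 {0<..<1} = 1"
  by (simp add: measure_restrict_space)

text \<open>An energy estimate bounds the difference D = L - K uniformly, and its derivative d in
  the quadratic mean, by multiples of \<epsilon>. Integrating the derivatives of V D and w P, both
  zero at the end points, then removes all terms linear in D and w except the one with C - B, and
  what is left is quadratic in small quantities.\<close>

lemma solves_state_expansion:
  fixes B C K L P U V W :: "real \<Rightarrow> real"
  assumes st: "solves_state B K U" and st': "solves_state C L W" and ad: "solves_adjoint B K P V"
    and B: "B \<in> borel_measurable leb01" "\<And>t. a \<le> B t"
    and C: "C \<in> borel_measurable leb01" "\<And>t. a \<le> C t"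
    and a: "0 < a" and \<epsilon>: "0 < \<epsilon>" and near: "\<And>t. \<bar>C t - B t\<bar> \<le> \<epsilon> * m"
    and N: "\<And>t. t \<in> {0..1} \<Longrightarrow> \<bar>P t\<bar> \<le> N" "\<And>t. t \<in> {0..1} \<Longrightarrow> \<bar>U t\<bar> \<le> N"
      "\<And>t. t \<in> {0..1} \<Longrightarrow> \<bar>V t\<bar> \<le> N"
  defines "Q \<equiv> (m * N / a / a)\<^sup>2"
  shows "\<bar>integral\<^sup>L leb01 (\<lambda>t. (1 - t) * sin (L t)) - integral\<^sup>L leb01 (\<lambda>t. (1 - t) * sin (K t))
      - integral\<^sup>L leb01 (\<lambda>t. (C t - B t) / B t * (U t * (V t / B t)))\<bar>
    \<le> ((1 + N) * ((1 + Q) / 2)\<^sup>2 + m * N / a * ((1 + Q) / 2)) * \<epsilon>\<^sup>2"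
proof -
  have K: "primitive K (\<lambda>t. U t / B t)" and U: "primitive U (\<lambda>t. (1 - t) * cos (K t))"
    and K0: "K 0 = 0" and U1: "U 1 = 0" and Kr: "\<And>t. t \<in> {0..1} \<Longrightarrow> - pi / 2 \<le> K t \<and> K t \<le> 0"
    using st by (auto simp: solves_state_def)
  have L: "primitive L (\<lambda>t. W t / C t)" and W: "primitive W (\<lambda>t. (1 - t) * cos (L t))"
    and L0: "L 0 = 0" and W1: "W 1 = 0" and Lr: "\<And>t. t \<in> {0..1} \<Longrightarrow> - pi / 2 \<le> L t \<and> L t \<le> 0"
    using st' by (auto simp: solves_state_def)
  have P: "primitive P (\<lambda>t. V t / B t)" and V: "primitive V (\<lambda>t. (1 - t) * (cos (K t) - sin (K t) * P t))"
    and P0: "P 0 = 0" and V1: "V 1 = 0"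
    using ad by (auto simp: solves_adjoint_def)
  have pos: "0 < B t" "0 < C t" for t using B(2)[of t] C(2)[of t] a by linarith+
  have N0: "0 \<le> N" using N(1)[of 0] by simp
  have m0: "0 \<le> m" using near[of 0] \<epsilon> by (smt (verit) zero_le_mult_iff)
  define d where "d t = W t / C t - U t / B t" for t
  define D where "D t = L t - K t" for t
  define w where "w t = W t - U t" for t
  have D: "primitive D d" unfolding D_def d_def by (intro primitive_sub L K)
  have w: "primitive w (\<lambda>t. (1 - t) * cos (L t) - (1 - t) * cos (K t))"
    unfolding w_def by (intro primitive_sub W U)
  have D0: "D 0 = 0" and w1: "w 1 = 0" by (simp_all add: D_def w_def L0 K0 W1 U1)
  have w_eq: "w t = C t * d t + (C t - B t) * (U t / B t)" for t
    using pos[of t] by (simp add: w_def d_def field_simps)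
  have bdd: "\<bar>x / y\<bar> \<le> c / a" if "\<bar>x\<bar> \<le> c" "a \<le> y" for x y c :: real
    using that a by (simp add: abs_divide frac_le)
  have int_d2: "integrable leb01 (\<lambda>t. (d t)\<^sup>2)"
  proof -
    obtain M where M: "\<And>t. t \<in> {0..1} \<Longrightarrow> \<bar>W t\<bar> \<le> M"
      using continuous_bounded_leb01[OF primitive_continuous[OF W]] by metis
    have "\<bar>d t\<bar> \<le> M / a + N / a" if "t \<in> {0<..<1}" for t
    proof -
      have t: "t \<in> {0..1}" using that by simp
      show ?thesis
        using bdd[OF M[OF t] C(2)[of t]] bdd[OF N(2)[OF t] B(2)[of t]] unfolding d_def by linarith
    qed
    then have "integrable leb01 (\<lambda>t. d t * d t)"
      using primitive_integrable[OF D] by (intro integrable_leb01_mult) auto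
    then show ?thesis by (simp add: power2_eq_square)
  qed
  have d2: "integral\<^sup>L leb01 (\<lambda>t. (d t)\<^sup>2) \<le> \<epsilon>\<^sup>2 * Q"
  proof -
    \<comment> \<open>The difference of the two state equations is tested with D. The term D (cos L
      - cos K) is nonnegative because both angles lie where the cosine is nondecreasing, so C d^2 is
      controlled by the perturbation of the stiffness alone.\<close>
    define z where "z t = d t * w t + D t * ((1 - t) * cos (L t) - (1 - t) * cos (K t))" for t
    have z: "primitive (\<lambda>t. D t * w t) z" unfolding z_def by (rule primitive_mult[OF D w])
    have "integral\<^sup>L leb01 (\<lambda>t. a / 2 * (d t)\<^sup>2 - (\<epsilon> * m * (N / a))\<^sup>2 / (2 * a)) \<le> integral\<^sup>L leb01 z"
    proof (rule integral_mono)
      fix t assume "t \<in> space leb01"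
      then have t: "t \<in> {0..1}" by simp
      have "0 \<le> D t * (cos (L t) - cos (K t))"
      proof (cases "K t \<le> L t")
        case True
        then have "cos (K t) \<le> cos (L t)" using Kr[OF t] Lr[OF t] by (intro cos_monotone_minus_pi_0') auto
        then show ?thesis using True by (simp add: D_def)
      next
        case False
        then have "cos (L t) \<le> cos (K t)" using Kr[OF t] Lr[OF t] by (intro cos_monotone_minus_pi_0') auto
        then show ?thesis using False by (simp add: D_def mult_nonpos_nonpos)
      qed
      then have "0 \<le> (1 - t) * (D t * (cos (L t) - cos (K t)))" using t by simp
      moreover have "a * (d t)\<^sup>2 \<le> C t * (d t)\<^sup>2" using C(2)[of t] by (intro mult_right_mono) auto
      moreover have "\<bar>d t * ((C t - B t) * (U t / B t))\<bar>
          \<le> a / 2 * (d t)\<^sup>2 + (\<epsilon> * m * (N / a))\<^sup>2 / (2 * a)"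
      proof -
        have "\<bar>(C t - B t) * (U t / B t)\<bar> \<le> \<epsilon> * m * (N / a)"
          unfolding abs_mult using near[of t] bdd[OF N(2)[OF t] B(2)] \<epsilon> m0 by (intro mult_mono) auto
        then have "((C t - B t) * (U t / B t))\<^sup>2 \<le> (\<epsilon> * m * (N / a))\<^sup>2"
          by (metis abs_ge_zero power2_abs power_mono)
        then have "((C t - B t) * (U t / B t))\<^sup>2 / (2 * a) \<le> (\<epsilon> * m * (N / a))\<^sup>2 / (2 * a)"
          using a by (intro divide_right_mono) auto
        then show ?thesis
          using mult_le_weighted_squares[OF a, of "d t" "(C t - B t) * (U t / B t)"] by linarith
      qed
      moreover have "z t = C t * (d t)\<^sup>2 + d t * ((C t - B t) * (U t / B t)) + (1 - t) * (D t * (cos (L t) - cos (K t)))"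
        unfolding z_def w_eq by (simp add: algebra_simps power2_eq_square)
      ultimately show "a / 2 * (d t)\<^sup>2 - (\<epsilon> * m * (N / a))\<^sup>2 / (2 * a) \<le> z t" by linarith
    qed (use int_d2 primitive_integrable[OF z] in auto)
    also have "integral\<^sup>L leb01 z = 0" using primitive_integral[OF z] by (simp add: D0 w1)
    also have "integral\<^sup>L leb01 (\<lambda>t. a / 2 * (d t)\<^sup>2 - (\<epsilon> * m * (N / a))\<^sup>2 / (2 * a))
        = a / 2 * integral\<^sup>L leb01 (\<lambda>t. (d t)\<^sup>2) - (\<epsilon> * m * (N / a))\<^sup>2 / (2 * a)"
      using int_d2 by simp
    finally have "integral\<^sup>L leb01 (\<lambda>t. (d t)\<^sup>2) \<le> (\<epsilon> * m * (N / a))\<^sup>2 / a\<^sup>2"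
      using a by (simp add: field_simps power2_eq_square)
    also have "\<dots> = \<epsilon>\<^sup>2 * Q" by (simp add: Q_def power_mult_distrib power_divide)
    finally show ?thesis .
  qed
  have D_le: "\<bar>D t\<bar> \<le> \<epsilon> * ((1 + Q) / 2)" if t: "t \<in> {0..1}" for t
  proof -
    have int: "integrable leb01 (\<lambda>t. \<bar>d t\<bar>)" using primitive_integrable[OF D] by simp
    have "\<bar>D t\<bar> \<le> integral {0..t} (\<lambda>t. \<bar>d t\<bar>)"
    proof -
      have "norm (integral {0..t} d) \<le> integral {0..t} (\<lambda>t. \<bar>d t\<bar>)"
        using t by (intro integral_norm_bound_integral integrable_leb01_sub[OF primitive_integrable[OF D]]) auto
      then show ?thesis using primitive_diff[OF D, of 0 t] t D0 by simp
    qed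
    also have "\<dots> \<le> integral {0..1} (\<lambda>t. \<bar>d t\<bar>)"
      using t by (intro integral_subset_le integrable_leb01_sub(1)[OF int]) auto
    also have "\<dots> = integral\<^sup>L leb01 (\<lambda>t. \<bar>d t\<bar>)" by (rule integral_leb01[OF int, symmetric])
    \<comment> \<open>The weight \<epsilon> balances the two parts: the integral of d^2 is of order
      \<epsilon>^2, so both contribute order \<epsilon>.\<close>
    also have "\<dots> \<le> integral\<^sup>L leb01 (\<lambda>t. (d t)\<^sup>2 / (2 * \<epsilon>) + \<epsilon> / 2)"
    proof (rule integral_mono)
      show "\<bar>d t\<bar> \<le> (d t)\<^sup>2 / (2 * \<epsilon>) + \<epsilon> / 2" for t
        using mult_le_weighted_squares[OF \<epsilon>, of 1 "d t"] by simp
    qed (use int int_d2 in auto)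
    also have "\<dots> = integral\<^sup>L leb01 (\<lambda>t. (d t)\<^sup>2) / (2 * \<epsilon>) + \<epsilon> / 2"
      using int_d2 by simp
    also have "\<dots> \<le> \<epsilon>\<^sup>2 * Q / (2 * \<epsilon>) + \<epsilon> / 2"
      using d2 \<epsilon> by (intro add_right_mono divide_right_mono) auto
    also have "\<dots> = \<epsilon> * ((1 + Q) / 2)" using \<epsilon> by (simp add: field_simps power2_eq_square)
    finally show ?thesis .
  qed
  have D2_le: "(D t)\<^sup>2 \<le> \<epsilon>\<^sup>2 * ((1 + Q) / 2)\<^sup>2" if "t \<in> {0..1}" for t
    using power_mono[OF D_le[OF that] abs_ge_zero, of 2] unfolding power_mult_distrib power2_abs .
  define z3 where "z3 t = (1 - t) * (cos (K t) - sin (K t) * P t) * D t + V t * d t" for t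
  define z4 where "z4 t = ((1 - t) * cos (L t) - (1 - t) * cos (K t)) * P t + w t * (V t / B t)" for t
  have z3: "primitive (\<lambda>t. V t * D t) z3" unfolding z3_def by (rule primitive_mult[OF V D])
  have z4: "primitive (\<lambda>t. w t * P t) z4" unfolding z4_def by (rule primitive_mult[OF w P])
  define X where "X t = (C t - B t) / B t * (U t * (V t / B t))" for t
  have int_X: "integrable leb01 X"
    unfolding X_def
  proof (rule integrable_leb01_mult[where C = "\<epsilon> * m / a"])
    show "(\<lambda>t. (C t - B t) / B t) \<in> borel_measurable leb01" using B C by auto
    show "\<bar>(C t - B t) / B t\<bar> \<le> \<epsilon> * m / a" for t by (rule bdd[OF near B(2)])
    show "integrable leb01 (\<lambda>t. U t * (V t / B t))"
      by (intro integrable_leb01_continuous_mult primitive_continuous[OF U] primitive_integrable[OF P])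
  qed
  have int_sin: "integrable leb01 (\<lambda>t. (1 - t) * sin (K t))" "integrable leb01 (\<lambda>t. (1 - t) * sin (L t))"
    by (intro integrable_leb01_continuous continuous_intros primitive_continuous[OF K]
        primitive_continuous[OF L])+
  define rem where "rem t = (1 - t) * sin (L t) - (1 - t) * sin (K t) - X t - z3 t + z4 t" for t
  note ints = int_sin int_X primitive_integrable[OF z3] primitive_integrable[OF z4]
  have int_rem: "integrable leb01 rem"
    unfolding rem_def using ints
    by (intro Bochner_Integration.integrable_add Bochner_Integration.integrable_diff)
  have rem_integral: "integral\<^sup>L leb01 rem = integral\<^sup>L leb01 (\<lambda>t. (1 - t) * sin (L t))
      - integral\<^sup>L leb01 (\<lambda>t. (1 - t) * sin (K t)) - integral\<^sup>L leb01 X"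
    unfolding rem_def using ints primitive_integral[OF z3] primitive_integral[OF z4]
    by (simp add: V1 D0 w1 P0)
  have rem_le: "\<bar>rem t\<bar> \<le> (1 + N) * (\<epsilon>\<^sup>2 * ((1 + Q) / 2)\<^sup>2) + m * N / a * (((d t)\<^sup>2 + \<epsilon>\<^sup>2) / 2)"
    if t: "t \<in> {0..1}" for t
  proof -
    \<comment> \<open>Three second-order terms: the Taylor remainders of sine and cosine, and the
      product of the change of stiffness with d.\<close>
    have eq: "rem t = (1 - t) * (sin (L t) - sin (K t) - cos (K t) * (L t - K t))
        + (1 - t) * (P t * (cos (L t) - cos (K t) + sin (K t) * (L t - K t)))
        + (C t - B t) * (d t * (V t / B t))"
      unfolding rem_def X_def z3_def z4_def w_eq D_def using pos[of t]
      by (simp add: field_simps)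
    have 1: "\<bar>(1 - t) * (sin (L t) - sin (K t) - cos (K t) * (L t - K t))\<bar> \<le> 1 * (D t)\<^sup>2"
      unfolding abs_mult D_def using t by (intro mult_mono sin_remainder_le) auto
    have 2: "\<bar>(1 - t) * (P t * (cos (L t) - cos (K t) + sin (K t) * (L t - K t)))\<bar> \<le> 1 * (N * (D t)\<^sup>2)"
      unfolding abs_mult D_def using t N(1)[OF t] N0 by (intro mult_mono cos_remainder_le) auto
    have 3: "(1 + N) * (D t)\<^sup>2 \<le> (1 + N) * (\<epsilon>\<^sup>2 * ((1 + Q) / 2)\<^sup>2)"
      using N0 D2_le[OF t] by (intro mult_left_mono) auto
    have 4: "\<bar>(C t - B t) * (d t * (V t / B t))\<bar> \<le> \<epsilon> * m * (\<bar>d t\<bar> * (N / a))"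
      unfolding abs_mult using near[of t] bdd[OF N(3)[OF t] B(2)] \<epsilon> m0
      by (intro mult_mono mult_left_mono) auto
    have 5: "\<epsilon> * m * (\<bar>d t\<bar> * (N / a)) \<le> m * N / a * (((d t)\<^sup>2 + \<epsilon>\<^sup>2) / 2)"
    proof -
      have "\<epsilon> * \<bar>d t\<bar> \<le> ((d t)\<^sup>2 + \<epsilon>\<^sup>2) / 2"
        using two_abs_mult_le[of "d t" \<epsilon>] \<epsilon> by (simp add: abs_mult mult.commute)
      then have "m * N / a * (\<epsilon> * \<bar>d t\<bar>) \<le> m * N / a * (((d t)\<^sup>2 + \<epsilon>\<^sup>2) / 2)"
        using m0 N0 a by (intro mult_left_mono) auto
      then show ?thesis by (simp add: mult_ac)
    qed
    have "\<bar>rem t\<bar> \<le> 1 * (D t)\<^sup>2 + 1 * (N * (D t)\<^sup>2) + \<epsilon> * m * (\<bar>d t\<bar> * (N / a))"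
      unfolding eq
      by (rule order_trans[OF abs_triangle_ineq add_mono[OF order_trans[OF abs_triangle_ineq
              add_mono[OF 1 2]] 4]])
    also have "\<dots> = (1 + N) * (D t)\<^sup>2 + \<epsilon> * m * (\<bar>d t\<bar> * (N / a))"
      by (simp add: distrib_right)
    also have "\<dots> \<le> (1 + N) * (\<epsilon>\<^sup>2 * ((1 + Q) / 2)\<^sup>2) + m * N / a * (((d t)\<^sup>2 + \<epsilon>\<^sup>2) / 2)"
      by (rule add_mono[OF 3 5])
    finally show ?thesis .
  qed
  have "\<bar>integral\<^sup>L leb01 rem\<bar>
      \<le> integral\<^sup>L leb01 (\<lambda>t. (1 + N) * (\<epsilon>\<^sup>2 * ((1 + Q) / 2)\<^sup>2) + m * N / a * (((d t)\<^sup>2 + \<epsilon>\<^sup>2) / 2))"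
    unfolding real_norm_def[symmetric]
  proof (rule Bochner_Integration.integral_norm_bound_integral[OF int_rem])
    show "integrable leb01 (\<lambda>t. (1 + N) * (\<epsilon>\<^sup>2 * ((1 + Q) / 2)\<^sup>2) + m * N / a * (((d t)\<^sup>2 + \<epsilon>\<^sup>2) / 2))"
      by (intro Bochner_Integration.integrable_add integrable_mult_right integrable_divide
          integrable_leb01_const int_d2)
  qed (simp only: real_norm_def, rule rem_le, simp)
  also have "\<dots> = (1 + N) * (\<epsilon>\<^sup>2 * ((1 + Q) / 2)\<^sup>2) + m * N / a * ((integral\<^sup>L leb01 (\<lambda>t. (d t)\<^sup>2) + \<epsilon>\<^sup>2) / 2)"
    using int_d2 by simp
  also have "\<dots> \<le> (1 + N) * (\<epsilon>\<^sup>2 * ((1 + Q) / 2)\<^sup>2) + m * N / a * ((\<epsilon>\<^sup>2 * Q + \<epsilon>\<^sup>2) / 2)"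
    using d2 m0 N0 a by (intro add_left_mono mult_left_mono divide_right_mono add_right_mono) auto
  also have "\<dots> = ((1 + N) * ((1 + Q) / 2)\<^sup>2 + m * N / a * ((1 + Q) / 2)) * \<epsilon>\<^sup>2"
    by (simp add: algebra_simps add_divide_distrib)
  finally show ?thesis unfolding rem_integral X_def .
qed

section \<open>From optimality to a pointwise formula for the stiffness\<close>

lemma stiffness_bounds:
  assumes "a < b" "\<And>t. \<theta> t \<in> {0..1}"
  shows "a \<le> stiffness a b \<theta> t" "stiffness a b \<theta> t \<le> b"
proof -
  have eq: "stiffness a b \<theta> t = a + \<theta> t * (b - a)" "stiffness a b \<theta> t = b - (1 - \<theta> t) * (b - a)"
    by (simp_all add: stiffness_def algebra_simps)
  have "0 \<le> \<theta> t * (b - a)" "0 \<le> (1 - \<theta> t) * (b - a)" using assms by auto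
  then show "a \<le> stiffness a b \<theta> t" "stiffness a b \<theta> t \<le> b" using eq by linarith+
qed

lemma stiffness_measurable:
  "\<theta> \<in> borel_measurable leb01 \<Longrightarrow> stiffness a b \<theta> \<in> borel_measurable leb01"
  unfolding stiffness_def[abs_def]
  by (intro borel_measurable_add borel_measurable_times borel_measurable_diff borel_measurable_const)

lemma objective_eq:
  assumes ab: "0 < a" "a < b" and \<theta>: "\<theta> \<in> borel_measurable leb01" "\<And>t. \<theta> t \<in> {0..1}"
    and st: "solves_state (stiffness a b \<theta>) K U"
  shows "objective a b c \<theta> = - integral\<^sup>L leb01 (\<lambda>t. (1 - t) * sin (K t)) + c * integral\<^sup>L leb01 \<theta>"
proof -
  have "integral\<^sup>L leb01 (\<lambda>t. (1 - t) * sin (state (stiffness a b \<theta>) t)) = integral\<^sup>L leb01 (\<lambda>t. (1 - t) * sin (K t))"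
    using state_eq[OF st stiffness_measurable[OF \<theta>(1)] stiffness_bounds(1)[where \<theta> = \<theta>, OF ab(2) \<theta>(2)]
        stiffness_bounds(2)[where \<theta> = \<theta>, OF ab(2) \<theta>(2)] ab(1)]
    by (intro Bochner_Integration.integral_cong) auto
  then show ?thesis by (simp add: objective_def)
qed

lemma objective_cong_AE:
  assumes "\<theta> \<in> borel_measurable leb01" "\<eta> \<in> borel_measurable leb01" "AE t in leb01. \<theta> t = \<eta> t"
  shows "objective a b c \<theta> = objective a b c \<eta>"
proof -
  have "state (stiffness a b \<theta>) = state (stiffness a b \<eta>)"
    using assms by (intro state_cong_AE stiffness_measurable) (auto simp: stiffness_def)
  then show ?thesis
    using integral_cong_AE[OF assms] by (simp add: objective_def)
qed

lemma nonneg_if_ge_small: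
  fixes x r :: real
  assumes "\<And>\<epsilon>. 0 < \<epsilon> \<Longrightarrow> \<epsilon> \<le> 1 \<Longrightarrow> - (r * \<epsilon>) \<le> x"
  shows "0 \<le> x"
proof (rule tendsto_lowerbound)
  show "((\<lambda>\<epsilon>. x + r * \<epsilon>) \<longlongrightarrow> x) (at_right 0)"
    by (auto intro!: tendsto_eq_intros)
  show "\<forall>\<^sub>F \<epsilon> in at_right 0. 0 \<le> x + r * \<epsilon>"
    using eventually_at_right_real[of 0 "1::real", OF zero_less_one]
  proof eventually_elim
    case (elim \<epsilon>)
    then show ?case using assms[of \<epsilon>] by simp
  qed
qed simp

text \<open>Optimality is tested on the segment from \<theta> to \<eta>: the objective changes by
  \<epsilon> times the integral, up to R \<epsilon>^2. Dividing by \<epsilon> and letting it tend to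
  0 leaves the sign of the integral.\<close>

lemma optimal_design_first_order:
  assumes ab: "0 < a" "a < b" and opt: "optimal_design a b c \<theta>"
    and \<theta>: "\<theta> \<in> borel_measurable leb01" "\<And>t. \<theta> t \<in> {0..1}"
    and \<eta>: "\<eta> \<in> borel_measurable leb01" "\<And>t. \<eta> t \<in> {0..1}"
    and st: "solves_state (stiffness a b \<theta>) K U" and ad: "solves_adjoint (stiffness a b \<theta>) K P V"
  shows "0 \<le> integral\<^sup>L leb01 (\<lambda>t. (\<eta> t - \<theta> t) * (c - (b - a) * (U t * V t) / (stiffness a b \<theta> t)\<^sup>2))"
    (is "0 \<le> ?I")
proof -
  let ?B = "stiffness a b \<theta>"
  note B = stiffness_measurable[OF \<theta>(1)] stiffness_bounds[where \<theta> = \<theta>, OF ab(2) \<theta>(2)]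
  have pos: "0 < ?B t" for t using B(2)[of t] ab by linarith
  have cont: "continuous_on {0..1} P" "continuous_on {0..1} U" "continuous_on {0..1} V"
    using st ad primitive_continuous by (auto simp: solves_state_def solves_adjoint_def)
  obtain N1 N2 N3 where N': "\<And>t. t \<in> {0..1} \<Longrightarrow> \<bar>P t\<bar> \<le> N1"
    "\<And>t. t \<in> {0..1} \<Longrightarrow> \<bar>U t\<bar> \<le> N2" "\<And>t. t \<in> {0..1} \<Longrightarrow> \<bar>V t\<bar> \<le> N3"
    using continuous_bounded_leb01[OF cont(1)] continuous_bounded_leb01[OF cont(2)]
      continuous_bounded_leb01[OF cont(3)] by metis
  define N where "N = max N1 (max N2 N3)"
  have N: "\<And>t. t \<in> {0..1} \<Longrightarrow> \<bar>P t\<bar> \<le> N" "\<And>t. t \<in> {0..1} \<Longrightarrow> \<bar>U t\<bar> \<le> N"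
    "\<And>t. t \<in> {0..1} \<Longrightarrow> \<bar>V t\<bar> \<le> N"
    using N' unfolding N_def by (meson max.coboundedI1 max.coboundedI2)+
  \<comment> \<open>The constants of the expansion for m = b - a; they do not depend on
    \<epsilon>.\<close>
  define Q where "Q = ((b - a) * N / a / a)\<^sup>2"
  define R where "R = (1 + N) * ((1 + Q) / 2)\<^sup>2 + (b - a) * N / a * ((1 + Q) / 2)"
  have diff_bd: "\<bar>\<eta> t - \<theta> t\<bar> \<le> 1" for t
    using \<eta>(2)[of t] \<theta>(2)[of t] by auto
  have int_diff: "integrable leb01 (\<lambda>t. \<eta> t - \<theta> t)"
    using \<eta> \<theta> diff_bd by (intro integrable_leb01_bounded) auto
  have int_\<theta>: "integrable leb01 \<theta>"
    using \<theta> by (intro integrable_leb01_bounded[where C = 1]) (auto simp: abs_le_iff)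
  have int_UV: "integrable leb01 (\<lambda>t. (\<eta> t - \<theta> t) / ?B t * (U t * (V t / ?B t)))"
  proof (rule integrable_leb01_mult[where C = "1 / a"])
    show "(\<lambda>t. (\<eta> t - \<theta> t) / ?B t) \<in> borel_measurable leb01" using \<eta> \<theta> B by auto
    show "\<bar>(\<eta> t - \<theta> t) / ?B t\<bar> \<le> 1 / a" for t
      unfolding abs_divide using diff_bd[of t] B(2)[of t] ab by (intro frac_le) auto
    show "integrable leb01 (\<lambda>t. U t * (V t / ?B t))"
      using ad by (intro integrable_leb01_continuous_mult cont)
        (auto simp: solves_adjoint_def primitive_integrable)
  qed
  have I_eq: "?I = c * integral\<^sup>L leb01 (\<lambda>t. \<eta> t - \<theta> t)
      - (b - a) * integral\<^sup>L leb01 (\<lambda>t. (\<eta> t - \<theta> t) / ?B t * (U t * (V t / ?B t)))"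
  proof -
    have "(\<eta> t - \<theta> t) * (c - (b - a) * (U t * V t) / (?B t)\<^sup>2)
        = c * (\<eta> t - \<theta> t) - (b - a) * ((\<eta> t - \<theta> t) / ?B t * (U t * (V t / ?B t)))" for t
      using pos[of t] by (simp add: field_simps power2_eq_square)
    then have "?I = integral\<^sup>L leb01 (\<lambda>t. c * (\<eta> t - \<theta> t) - (b - a) * ((\<eta> t - \<theta> t) / ?B t * (U t * (V t / ?B t))))"
      by simp
    also have "\<dots> = c * integral\<^sup>L leb01 (\<lambda>t. \<eta> t - \<theta> t)
      - (b - a) * integral\<^sup>L leb01 (\<lambda>t. (\<eta> t - \<theta> t) / ?B t * (U t * (V t / ?B t)))"
      by (subst Bochner_Integration.integral_diff)
         (intro integrable_mult_right int_diff int_UV | simp only: integral_mult_right_zero)+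
    finally show ?thesis .
  qed
  have key: "- (R * \<epsilon>) \<le> ?I" if \<epsilon>: "0 < \<epsilon>" "\<epsilon> \<le> 1" for \<epsilon>
  proof -
    define \<theta>' where "\<theta>' t = \<theta> t + \<epsilon> * (\<eta> t - \<theta> t)" for t
    have \<theta>': "\<theta>' \<in> borel_measurable leb01" "\<And>t. \<theta>' t \<in> {0..1}"
    proof -
      show "\<theta>' \<in> borel_measurable leb01" unfolding \<theta>'_def[abs_def] using \<theta> \<eta> by auto
      fix t
      have eq: "\<theta>' t = (1 - \<epsilon>) * \<theta> t + \<epsilon> * \<eta> t" by (simp add: \<theta>'_def algebra_simps)
      have "(1 - \<epsilon>) * \<theta> t \<le> (1 - \<epsilon>) * 1" "\<epsilon> * \<eta> t \<le> \<epsilon> * 1" "0 \<le> (1 - \<epsilon>) * \<theta> t" "0 \<le> \<epsilon> * \<eta> t"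
        using \<epsilon> \<theta>(2)[of t] \<eta>(2)[of t] by (auto intro!: mult_left_le mult_nonneg_nonneg)
      then show "\<theta>' t \<in> {0..1}" unfolding eq by simp
    qed
    let ?C = "stiffness a b \<theta>'"
    note C = stiffness_measurable[OF \<theta>'(1)] stiffness_bounds[where \<theta> = \<theta>', OF ab(2) \<theta>'(2)]
    obtain L W where st': "solves_state ?C L W"
      using solves_state_exists[OF C(1,2) ab(1)] by blast
    have CB: "?C t - ?B t = \<epsilon> * (b - a) * (\<eta> t - \<theta> t)" for t
      by (simp add: stiffness_def \<theta>'_def algebra_simps)
    have near: "\<bar>?C t - ?B t\<bar> \<le> \<epsilon> * (b - a)" for t
      unfolding CB abs_mult using diff_bd[of t] \<epsilon> ab by (simp add: mult_left_le)
    have "\<theta>' \<in> designs" using \<theta>' by (simp add: designs_def)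
    then have "objective a b c \<theta> \<le> objective a b c \<theta>'"
      using opt by (auto simp: optimal_design_def is_arg_min_def not_less)
    then have "integral\<^sup>L leb01 (\<lambda>t. (1 - t) * sin (L t)) - integral\<^sup>L leb01 (\<lambda>t. (1 - t) * sin (K t))
        \<le> c * integral\<^sup>L leb01 \<theta>' - c * integral\<^sup>L leb01 \<theta>"
      unfolding objective_eq[OF ab \<theta> st] objective_eq[OF ab \<theta>' st'] by simp
    also have "c * integral\<^sup>L leb01 \<theta>' - c * integral\<^sup>L leb01 \<theta> = \<epsilon> * (c * integral\<^sup>L leb01 (\<lambda>t. \<eta> t - \<theta> t))"
    proof -
      have "integrable leb01 (\<lambda>t. \<epsilon> * (\<eta> t - \<theta> t))" by (intro integrable_mult_right int_diff)
      from Bochner_Integration.integral_add[OF int_\<theta> this]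
      have "integral\<^sup>L leb01 \<theta>' = integral\<^sup>L leb01 \<theta> + \<epsilon> * integral\<^sup>L leb01 (\<lambda>t. \<eta> t - \<theta> t)"
        unfolding \<theta>'_def[abs_def] by (simp only: integral_mult_right_zero)
      then show ?thesis by (simp only:) (simp add: distrib_left)
    qed
    finally have up: "integral\<^sup>L leb01 (\<lambda>t. (1 - t) * sin (L t)) - integral\<^sup>L leb01 (\<lambda>t. (1 - t) * sin (K t))
        \<le> \<epsilon> * (c * integral\<^sup>L leb01 (\<lambda>t. \<eta> t - \<theta> t))" .
    have X: "integral\<^sup>L leb01 (\<lambda>t. (?C t - ?B t) / ?B t * (U t * (V t / ?B t)))
        = \<epsilon> * ((b - a) * integral\<^sup>L leb01 (\<lambda>t. (\<eta> t - \<theta> t) / ?B t * (U t * (V t / ?B t))))"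
    proof -
      have "(?C t - ?B t) / ?B t * (U t * (V t / ?B t))
          = \<epsilon> * ((b - a) * ((\<eta> t - \<theta> t) / ?B t * (U t * (V t / ?B t))))" for t
        unfolding CB by simp
      then show ?thesis by (simp only: integral_mult_right_zero)
    qed
    have "\<bar>integral\<^sup>L leb01 (\<lambda>t. (1 - t) * sin (L t)) - integral\<^sup>L leb01 (\<lambda>t. (1 - t) * sin (K t))
        - integral\<^sup>L leb01 (\<lambda>t. (?C t - ?B t) / ?B t * (U t * (V t / ?B t)))\<bar> \<le> R * \<epsilon>\<^sup>2"
      unfolding R_def Q_def
      by (rule solves_state_expansion[OF st st' ad B(1,2) C(1,2) ab(1) \<epsilon>(1) near]) (fact N)+
    moreover have "\<epsilon> * ?I = \<epsilon> * (c * integral\<^sup>L leb01 (\<lambda>t. \<eta> t - \<theta> t))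
        - \<epsilon> * ((b - a) * integral\<^sup>L leb01 (\<lambda>t. (\<eta> t - \<theta> t) / ?B t * (U t * (V t / ?B t))))"
      unfolding I_eq by (rule right_diff_distrib)
    ultimately have "- (R * \<epsilon>\<^sup>2) \<le> \<epsilon> * ?I"
      using up unfolding X by linarith
    then have "\<epsilon> * (- (R * \<epsilon>)) \<le> \<epsilon> * ?I" by (simp add: power2_eq_square mult_ac)
    then show ?thesis unfolding mult_le_cancel_left_pos[OF \<epsilon>(1)] .
  qed
  show ?thesis by (rule nonneg_if_ge_small) (rule key)
qed

text \<open>The switching function contains \<open>B\<close>, but its sign is that of B^2 - r with r
  = (b - a) m / c. If B^2 < r then B = b and sqrt r exceeds it; if B^2 > r then B = a and sqrt r is
  below it; otherwise B = sqrt r. Negative \<open>m\<close> is included: \<open>sqrt\<close> is then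
  negative and the clamp returns \<open>a\<close>.\<close>

lemma clamp_of_switching:
  fixes a b c m \<theta> :: real
  assumes ab: "0 < a" "a < b" and c: "0 < c" and \<theta>: "0 \<le> \<theta>" "\<theta> \<le> 1"
    and B: "B = (1 - \<theta>) * a + \<theta> * b"
    and neg: "c - (b - a) * m / B\<^sup>2 < 0 \<Longrightarrow> \<theta> = 1" and pos: "0 < c - (b - a) * m / B\<^sup>2 \<Longrightarrow> \<theta> = 0"
  shows "B = max a (min b (sqrt ((b - a) * m / c)))"
proof -
  define r where "r = (b - a) * m / c"
  have "B = a + \<theta> * (b - a)" "B = b - (1 - \<theta>) * (b - a)" using B by (simp_all add: algebra_simps)
  moreover have "0 \<le> \<theta> * (b - a)" "0 \<le> (1 - \<theta>) * (b - a)" using \<theta> ab by auto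
  ultimately have Bb: "a \<le> B" "B \<le> b" by linarith+
  then have B0: "0 < B" using ab by linarith
  have eq: "c - (b - a) * m / B\<^sup>2 = c / B\<^sup>2 * (B\<^sup>2 - r)"
    using c B0 by (simp add: r_def field_simps)
  have cB: "0 < c / B\<^sup>2" using c B0 by simp
  show ?thesis
    unfolding r_def[symmetric]
  proof (cases "B\<^sup>2" r rule: linorder_cases)
    case less
    then have "c / B\<^sup>2 * (B\<^sup>2 - r) < 0" by (intro mult_pos_neg[OF cB]) linarith
    then have "\<theta> = 1" unfolding eq[symmetric] by (rule neg)
    then have "B = b" unfolding B by simp
    moreover have "B \<le> sqrt r" by (rule real_le_rsqrt[OF less_imp_le[OF less]])
    ultimately show "B = max a (min b (sqrt r))" using ab by linarith
  next
    case equal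
    then have "sqrt r = B" using B0 by (intro real_sqrt_unique) linarith+
    then show "B = max a (min b (sqrt r))" using Bb by linarith
  next
    case greater
    then have "0 < c / B\<^sup>2 * (B\<^sup>2 - r)" by (intro mult_pos_pos[OF cB]) linarith
    then have "\<theta> = 0" unfolding eq[symmetric] by (rule pos)
    then have "B = a" unfolding B by simp
    moreover have "sqrt r \<le> B"
      using real_sqrt_le_mono[OF less_imp_le[OF greater]] B0 by simp
    ultimately show "B = max a (min b (sqrt r))" using ab by linarith
  qed
qed

lemma optimal_design_stiffness:
  assumes ab: "0 < a" "a < b" and c: "0 < c" and opt: "optimal_design a b c \<theta>"
    and \<theta>: "\<theta> \<in> borel_measurable leb01" "\<And>t. \<theta> t \<in> {0..1}"
    and st: "solves_state (stiffness a b \<theta>) K U" and ad: "solves_adjoint (stiffness a b \<theta>) K P V"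
  shows "AE t in leb01. stiffness a b \<theta> t = max a (min b (sqrt ((b - a) * (U t * V t) / c)))"
proof -
  let ?B = "stiffness a b \<theta>"
  have "U \<in> borel_measurable leb01" "V \<in> borel_measurable leb01"
    using st ad by (auto simp: solves_state_def solves_adjoint_def
        intro: measurable_leb01_continuous primitive_continuous)
  note meas = this stiffness_measurable[OF \<theta>(1)]
  define s where "s t = c - (b - a) * (U t * V t) / (?B t)\<^sup>2" for t
  have "s \<in> borel_measurable leb01"
    unfolding s_def[abs_def] by (intro borel_measurable_diff borel_measurable_divide
        borel_measurable_times borel_measurable_power borel_measurable_const meas)
  \<comment> \<open>The bang-bang design minimises \<eta> s pointwise. The integrand (\<eta> -
    \<theta>) s is thus nonpositive while its integral is nonnegative, so it vanishes almost
    everywhere.\<close>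
  define \<eta> where "\<eta> t = (if s t < 0 then 1 else 0 :: real)" for t
  have \<eta>: "\<eta> \<in> borel_measurable leb01" "\<And>t. \<eta> t \<in> {0..1}"
  proof -
    have "{t \<in> space leb01. s t < 0} \<in> sets leb01"
      using \<open>s \<in> borel_measurable leb01\<close> borel_measurable_iff_less by blast
    then show "\<eta> \<in> borel_measurable leb01"
      unfolding \<eta>_def[abs_def] by (intro measurable_If borel_measurable_const)
  qed (simp add: \<eta>_def)
  define f where "f t = - ((\<eta> t - \<theta> t) * s t)" for t
  have f_nonneg: "0 \<le> f t" for t
    using \<theta>(2)[of t] by (auto simp: f_def \<eta>_def mult_nonneg_nonpos2 mult_nonneg_nonpos)
  have "integral\<^sup>L leb01 f \<le> 0"
    using optimal_design_first_order[OF ab opt \<theta> \<eta> st ad]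
    by (simp add: f_def[abs_def] s_def[abs_def])
  moreover have int_f: "integrable leb01 f"
  proof -
    have pos: "0 < ?B t" "a \<le> ?B t" for t
      using stiffness_bounds(1)[where \<theta> = \<theta> and t = t, OF ab(2) \<theta>(2)] ab by auto
    obtain N M where NM: "\<And>t. t \<in> {0..1} \<Longrightarrow> \<bar>U t\<bar> \<le> N" "\<And>t. t \<in> {0..1} \<Longrightarrow> \<bar>V t\<bar> \<le> M"
      using st ad continuous_bounded_leb01 primitive_continuous
      unfolding solves_state_def solves_adjoint_def by metis
    have "\<bar>s t\<bar> \<le> c + (b - a) * (N * M) / a\<^sup>2" if t: "t \<in> {0<..<1}" for t
    proof -
      have UV: "\<bar>U t * V t\<bar> \<le> N * M"
        unfolding abs_mult using t NM(1)[of t] NM(2)[of t] by (intro mult_mono) auto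
      have "\<bar>(b - a) * (U t * V t) / (?B t)\<^sup>2\<bar> \<le> (b - a) * (N * M) / a\<^sup>2"
        unfolding abs_divide
      proof (intro frac_le)
        show "\<bar>(b - a) * (U t * V t)\<bar> \<le> (b - a) * (N * M)"
          using UV ab by (subst abs_mult) (auto intro!: mult_left_mono)
        show "0 \<le> (b - a) * (N * M)" using UV ab by (intro mult_nonneg_nonneg[of "b - a"]) linarith+
        show "a\<^sup>2 \<le> \<bar>(?B t)\<^sup>2\<bar>" using pos[of t] ab by (simp add: power_mono)
      qed (use ab in auto)
      then show ?thesis using c unfolding s_def by linarith
    qed
    then have "integrable leb01 s"
      using \<open>s \<in> borel_measurable leb01\<close> by (intro integrable_leb01_bounded)
    moreover have "\<bar>\<theta> t - \<eta> t\<bar> \<le> 1" for t using \<theta>(2)[of t] \<eta>(2)[of t] by auto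
    ultimately have "integrable leb01 (\<lambda>t. (\<theta> t - \<eta> t) * s t)"
      by (intro integrable_leb01_mult[where C = 1] borel_measurable_diff \<theta>(1) \<eta>(1))
    then show ?thesis by (simp add: f_def[abs_def] minus_mult_left)
  qed
  moreover have f_AE: "AE t in leb01. 0 \<le> f t" using f_nonneg by simp
  ultimately have "AE t in leb01. f t = 0"
    using integral_nonneg_eq_0_iff_AE[OF int_f f_AE] integral_nonneg_AE[OF f_AE] by linarith
  then show ?thesis
  proof eventually_elim
    case (elim t)
    then have "\<eta> t = \<theta> t \<or> s t = 0" by (simp add: f_def)
    then show ?case
      using \<theta>(2)[of t] by (intro clamp_of_switching[OF ab c, where \<theta> = "\<theta> t"])
        (auto simp: stiffness_def \<eta>_def s_def split: if_splits)
  qed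
qed

section \<open>Structure of stationary designs\<close>

text \<open>The situation after \<open>B\<close> has been replaced by its continuous representative:
  the equations hold classically inside the interval. The formula for \<open>B\<close> in terms of U
  V enters only through \<open>ntimes_diff_interior\<close>; the monotonicity results rest on
  positivity of \<open>B\<close>.\<close>

locale stationary_system =
  fixes B K U P V :: "real \<Rightarrow> real"
  assumes cont: "continuous_on {0..1} K" "continuous_on {0..1} U" "continuous_on {0..1} P"
      "continuous_on {0..1} V"
    and B_pos: "\<And>t. 0 < B t"
    and deriv: "\<And>t. 0 < t \<Longrightarrow> t < 1 \<Longrightarrow> (K has_real_derivative U t / B t) (at t)"
      "\<And>t. 0 < t \<Longrightarrow> t < 1 \<Longrightarrow> (U has_real_derivative (1 - t) * cos (K t)) (at t)"
      "\<And>t. 0 < t \<Longrightarrow> t < 1 \<Longrightarrow> (P has_real_derivative V t / B t) (at t)"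
      "\<And>t. 0 < t \<Longrightarrow> t < 1 \<Longrightarrow>
         (V has_real_derivative (1 - t) * (cos (K t) - sin (K t) * P t)) (at t)"
    and boundary: "K 0 = 0" "P 0 = 0" "U 1 = 0" "V 1 = 0"
    and range_K: "\<And>t. t \<in> {0..1} \<Longrightarrow> - pi / 2 \<le> K t \<and> K t \<le> 0"
    and U_neg: "\<And>t. 0 \<le> t \<Longrightarrow> t < 1 \<Longrightarrow> U t < 0"
begin

section \<open>Monotonicity of the product of the fluxes\<close>

lemma K_decreasing:
  assumes "0 \<le> s" "s < t" "t \<le> 1"
  shows "K t < K s"
proof (rule DERIV_neg_imp_decreasing_open[OF assms(2)])
  show "\<exists>y. (K has_real_derivative y) (at x) \<and> y < 0" if "s < x" "x < t" for x
    using deriv(1)[of x] U_neg[of x] B_pos[of x] that assms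
    by (intro exI[of _ "U x / B x"]) (auto intro: divide_neg_pos)
qed (rule continuous_on_subset[OF cont(1)], use assms in auto)

lemma sin_K_neg: "0 < t \<Longrightarrow> t \<le> 1 \<Longrightarrow> sin (K t) < 0"
  using K_decreasing[of 0 t] range_K[of t] boundary(1) sin_gt_zero[of "- K t"] pi_gt_zero
  by auto

text \<open>Where the claim fails, \<open>P - cot K\<close> is nonpositive and decreasing, so \<open>V\<close> decreases
  from a nonpositive value and cannot return to \<open>V 1 = 0\<close>.\<close>

lemma adjoint_source_pos:
  assumes z: "0 \<le> z" "z < 1" and Vz: "V z \<le> 0"
  shows "0 < cos (K z) - sin (K z) * P z"
proof (rule ccontr)
  assume n: "\<not> 0 < cos (K z) - sin (K z) * P z"
  define r where "r t = P t - cos (K t) / sin (K t)" for t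
  \<comment> \<open>Since the cotangent has derivative -1/sin^2, the function r = P - cot K
    satisfies r' = \<rho> / B; the sign of \<rho> decides whether r decreases.\<close>
  define \<rho> where "\<rho> t = V t + U t / (sin (K t))\<^sup>2" for t
  \<comment> \<open>At 0 the source is cos 0 = 1, so a failure happens only where sin K is nonzero
    and the cotangent is defined.\<close>
  have z0: "0 < z" using n z boundary by (cases "z = 0") auto
  have s0: "sin (K t) < 0" if "t \<in> {z..1}" for t using sin_K_neg[of t] that z0 by auto
  have sub: "continuous_on {z..1} K" "continuous_on {z..1} U" "continuous_on {z..1} P"
    "continuous_on {z..1} V"
    using z by (auto intro: continuous_on_subset[OF cont(1)] continuous_on_subset[OF cont(2)]
        continuous_on_subset[OF cont(3)] continuous_on_subset[OF cont(4)])
  have sn0: "\<forall>t\<in>{z..1}. sin (K t) \<noteq> 0" using s0 by force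
  have cont_r: "continuous_on {z..1} r"
    unfolding r_def by (intro continuous_intros sub sn0)
  have cont_\<rho>: "continuous_on {z..1} \<rho>"
    unfolding \<rho>_def using sn0 by (intro continuous_intros sub) auto
  have source: "cos (K t) - sin (K t) * P t = - sin (K t) * r t" if "t \<in> {z..1}" for t
    using s0[OF that] by (simp add: r_def field_simps)
  have "0 \<le> sin (K z) * r z" using n source[of z] z by simp
  then have rz: "r z \<le> 0" using s0[of z] z by (simp add: zero_le_mult_iff)
  have deriv_r: "(r has_real_derivative \<rho> t / B t) (at t)" if t: "z < t" "t < 1" for t
  proof -
    have ne: "sin (K t) \<noteq> 0" using s0[of t] t by simp
    have *: "((\<lambda>t. cos (K t) / sin (K t)) has_real_derivative
       (- sin (K t) * (U t / B t) * sin (K t) - cos (K t) * (cos (K t) * (U t / B t))) / (sin (K t) * sin (K t))) (at t)"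
      using t z0 ne by (auto intro!: derivative_eq_intros deriv(1))
    have regroup: "- x * u * x - y * (y * u) = - (x\<^sup>2 + y\<^sup>2) * u" for x y u :: real
      by (simp add: power2_eq_square algebra_simps)
    have num: "- sin (K t) * (U t / B t) * sin (K t) - cos (K t) * (cos (K t) * (U t / B t))
        = - (U t / B t)"
      unfolding regroup sin_cos_squared_add by simp
    have "((\<lambda>t. cos (K t) / sin (K t)) has_real_derivative - (U t / B t) / (sin (K t))\<^sup>2) (at t)"
      by (rule DERIV_cong[OF *]) (simp only: num power2_eq_square)
    then have "(r has_real_derivative V t / B t - - (U t / B t) / (sin (K t))\<^sup>2) (at t)"
      unfolding r_def using t z0 by (intro DERIV_diff deriv(3)) auto
    then show ?thesis by (simp add: \<rho>_def add_divide_distrib mult.commute)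
  qed
  \<comment> \<open>The first point y after z with \<rho> y nonnegative exists, since \<rho>
    vanishes at 1. Up to y the function r decreases from a nonpositive value, so the source is
    negative and \<open>V\<close> falls. Hence V y < 0 and U y \<le> 0, which makes \<rho> y
    negative after all.\<close>
  define Y where "Y = {z..1} \<inter> \<rho> -` {0..}"
  have "compact Y"
    unfolding Y_def compact_eq_bounded_closed
    by (intro conjI continuous_closed_preimage cont_\<rho> bounded_Int) auto
  moreover have "1 \<in> Y" using z boundary by (simp add: Y_def \<rho>_def)
  ultimately obtain y where y: "y \<in> Y" "\<And>t. t \<in> Y \<Longrightarrow> y \<le> t"
    using compact_attains_inf[of Y] by blast
  have yr: "y \<in> {z..1}" "0 \<le> \<rho> y" using y(1) by (auto simp: Y_def)
  have "\<rho> z < 0"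
    using Vz U_neg[OF z] s0[of z] z by (simp add: \<rho>_def add_nonpos_neg divide_neg_pos)
  then have zy: "z < y" using yr by (cases "y = z") auto
  have neg: "\<rho> t < 0" if "z \<le> t" "t < y" for t
    using y(2)[of t] that yr(1) by (force simp: Y_def)
  have r_neg: "r t < 0" if t: "z < t" "t \<le> y" for t
  proof -
    have "r t < r z"
    proof (rule DERIV_neg_imp_decreasing_open[OF t(1)])
      show "\<exists>d. (r has_real_derivative d) (at x) \<and> d < 0" if "z < x" "x < t" for x
        using deriv_r[of x] neg[of x] B_pos[of x] that t yr(1)
        by (intro exI[of _ "\<rho> x / B x"]) (auto intro: divide_neg_pos)
    qed (rule continuous_on_subset[OF cont_r], use t yr(1) in auto)
    then show ?thesis using rz by simp
  qed
  have "V y < V z"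
  proof (rule DERIV_neg_imp_decreasing_open[OF zy])
    show "\<exists>d. (V has_real_derivative d) (at x) \<and> d < 0" if x: "z < x" "x < y" for x
    proof -
      have "- sin (K x) * r x < 0" using s0[of x] r_neg[of x] x yr(1) by (intro mult_pos_neg) auto
      then have "(1 - x) * (cos (K x) - sin (K x) * P x) < 0"
        using source[of x] x yr(1) by (intro mult_pos_neg) auto
      then show ?thesis using deriv(4)[of x] x z0 yr(1) by auto
    qed
  qed (rule continuous_on_subset[OF sub(4)], use yr(1) in auto)
  moreover have "U y \<le> 0" using U_neg[of y] boundary(3) yr(1) z0 by (cases "y = 1") auto
  then have "U y / (sin (K y))\<^sup>2 \<le> 0" by (intro divide_nonpos_nonneg) auto
  ultimately show False using yr(2) Vz by (simp add: \<rho>_def)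
qed

text \<open>\<open>V\<close> has positive derivative wherever it is nonpositive. If \<open>V\<close>
  were nonnegative somewhere before t, it would increase from the last such point up to t,
  contradicting V t < 0; so it is negative throughout and increases.\<close>

lemma V_increasing:
  assumes "0 \<le> s" "s < t" "t \<le> 1" "V t < 0"
  shows "V s < V t"
proof -
  have t1: "t < 1" using assms boundary(4) by (cases "t = 1") auto
  have incr: "V x < V t" if x: "0 \<le> x" "x < t" and neg: "\<And>u. x < u \<Longrightarrow> u < t \<Longrightarrow> V u \<le> 0" for x
  proof (rule DERIV_pos_imp_increasing_open[OF x(2)])
    show "\<exists>d. (V has_real_derivative d) (at u) \<and> 0 < d" if u: "x < u" "u < t" for u
      using deriv(4)[of u] adjoint_source_pos[of u] neg[OF u] u x t1
      by (intro exI[of _ "(1 - u) * (cos (K u) - sin (K u) * P u)"]) auto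
  qed (rule continuous_on_subset[OF cont(4)], use x t1 in auto)
  have "V u < 0" if u: "s \<le> u" "u \<le> t" for u
  proof (rule ccontr)
    assume "\<not> V u < 0"
    define Y where "Y = {s..t} \<inter> V -` {0..}"
    have "continuous_on {s..t} V" by (rule continuous_on_subset[OF cont(4)]) (use assms in auto)
    then have "compact Y"
      unfolding Y_def compact_eq_bounded_closed
      by (intro conjI continuous_closed_preimage bounded_Int) auto
    moreover have "u \<in> Y" using u \<open>\<not> V u < 0\<close> by (simp add: Y_def)
    ultimately obtain y where y: "y \<in> Y" "\<And>t. t \<in> Y \<Longrightarrow> t \<le> y"
      using compact_attains_sup[of Y] by blast
    then have yr: "s \<le> y" "y \<le> t" "0 \<le> V y" by (auto simp: Y_def)
    then have "y < t" using assms(4) by (cases "y = t") auto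
    moreover have "V x \<le> 0" if "y < x" "x < t" for x
      using y(2)[of x] that yr by (force simp: Y_def)
    ultimately have "V y < V t" using yr assms(1) by (intro incr) auto
    then show False using yr assms(4) by simp
  qed
  then show ?thesis using assms by (intro incr) (auto intro: less_imp_le)
qed

lemma U_mono: "0 \<le> s \<Longrightarrow> s \<le> t \<Longrightarrow> t \<le> 1 \<Longrightarrow> U s \<le> U t"
proof (cases "s = t")
  case False
  assume st: "0 \<le> s" "s \<le> t" "t \<le> 1"
  show ?thesis
  proof (rule DERIV_nonneg_imp_increasing_open[OF st(2)])
    show "\<exists>d. (U has_real_derivative d) (at x) \<and> 0 \<le> d" if "s < x" "x < t" for x
      using deriv(2)[of x] range_K[of x] that st cos_ge_zero[of "K x"]
      by (intro exI[of _ "(1 - x) * cos (K x)"]) auto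
  qed (rule continuous_on_subset[OF cont(2)], use st in auto)
qed simp

lemma UV_decreasing:
  assumes "0 \<le> s" "s < t" "t \<le> 1" "0 < U t * V t"
  shows "U t * V t < U s * V s"
proof -
  have t1: "t < 1" using assms boundary(3) by (cases "t = 1") auto
  have Ut: "U t < 0" using U_neg[of t] t1 assms by simp
  then have Vt: "V t < 0" using assms(4) by (simp add: zero_less_mult_iff)
  have "(- U t) * (- V t) < (- U s) * (- V s)"
    using U_mono[of s t] V_increasing[OF assms(1-3) Vt] Ut Vt assms by (intro mult_le_less_imp_less) auto
  then show ?thesis by simp
qed

text \<open>Adjoining I = 1 / sqrt R, with derivative -R' I^3 / 2, and sin K, cos K closes the
  system: each of the seven functions has a derivative polynomial in all of them and in t. One
  simultaneous induction gains a derivative for all, and sqrt R is recovered as R I.\<close>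

lemma ntimes_diff_interior:
  assumes S: "open S" "S \<subseteq> {0<..<1}" and c: "0 < c"
    and B: "\<And>t. t \<in> S \<Longrightarrow> 0 < U t * V t \<and> B t = sqrt (c * (U t * V t))"
  shows "ntimes_diff_on n S (\<lambda>t. sqrt (c * (U t * V t)))"
proof -
  define R where "R t = c * (U t * V t)" for t
  define I where "I t = inverse (sqrt (R t))" for t
  define dU where "dU t = (1 - t) * cos (K t)" for t
  define dV where "dV t = (1 - t) * (cos (K t) - sin (K t) * P t)" for t
  have R_pos: "0 < R t" if "t \<in> S" for t using B[OF that] c by (simp add: R_def)
  have BI: "x / B t = x * I t" if "t \<in> S" for x t
    using B[OF that] by (simp add: I_def R_def divide_inverse)
  have D: "(K has_real_derivative U t * I t) (at t)" "(U has_real_derivative dU t) (at t)"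
    "(P has_real_derivative V t * I t) (at t)" "(V has_real_derivative dV t) (at t)"
    if "t \<in> S" for t
  proof -
    have "t \<in> {0<..<1}" using S(2) that by (rule subsetD)
    then have t: "0 < t" "t < 1" by auto
    show "(K has_real_derivative U t * I t) (at t)" "(U has_real_derivative dU t) (at t)"
      "(P has_real_derivative V t * I t) (at t)" "(V has_real_derivative dV t) (at t)"
      using deriv(1-4)[OF t] unfolding BI[OF that] dU_def dV_def .
  qed
  have dI: "(I has_real_derivative
      (- (1 / 2) * (c * (dU t * V t + U t * dV t))) * (I t * (I t * I t))) (at t)" if t: "t \<in> S" for t
  proof -
    have sq: "sqrt (R t) * sqrt (R t) = R t" "0 < sqrt (R t)" using R_pos[OF t] by auto
    have "(R has_real_derivative c * (dU t * V t + U t * dV t)) (at t)"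
      unfolding R_def
      by (rule DERIV_cong[OF DERIV_cmult[OF DERIV_mult[OF D(2)[OF t] D(4)[OF t]]]])
         (simp add: mult.commute)
    from DERIV_chain2[OF DERIV_real_sqrt[OF R_pos[OF t]] this]
    have "((\<lambda>t. sqrt (R t)) has_real_derivative
        inverse (sqrt (R t)) / 2 * (c * (dU t * V t + U t * dV t))) (at t)" .
    then have "(I has_real_derivative
        - (inverse (sqrt (R t)) * (inverse (sqrt (R t)) / 2 * (c * (dU t * V t + U t * dV t))) * inverse (sqrt (R t)))) (at t)"
      unfolding I_def using sq by (intro DERIV_inverse') simp_all
    then show ?thesis by (rule DERIV_cong) (simp add: I_def)
  qed
  note closure = ntimes_diff_on_mult[OF S(1)] ntimes_diff_on_add[OF S(1)] ntimes_diff_on_diff[OF S(1)]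
    ntimes_diff_on_minus[OF S(1)] ntimes_diff_on_const ntimes_diff_on_ident[OF S(1)]
  have all: "ntimes_diff_on n S K \<and> ntimes_diff_on n S U \<and> ntimes_diff_on n S P \<and> ntimes_diff_on n S V
      \<and> ntimes_diff_on n S I \<and> ntimes_diff_on n S (\<lambda>t. sin (K t)) \<and> ntimes_diff_on n S (\<lambda>t. cos (K t))"
    for n
  proof (induction n)
    case (Suc n)
    then have IH: "ntimes_diff_on n S K" "ntimes_diff_on n S U" "ntimes_diff_on n S P" "ntimes_diff_on n S V"
      "ntimes_diff_on n S I" "ntimes_diff_on n S (\<lambda>t. sin (K t))" "ntimes_diff_on n S (\<lambda>t. cos (K t))"
      by blast+
    have dUV: "ntimes_diff_on n S dU" "ntimes_diff_on n S dV"
      unfolding dU_def[abs_def] dV_def[abs_def] by (intro closure IH)+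
    have sc: "((\<lambda>t. sin (K t)) has_real_derivative cos (K t) * (U t * I t)) (at t)"
      "((\<lambda>t. cos (K t)) has_real_derivative - sin (K t) * (U t * I t)) (at t)" if "t \<in> S" for t
      using D(1)[OF that] by (auto intro!: derivative_eq_intros)
    show ?case
    proof (intro conjI)
      show "ntimes_diff_on (Suc n) S K"
        by (rule ntimes_diff_on_SucI[OF S(1) D(1)]) (auto intro!: closure IH)
      show "ntimes_diff_on (Suc n) S U"
        by (rule ntimes_diff_on_SucI[OF S(1) D(2)]) (auto intro!: dUV)
      show "ntimes_diff_on (Suc n) S P"
        by (rule ntimes_diff_on_SucI[OF S(1) D(3)]) (auto intro!: closure IH)
      show "ntimes_diff_on (Suc n) S V"
        by (rule ntimes_diff_on_SucI[OF S(1) D(4)]) (auto intro!: dUV)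
      show "ntimes_diff_on (Suc n) S I"
        by (rule ntimes_diff_on_SucI[OF S(1) dI]) (assumption | intro closure IH dUV)+
      show "ntimes_diff_on (Suc n) S (\<lambda>t. sin (K t))"
        by (rule ntimes_diff_on_SucI[OF S(1) sc(1)]) (auto intro!: closure IH)
      show "ntimes_diff_on (Suc n) S (\<lambda>t. cos (K t))"
        by (rule ntimes_diff_on_SucI[OF S(1) sc(2)]) (auto intro!: closure IH)
    qed
  qed simp
  have "ntimes_diff_on n S (\<lambda>t. c * (U t * V t) * I t)"
    using all[of n] by (intro closure) auto
  then show ?thesis
  proof (rule ntimes_diff_on_cong[OF S(1), rotated])
    fix t assume "t \<in> S"
    from R_pos[OF this] show "c * (U t * V t) * I t = sqrt (c * (U t * V t))"
      unfolding I_def R_def by (metis divide_inverse less_imp_le real_div_sqrt)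
  qed
qed

end

text \<open>The intermediate value theorem provides t1 with R = a^2 there, and t0 with R = b^2 if R
  starts above b^2, while t0 = 0 otherwise. Strict decrease is available only where R is positive,
  which covers these levels because a > 0; it puts R strictly between them inside (t0, t1).\<close>

lemma clamped_profile:
  fixes a b c :: real and R :: "real \<Rightarrow> real"
  assumes ab: "0 < a" "a < b" and R: "continuous_on {0..1} R" "R 1 = 0"
    and decr: "\<And>s t. 0 \<le> s \<Longrightarrow> s < t \<Longrightarrow> t \<le> 1 \<Longrightarrow> 0 < R t \<Longrightarrow> R t < R s"
    and smooth: "\<And>S. open S \<Longrightarrow> S \<subseteq> {0<..<1} \<Longrightarrow> (\<And>t. t \<in> S \<Longrightarrow> a\<^sup>2 < R t \<and> R t < b\<^sup>2) \<Longrightarrow>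
      smooth_on S (\<lambda>t. sqrt (R t))"
  defines "\<theta> \<equiv> \<lambda>t. (max a (min b (sqrt (R t))) - a) / (b - a)"
  shows "(\<forall>t\<in>{0..1}. \<theta> t = 0) \<or>
            (\<exists>t\<^sub>0 t\<^sub>1. 0 \<le> t\<^sub>0 \<and> t\<^sub>0 < t\<^sub>1 \<and> t\<^sub>1 < 1 \<and>
               (0 < t\<^sub>0 \<longrightarrow> (\<forall>t\<in>{0<..<t\<^sub>0}. \<theta> t = 1)) \<and>
               (\<forall>t\<in>{t\<^sub>0<..<t\<^sub>1}. \<theta> t \<noteq> 0) \<and> strict_antimono_on {t\<^sub>0<..<t\<^sub>1} \<theta> \<and>
               (\<forall>t\<in>{t\<^sub>1..1}. \<theta> t = 0) \<and>
               smooth_on {t\<^sub>0<..<t\<^sub>1} \<theta>)"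
proof -
  have low: "\<theta> t = 0" if "R t \<le> a\<^sup>2" for t
  proof -
    have "sqrt (R t) \<le> a" using that ab by (intro real_le_lsqrt) auto
    then show ?thesis using ab by (simp add: \<theta>_def)
  qed
  have high: "\<theta> t = 1" if "b\<^sup>2 < R t" for t
  proof -
    have "b \<le> sqrt (R t)" using that ab by (intro real_le_rsqrt) auto
    then show ?thesis using ab by (simp add: \<theta>_def)
  qed
  have mid: "\<theta> t = (sqrt (R t) - a) / (b - a)" "a < sqrt (R t)" if "a\<^sup>2 < R t" "R t < b\<^sup>2" for t
  proof -
    have "sqrt (R t) < b" using that ab by (intro real_less_lsqrt) (auto intro: less_imp_le order.strict_trans1)
    moreover show "a < sqrt (R t)" using that ab by (intro real_less_rsqrt) auto
    ultimately show "\<theta> t = (sqrt (R t) - a) / (b - a)" by (simp add: \<theta>_def)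
  qed
  have a2: "0 < a\<^sup>2" and ab2: "a\<^sup>2 < b\<^sup>2"
    using ab by (auto intro: power_strict_mono)
  show ?thesis
  proof (cases "R 0 \<le> a\<^sup>2")
    case True
    have "R t \<le> a\<^sup>2" if "t \<in> {0..1}" for t
    proof (rule ccontr)
      assume "\<not> R t \<le> a\<^sup>2"
      then show False using decr[of 0 t] True a2 that by (cases "t = 0") auto
    qed
    then show ?thesis using low by blast
  next
    case False
    obtain t\<^sub>1 where t1: "0 \<le> t\<^sub>1" "t\<^sub>1 \<le> 1" "R t\<^sub>1 = a\<^sup>2"
      using IVT2'[of R 1 "a\<^sup>2" 0] False R a2 by auto
    have t1': "0 < t\<^sub>1" "t\<^sub>1 < 1"
      using t1 False R(2) a2 by (cases "t\<^sub>1 = 0"; cases "t\<^sub>1 = 1"; force)+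
    have "\<exists>t\<^sub>0. 0 \<le> t\<^sub>0 \<and> t\<^sub>0 < t\<^sub>1 \<and> R t\<^sub>0 \<le> b\<^sup>2 \<and> (0 < t\<^sub>0 \<longrightarrow> R t\<^sub>0 = b\<^sup>2)"
    proof (cases "R 0 \<le> b\<^sup>2")
      case True
      then show ?thesis using t1' by (intro exI[of _ 0]) auto
    next
      case False
      have "continuous_on {0..t\<^sub>1} R" by (rule continuous_on_subset[OF R(1)]) (use t1 in auto)
      then obtain t\<^sub>0 where "0 \<le> t\<^sub>0" "t\<^sub>0 \<le> t\<^sub>1" "R t\<^sub>0 = b\<^sup>2"
        using IVT2'[of R t\<^sub>1 "b\<^sup>2" 0] False t1 ab2 by auto
      moreover from this have "t\<^sub>0 \<noteq> t\<^sub>1" using t1 ab2 by auto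
      ultimately show ?thesis by (intro exI[of _ t\<^sub>0]) auto
    qed
    then obtain t\<^sub>0 where t0: "0 \<le> t\<^sub>0" "t\<^sub>0 < t\<^sub>1" "R t\<^sub>0 \<le> b\<^sup>2" "0 < t\<^sub>0 \<Longrightarrow> R t\<^sub>0 = b\<^sup>2"
      by blast
    have strip: "a\<^sup>2 < R t" "R t < b\<^sup>2" if "t \<in> {t\<^sub>0<..<t\<^sub>1}" for t
    proof -
      show g: "a\<^sup>2 < R t" using decr[of t t\<^sub>1] that t0 t1 a2 by auto
      show "R t < b\<^sup>2" using decr[of t\<^sub>0 t] that t0 t1 a2 g by auto
    qed
    have "\<forall>t\<in>{0<..<t\<^sub>0}. \<theta> t = 1" if "0 < t\<^sub>0"
    proof
      fix t assume "t \<in> {0<..<t\<^sub>0}"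
      then have "R t\<^sub>0 < R t" using t0 t1 a2 ab2 that by (intro decr) auto
      then show "\<theta> t = 1" using t0(4)[OF that] by (intro high) simp
    qed
    moreover have "\<forall>t\<in>{t\<^sub>0<..<t\<^sub>1}. \<theta> t \<noteq> 0"
      using mid strip ab by force
    moreover have "strict_antimono_on {t\<^sub>0<..<t\<^sub>1} \<theta>"
    proof (rule monotone_onI)
      fix s t assume st: "s \<in> {t\<^sub>0<..<t\<^sub>1}" "t \<in> {t\<^sub>0<..<t\<^sub>1}" "s < t"
      have "0 < R t" using strip(1)[OF st(2)] a2 by linarith
      then have "R t < R s" using st t0 t1 by (intro decr) auto
      then have "(sqrt (R t) - a) / (b - a) < (sqrt (R s) - a) / (b - a)"
        using ab by (intro divide_strict_right_mono) auto
      then show "\<theta> s > \<theta> t" using mid(1)[OF strip[OF st(1)]] mid(1)[OF strip[OF st(2)]] by simp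
    qed
    moreover have "\<forall>t\<in>{t\<^sub>1..1}. \<theta> t = 0"
    proof
      fix t assume t: "t \<in> {t\<^sub>1..1}"
      have "R t \<le> a\<^sup>2"
      proof (rule ccontr)
        assume "\<not> R t \<le> a\<^sup>2"
        then show False using decr[of t\<^sub>1 t] t t1 a2 by (cases "t = t\<^sub>1") auto
      qed
      then show "\<theta> t = 0" by (rule low)
    qed
    moreover have "smooth_on {t\<^sub>0<..<t\<^sub>1} \<theta>"
      unfolding smooth_on_iff
    proof
      fix n
      have "smooth_on {t\<^sub>0<..<t\<^sub>1} (\<lambda>t. sqrt (R t))"
        using strip t0 t1' by (intro smooth) auto
      then have "ntimes_diff_on n {t\<^sub>0<..<t\<^sub>1} (\<lambda>t. (sqrt (R t) - a) * (1 / (b - a)))"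
        unfolding smooth_on_iff
        by (intro ntimes_diff_on_mult ntimes_diff_on_diff ntimes_diff_on_const) auto
      then show "ntimes_diff_on n {t\<^sub>0<..<t\<^sub>1} \<theta>"
        by (rule ntimes_diff_on_cong[rotated 2]) (use mid(1)[OF strip] in auto)
    qed
    ultimately show ?thesis using t0 t1' by blast
  qed
qed

section \<open>The main result\<close>

lemma primitive_DERIV:
  assumes "primitive F f" "continuous_on {0..1} f" "0 < t" "t < 1"
  shows "(F has_real_derivative f t) (at t)"
  using primitive_has_derivative[OF assms(1,2), of t] at_within_Icc_at[of 0 t 1] assms(3,4) by simp

lemma solves_state_sin_nonpos: "solves_state B K U \<Longrightarrow> t \<in> {0..1} \<Longrightarrow> sin (K t) \<le> 0"
  using sin_ge_zero[of "- K t"] pi_gt_zero by (force simp: solves_state_def)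

text \<open>Changing the stiffness on a null set leaves the integrated equations intact. With a
  continuous stiffness their integrands are continuous, so the fundamental theorem gives classical
  derivatives.\<close>

lemma stationary_system_of_solutions:
  assumes st: "solves_state B K U" and ad: "solves_adjoint B K P V" and a: "0 < a" "\<And>t. a \<le> B t"
    and C: "AE t in leb01. B t = C t" "continuous_on {0..1} C" "\<And>t. 0 < C t"
  shows "stationary_system C K U P V"
proof -
  have K: "primitive K (\<lambda>t. U t / B t)" and U: "primitive U (\<lambda>t. (1 - t) * cos (K t))"
    using st by (auto simp: solves_state_def)
  have P: "primitive P (\<lambda>t. V t / B t)" and V: "primitive V (\<lambda>t. (1 - t) * (cos (K t) - sin (K t) * P t))"
    using ad by (auto simp: solves_adjoint_def)
  note cont = primitive_continuous[OF K] primitive_continuous[OF U] primitive_continuous[OF P]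
    primitive_continuous[OF V]
  have C0: "\<forall>t\<in>{0..1}. C t \<noteq> 0" using C(3) by (metis less_irrefl)
  have cq: "continuous_on {0..1} (\<lambda>t. U t / C t)" "continuous_on {0..1} (\<lambda>t. V t / C t)"
    by (intro continuous_on_divide cont C(2) C0)+
  have KC: "primitive K (\<lambda>t. U t / C t)"
    by (rule primitive_cong_AE[OF K _ measurable_leb01_continuous[OF cq(1)]]) (use C(1) in auto)
  have PC: "primitive P (\<lambda>t. V t / C t)"
    by (rule primitive_cong_AE[OF P _ measurable_leb01_continuous[OF cq(2)]]) (use C(1) in auto)
  have cs: "continuous_on {0..1} (\<lambda>t. (1 - t) * cos (K t))"
    "continuous_on {0..1} (\<lambda>t. (1 - t) * (cos (K t) - sin (K t) * P t))"
    by (intro continuous_intros cont)+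
  show ?thesis
  proof
    show "U t < 0" if "0 \<le> t" "t < 1" for t
      by (rule solves_state_flux_negative[OF st a(2,1) that])
  qed (use st ad in \<open>simp_all add: solves_state_def solves_adjoint_def cont C(3)
        primitive_DERIV[OF KC cq(1)] primitive_DERIV[OF U cs(1)] primitive_DERIV[OF PC cq(2)]
        primitive_DERIV[OF V cs(2)]\<close>)
qed

theorem theorem7p3:
  fixes a b c\<^sub>l :: real and \<theta> :: "real \<Rightarrow> real"
  assumes "0 < a" and "a < b" and "0 < c\<^sub>l"
    and "optimal_design a b c\<^sub>l \<theta>"
  shows "\<exists>\<theta>' :: real \<Rightarrow> real.
           (AE t in leb01. \<theta> t = \<theta>' t) \<and> continuous_on {0..1} \<theta>' \<and>
           ((\<forall>t\<in>{0..1}. \<theta>' t = 0) \<or>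
            (\<exists>t\<^sub>0 t\<^sub>1. 0 \<le> t\<^sub>0 \<and> t\<^sub>0 < t\<^sub>1 \<and> t\<^sub>1 < 1 \<and>
               (0 < t\<^sub>0 \<longrightarrow> (\<forall>t\<in>{0<..<t\<^sub>0}. \<theta>' t = 1)) \<and>
               (\<forall>t\<in>{t\<^sub>0<..<t\<^sub>1}. \<theta>' t \<noteq> 0) \<and> strict_antimono_on {t\<^sub>0<..<t\<^sub>1} \<theta>' \<and>
               (\<forall>t\<in>{t\<^sub>1..1}. \<theta>' t = 0) \<and>
               smooth_on {t\<^sub>0<..<t\<^sub>1} \<theta>'))"
proof -
  note a = \<open>0 < a\<close> and ab = \<open>a < b\<close> and c = \<open>0 < c\<^sub>l\<close>
  \<comment> \<open>A representative with values in [0,1] at every point; it is again optimal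
    because the objective ignores null sets.\<close>
  define \<eta> where "\<eta> t = max 0 (min 1 (\<theta> t))" for t
  have \<theta>: "\<theta> \<in> designs" "\<theta> \<in> borel_measurable leb01" "AE t in leb01. \<theta> t \<in> {0..1}"
    using assms(4) by (auto simp: optimal_design_def is_arg_min_def designs_def)
  have \<eta>: "\<eta> \<in> borel_measurable leb01" "\<And>t. \<eta> t \<in> {0..1}"
    unfolding \<eta>_def[abs_def] by (intro borel_measurable_max borel_measurable_min borel_measurable_const \<theta>(2)) auto
  have \<theta>\<eta>: "AE t in leb01. \<theta> t = \<eta> t"
    using \<theta>(3) by eventually_elim (simp add: \<eta>_def)
  have "\<eta> \<in> designs" using \<eta> by (simp add: designs_def)
  then have opt: "optimal_design a b c\<^sub>l \<eta>"
    using assms(4) objective_cong_AE[OF \<theta>(2) \<eta>(1) \<theta>\<eta>] by (simp add: optimal_design_def is_arg_min_def)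
  let ?B = "stiffness a b \<eta>"
  note B = stiffness_measurable[OF \<eta>(1), of a b] stiffness_bounds(1)[where \<theta> = \<eta>, OF ab \<eta>(2)]
  obtain K U where st: "solves_state ?B K U"
    using solves_state_exists[OF B a] by blast
  have cK: "continuous_on {0..1} K" and cU: "continuous_on {0..1} U"
    using st primitive_continuous by (auto simp: solves_state_def)
  obtain P V where ad: "solves_adjoint ?B K P V"
    using solves_adjoint_exists[OF B a cK solves_state_sin_nonpos[OF st]] by blast
  have cV: "continuous_on {0..1} V"
    using ad primitive_continuous by (auto simp: solves_adjoint_def)
  define R where "R t = (b - a) / c\<^sub>l * (U t * V t)" for t
  define C where "C t = max a (min b (sqrt (R t)))" for t
  have BC: "AE t in leb01. ?B t = C t"
    using optimal_design_stiffness[OF a ab c opt \<eta> st ad] by (simp add: C_def R_def)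
  have cR: "continuous_on {0..1} R" unfolding R_def by (intro continuous_intros cU cV)
  have cC: "continuous_on {0..1} C" unfolding C_def by (intro continuous_intros cR)
  interpret stationary_system C K U P V
    by (rule stationary_system_of_solutions[OF st ad a B(2) BC cC]) (use a in \<open>simp add: C_def\<close>)
  have ratio: "0 < (b - a) / c\<^sub>l" using ab c by simp
  have R_pos: "0 < R t \<longleftrightarrow> 0 < U t * V t" for t
    unfolding R_def using ratio by (simp only: zero_less_mult_iff[of "(b - a) / c\<^sub>l"]) auto
  \<comment> \<open>The stiffness formula solved for the design, with the clamp in place of the
    stiffness.\<close>
  define \<theta>' where "\<theta>' t = (C t - a) / (b - a)" for t
  have "AE t in leb01. \<theta> t = \<theta>' t"
    using \<theta>\<eta> BC
  proof eventually_elim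
    case (elim t)
    have "?B t - a = \<eta> t * (b - a)" by (simp add: stiffness_def algebra_simps)
    then show ?case using elim ab by (simp add: \<theta>'_def)
  qed
  moreover have "continuous_on {0..1} \<theta>'"
    unfolding \<theta>'_def using ab by (intro continuous_intros cC) auto
  moreover have "(\<forall>t\<in>{0..1}. \<theta>' t = 0) \<or>
            (\<exists>t\<^sub>0 t\<^sub>1. 0 \<le> t\<^sub>0 \<and> t\<^sub>0 < t\<^sub>1 \<and> t\<^sub>1 < 1 \<and>
               (0 < t\<^sub>0 \<longrightarrow> (\<forall>t\<in>{0<..<t\<^sub>0}. \<theta>' t = 1)) \<and>
               (\<forall>t\<in>{t\<^sub>0<..<t\<^sub>1}. \<theta>' t \<noteq> 0) \<and> strict_antimono_on {t\<^sub>0<..<t\<^sub>1} \<theta>' \<and>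
               (\<forall>t\<in>{t\<^sub>1..1}. \<theta>' t = 0) \<and>
               smooth_on {t\<^sub>0<..<t\<^sub>1} \<theta>')"
    unfolding \<theta>'_def[abs_def] C_def
  proof (rule clamped_profile[OF a ab cR])
    show "R 1 = 0" by (simp add: R_def boundary)
    show "R t < R s" if "0 \<le> s" "s < t" "t \<le> 1" "0 < R t" for s t
      unfolding R_def using UV_decreasing[OF that(1-3)] that(4) ratio
      by (intro mult_strict_left_mono) (simp_all add: R_pos)
    show "smooth_on S (\<lambda>t. sqrt (R t))"
      if S: "open S" "S \<subseteq> {0<..<1}" "\<And>t. t \<in> S \<Longrightarrow> a\<^sup>2 < R t \<and> R t < b\<^sup>2" for S
      unfolding smooth_on_iff R_def
    proof (intro allI ntimes_diff_interior[OF S(1,2) ratio])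
      fix t assume "t \<in> S"
      then have R: "a\<^sup>2 < R t" "R t < b\<^sup>2" using S(3) by auto
      then have "0 < R t" using a by (smt (verit) zero_le_power2)
      have "sqrt (R t) < b" using R a ab \<open>0 < R t\<close> by (intro real_less_lsqrt) auto
      moreover have "a < sqrt (R t)" using R a by (intro real_less_rsqrt) auto
      ultimately have "C t = sqrt (R t)" by (simp add: C_def)
      then show "0 < U t * V t \<and> C t = sqrt ((b - a) / c\<^sub>l * (U t * V t))"
        using \<open>0 < R t\<close> R_pos[of t] by (simp add: R_def)
    qed
  qed
  ultimately show ?thesis by blast
qed

end
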